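(* Let $\phi(x)=\pi^{-d/4}e^{-|x|^2/2}$, $x\in\mathbf R^d$, let $\chi\in\mathcal R^\infty(\mathbf C^d)$ and let $f\in\mathscr S'(\mathbf R^d)$. Then the following conditions are equivalent: (1) $f\in\mathcal H_{0,\flat_1}(\mathbf R^d)$; (2) $f=V_\phi^*F$ for some $F\in\mathscr E'(\mathbf R^{2d})\cap L^\infty(\mathbf R^{2d})$ which satisfies $$F(x,\xi)=F_0(x-i\xi)\,e^{-i\langle x,\xi\rangle}\chi(x,\xi)$$ for some $F_0\in A(\mathbf C^d)$.
   Context: Notation: $\mathbf R_+=(0,\infty)$, $\mathbf N=\{0,1,2,\dots\}$. Inequalities between vectors are coordinatewise. $D_r(0)=\{z\in\mathbf C^d: |z_j|<r_j,\ j=1,\dots,d\}$; functions on $\mathbf C^d$ are regarded as functions on $\mathbf R^{2d}$ via $z=x+i\xi$. $A(\mathbf C^d)$ is the set of entire functions. $\langle x,\xi\rangle=\sum_jx_j\xi_j$. $g\lesssim h$ means $g\le Ch$ with $C>0$ independent of the variable. $\mathscr E'$ denotes compactly supported distributions. Hermite functions: $h_\alpha(x)=\pi^{-d/4}(-1)^{|\alpha|}(2^{|\alpha|}\alpha!)^{-1/2}e^{|x|^2/2}\partial^\alpha e^{-|x|^2}$, $\alpha\in\mathbf N^d$; $c_h(f,\alpha)=(f,h_\alpha)_{L^2}$. $\mathcal H_{0,\flat_1}(\mathbf R^d)$ is the set of $f\in L^2(\mathbf R^d)$ with $|c_h(f,\alpha)|\lesssim r^\alpha\alpha!^{-1/2}$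 for every $r\in\mathbf R_+^d$. For $t_1\le t_2$ in $\mathbf R_+^d$, $\mathcal R^\infty_{t_1,t_2}(\mathbf C^d)$ is the set of non-negative $\chi\in L^\infty(\mathbf C^d)$ with support in $\overline{D_{t_2}(0)}$, of the form $\chi(z)=\chi_0(|z_1|,\dots,|z_d|)$ for some function $\chi_0$, and such that $\chi\ge c$ on $D_{t_1}(0)$ for some constant $c>0$. $\mathcal R^\infty(\mathbf C^d)=\bigcup_{t_1\le t_2}\mathcal R^\infty_{t_1,t_2}(\mathbf C^d)$. $V_\phi^*$ is the adjoint of the short-time Fourier transform $V_\phi f(x,\xi)=\langle f,\overline{\phi(\cdot-x)}e^{-i\langle\cdot,\xi\rangle}\rangle$; for $F\in L^\infty\cap\mathscr E'$, $(V_\phi^*F)(x)=\iint F(y,\eta)\phi(x-y)e^{i\langle x,\eta\rangle}\,dy\,d\eta$ (constant normalising factors are immaterial here). *)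

theory Defs
  imports "HOL-Analysis.Analysis"
begin

section \<open>Multi-indices and partial derivatives\<close>

type_synonym 'n multi_index = "'n \<Rightarrow> nat"

definition mi_abs :: "'n::finite multi_index \<Rightarrow> nat" where
  "mi_abs \<alpha> = (\<Sum>j\<in>UNIV. \<alpha> j)"

definition mi_fact :: "'n::finite multi_index \<Rightarrow> real" where
  "mi_fact \<alpha> = (\<Prod>j\<in>UNIV. fact (\<alpha> j))"

definition mi_power :: "real^'n \<Rightarrow> 'n::finite multi_index \<Rightarrow> real" where
  "mi_power x \<alpha> = (\<Prod>j\<in>UNIV. (x $ j) ^ \<alpha> j)"

definition partial_deriv :: "'n::finite \<Rightarrow> (real^'n \<Rightarrow> 'b::real_normed_vector) \<Rightarrow> real^'n \<Rightarrow> 'b" where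
  "partial_deriv j f x = vector_derivative (\<lambda>t. f (x + t *\<^sub>R axis j 1)) (at 0)"

definition iter_partial :: "'n::finite list \<Rightarrow> (real^'n \<Rightarrow> 'b::real_normed_vector) \<Rightarrow> real^'n \<Rightarrow> 'b" where
  "iter_partial js f = foldr partial_deriv js f"

text \<open>\<open>mi_deriv \<alpha>\<close> is the operator usually written \<open>\<partial>\<^sup>\<alpha>\<close>. The order in which the partial
  derivatives are taken is left unspecified; it is immaterial on smooth functions, the only ones
  to which the operator is applied.\<close>

definition mi_deriv :: "'n::finite multi_index \<Rightarrow> (real^'n \<Rightarrow> 'b::real_normed_vector) \<Rightarrow> real^'n \<Rightarrow> 'b" where
  "mi_deriv \<alpha> f = iter_partial (SOME js. \<forall>j. count_list js j = \<alpha> j) f"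

definition smooth :: "(real^'n::finite \<Rightarrow> 'b::real_normed_vector) \<Rightarrow> bool" where
  "smooth f \<longleftrightarrow> (\<forall>js x. iter_partial js f differentiable (at x))"

section \<open>Tempered distributions\<close>

definition schwartz :: "(real^'n::finite \<Rightarrow> complex) set" where
  "schwartz = {\<psi>. smooth \<psi> \<and>
     (\<forall>\<alpha> \<beta>. bdd_above (range (\<lambda>x. norm (mi_power x \<alpha> *\<^sub>R mi_deriv \<beta> \<psi> x))))}"

definition schwartz_seminorm ::
    "'n::finite multi_index \<Rightarrow> 'n multi_index \<Rightarrow> (real^'n \<Rightarrow> complex) \<Rightarrow> real" where
  "schwartz_seminorm \<alpha> \<beta> \<psi> = (SUP x. norm (mi_power x \<alpha> *\<^sub>R mi_deriv \<beta> \<psi> x))"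

definition schwartz_topology :: "(real^'n::finite \<Rightarrow> complex) topology" where
  "schwartz_topology = topology_generated_by
     {{\<psi> \<in> schwartz. schwartz_seminorm \<alpha> \<beta> (\<lambda>x. \<psi> x - \<psi>\<^sub>0 x) < e} | \<alpha> \<beta> \<psi>\<^sub>0 e.
       \<psi>\<^sub>0 \<in> schwartz \<and> 0 < e}"

text \<open>Distributions are total HOL functions whose values outside \<^const>\<open>schwartz\<close> carry no
  information.\<close>

definition tempered_distribution :: "((real^'n::finite \<Rightarrow> complex) \<Rightarrow> complex) \<Rightarrow> bool" where
  "tempered_distribution u \<longleftrightarrow>
     (\<forall>\<psi>\<in>schwartz. \<forall>\<psi>'\<in>schwartz. u (\<lambda>x. \<psi> x + \<psi>' x) = u \<psi> + u \<psi>') \<and>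
     (\<forall>c. \<forall>\<psi>\<in>schwartz. u (\<lambda>x. c * \<psi> x) = c * u \<psi>) \<and>
     continuous_map schwartz_topology euclidean u"

text \<open>Equality in the space of tempered distributions between \<open>u\<close> and the function \<open>g\<close>.\<close>

definition dist_eq_fun :: "((real^'n::finite \<Rightarrow> complex) \<Rightarrow> complex) \<Rightarrow> (real^'n \<Rightarrow> complex) \<Rightarrow> bool" where
  "dist_eq_fun u g \<longleftrightarrow> (\<forall>\<psi>\<in>schwartz. u \<psi> = (LINT x|lebesgue. g x * \<psi> x))"

section \<open>Hermite coefficients\<close>

definition L2 :: "(real^'n::finite \<Rightarrow> complex) set" where
  "L2 = {f \<in> borel_measurable lebesgue. integrable lebesgue (\<lambda>x. (cmod (f x))\<^sup>2)}"

definition L2_inner :: "(real^'n::finite \<Rightarrow> complex) \<Rightarrow> (real^'n \<Rightarrow> complex) \<Rightarrow> complex" where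
  "L2_inner f g = (LINT x|lebesgue. f x * cnj (g x))"

definition hermite_fun :: "'n::finite multi_index \<Rightarrow> real^'n \<Rightarrow> real" where
  "hermite_fun \<alpha> x =
     pi powr (- real CARD('n) / 4) * (-1) ^ mi_abs \<alpha> * (2 ^ mi_abs \<alpha> * mi_fact \<alpha>) powr (- 1 / 2)
     * exp ((norm x)\<^sup>2 / 2) * mi_deriv \<alpha> (\<lambda>y. exp (- (norm y)\<^sup>2)) x"

definition hermite_coeff :: "(real^'n::finite \<Rightarrow> complex) \<Rightarrow> 'n multi_index \<Rightarrow> complex" where
  "hermite_coeff f \<alpha> = L2_inner f (\<lambda>x. complex_of_real (hermite_fun \<alpha> x))"

text \<open>The space \<open>\<H>\<^sub>0\<^sub>,\<^sub>\<flat>\<^sub>1(\<real>\<^sup>d)\<close>.\<close>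

definition H0_flat1 :: "(real^'n::finite \<Rightarrow> complex) set" where
  "H0_flat1 = {f \<in> L2. \<forall>r. (\<forall>j. 0 < r $ j) \<longrightarrow>
     (\<exists>C>0. \<forall>\<alpha>. cmod (hermite_coeff f \<alpha>) \<le> C * (mi_power r \<alpha> * mi_fact \<alpha> powr (- 1 / 2)))}"

section \<open>Functions on phase space\<close>

text \<open>The identification \<open>z = x + i\<xi>\<close> of \<open>\<real>\<^sup>2\<^sup>d\<close> with \<open>\<complex>\<^sup>d\<close>. Lebesgue measure is only
  used on the real side.\<close>

definition cplx_vec :: "real^'n::finite \<Rightarrow> real^'n \<Rightarrow> complex^'n" where
  "cplx_vec x \<xi> = (\<chi> j. Complex (x $ j) (\<xi> $ j))"

definition L_infty :: "((real^'n::finite) \<times> (real^'n) \<Rightarrow> 'b::euclidean_space) set" where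
  "L_infty = {g \<in> borel_measurable lebesgue. \<exists>C. AE p in lebesgue. norm (g p) \<le> C}"

text \<open>Support in the sense of distributions: the complement of the largest open set on which \<open>g\<close>
  vanishes almost everywhere.\<close>

definition ess_support :: "('a::euclidean_space \<Rightarrow> 'b::zero) \<Rightarrow> 'a set" where
  "ess_support g = - \<Union>{U. open U \<and> (AE p in lebesgue. p \<in> U \<longrightarrow> g p = 0)}"

definition polydisc :: "real^'n::finite \<Rightarrow> (complex^'n) set" where
  "polydisc r = {z. \<forall>j. cmod (z $ j) < r $ j}"

text \<open>Elements of \<open>L\<^sup>\<infinity>\<close> are only determined up to null sets, so all conditions on \<open>chi\<close> are
  imposed almost everywhere.\<close>

definition R_infty2 :: "real^'n::finite \<Rightarrow> real^'n \<Rightarrow> (complex^'n \<Rightarrow> real) set" where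
  "R_infty2 t\<^sub>1 t\<^sub>2 = {chi.
     (\<lambda>(x, \<xi>). chi (cplx_vec x \<xi>)) \<in> L_infty \<and>
     (AE (x, \<xi>) in lebesgue. 0 \<le> chi (cplx_vec x \<xi>)) \<and>
     ess_support (\<lambda>(x, \<xi>). chi (cplx_vec x \<xi>)) \<subseteq> {(x, \<xi>). cplx_vec x \<xi> \<in> closure (polydisc t\<^sub>2)} \<and>
     (\<exists>chi\<^sub>0 :: real^'n \<Rightarrow> real.
        AE (x, \<xi>) in lebesgue. chi (cplx_vec x \<xi>) = chi\<^sub>0 (\<chi> j. cmod (cplx_vec x \<xi> $ j))) \<and>
     (\<exists>c>0. AE (x, \<xi>) in lebesgue. cplx_vec x \<xi> \<in> polydisc t\<^sub>1 \<longrightarrow> c \<le> chi (cplx_vec x \<xi>))}"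

definition R_infty :: "(complex^'n::finite \<Rightarrow> real) set" where
  "R_infty = \<Union>{R_infty2 t\<^sub>1 t\<^sub>2 | t\<^sub>1 t\<^sub>2. \<forall>j. 0 < t\<^sub>1 $ j \<and> t\<^sub>1 $ j \<le> t\<^sub>2 $ j}"

definition entire :: "(complex^'n::finite \<Rightarrow> complex) set" where
  "entire = {G. \<forall>z. \<exists>L. (G has_derivative L) (at z) \<and> (\<forall>c v. L (c *s v) = c * L v)}"

section \<open>The adjoint short-time Fourier transform\<close>

definition stft_adjoint ::
    "(real^'n::finite \<Rightarrow> complex) \<Rightarrow> ((real^'n) \<times> (real^'n) \<Rightarrow> complex) \<Rightarrow> real^'n \<Rightarrow> complex" where
  "stft_adjoint \<phi> F x =
     (LINT (y, \<eta>)|lebesgue. F (y, \<eta>) * \<phi> (x - y) * exp (\<i> * complex_of_real (x \<bullet> \<eta>)))"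

definition gauss_window :: "real^'n::finite \<Rightarrow> complex" where
  "gauss_window x = complex_of_real (pi powr (- real CARD('n) / 4) * exp (- (norm x)\<^sup>2 / 2))"

end

theory Submission
  imports Defs "HOL-Probability.Probability" "HOL-Complex_Analysis.Complex_Analysis" "HOL-Real_Asymp.Real_Asymp"
begin

no_notation fps_nth (infixl "$" 75)

text \<open>Write \<open>w = y + i\<eta>\<close>. By Fubini, the generating function of the Hermite functions and the
  form of \<open>F\<close>, the Hermite coefficients of \<open>V\<^sub>\<phi>\<^sup>*F\<close> are \<open>(2\<^sup>\<bar>\<^sup>\<alpha>\<^sup>\<bar> \<alpha>!)\<^sup>-\<^sup>1\<^sup>/\<^sup>2 b\<^sub>\<alpha>\<close>, where
  \<open>b\<^sub>\<alpha> = \<integral> F\<^sub>0(w\<^sup>*) exp((w\<^sup>*\<^sup>2 - w\<^sup>2)/8) w\<^sup>\<alpha> d\<mu>\<close> with \<open>w\<^sup>*\<close> the conjugate of \<open>w\<close> and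
  \<open>d\<mu> = \<chi> exp(-\<bar>w\<bar>\<^sup>2/4) dw\<close> a compactly supported measure that is invariant under rotation of each
  coordinate. Membership in \<open>\<H>\<^sub>0\<^sub>,\<^sub>\<flat>\<^sub>1\<close> says that \<open>b\<close> decays faster than every geometric sequence.

  If \<open>F\<^sub>0\<close> is entire, then replacing \<open>w\<close> by \<open>\<lambda>w\<close> and \<open>w\<^sup>*\<close> by \<open>w\<^sup>*/\<lambda>\<close> in the integrand does not change
  the integral for \<open>\<bar>\<lambda>\<bar> = 1\<close>, hence for any \<open>\<lambda> \<noteq> 0\<close> by analyticity, and small \<open>\<lambda>\<close> gives the decay
  of \<open>b\<close>. Conversely, rotation invariance makes distinct monomials orthogonal for \<open>\<mu>\<close>, so for
  \<open>F\<^sub>0(u) exp(u\<^sup>2/8) = \<Sum> G\<^sub>\<beta> u\<^sup>\<beta>\<close> one gets \<open>b = exp(-L\<^sup>2/8) (G\<^sub>\<beta> m\<^sub>\<beta>)\<^sub>\<beta>\<close> with the moments \<open>m\<^sub>\<beta>\<close> of \<open>\<mu>\<close> and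
  \<open>L\<^sup>2\<close> the sum of the squared coordinate left shifts. Applying \<open>exp(L\<^sup>2/8)\<close> and dividing by \<open>m\<^sub>\<beta>\<close>, which is at least geometric, recovers
  an entire \<open>F\<^sub>0\<close> from \<open>b\<close>, and completeness of the Hermite functions in \<open>L\<^sup>2\<close> concludes.\<close>

section \<open>Derivatives of the Gaussian\<close>

text \<open>The constant 1/8 comes from completing squares. Pairing the window times exp(i x.\<eta>)
  with a Hermite function gives exp(-|y|^2/2 + w^2/4) w^\<alpha> up to constants, and together with
  the phase exp(-i y.\<eta>) of F the exponent becomes ((cnj w)^2 - w^2)/8 - |w|^2/4. The last term
  is rotation invariant and goes into the measure. The factor in cnj w is harmless, since F_0 can
  absorb it. The obstacle is exp(-w^2/8): it couples the moment of index \<alpha> to all those of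
  index \<alpha> + 2\<gamma>, so prescribing the moments is an infinite triangular system. Decay
  beyond every geometric rate makes all series involved absolutely convergent, so the formal inverse
  is a genuine one, and it leaves room for dividing by geometrically small moments. Those are
  controlled from below because \<chi> is bounded below near the origin. Completeness serves only as
  injectivity of the coefficient map on L^2: F_0 is built to have the right coefficients, and no
  Hermite expansion is ever summed.\<close>

fun gauss_deriv :: "nat \<Rightarrow> real \<Rightarrow> real" where
  "gauss_deriv 0 t = exp (- t\<^sup>2)"
| "gauss_deriv (Suc 0) t = - 2 * t * exp (- t\<^sup>2)"
| "gauss_deriv (Suc (Suc k)) t = - 2 * t * gauss_deriv (Suc k) t - 2 * (real k + 1) * gauss_deriv k t"

text \<open>Differentiating the recurrence reproduces it one index higher: the two resulting terms
  with index m + 1 merge and raise the coefficient to m + 2. So \<open>gauss_deriv k\<close> is the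
  k-th derivative of exp(-t^2), that is (-1)^k H_k(t) exp(-t^2) with the Hermite polynomial
  H_k.\<close>

lemma gauss_deriv_has_derivative:
  "(gauss_deriv k has_real_derivative gauss_deriv (Suc k) t) (at t)"
proof (induction k arbitrary: t rule: less_induct)
  case (less k)
  consider "k = 0" | "k = 1" | m where "k = Suc (Suc m)"
    by (metis One_nat_def not0_implies_Suc)
  then show ?case
  proof cases
    case 1
    have "((\<lambda>t. exp (- t\<^sup>2)) has_real_derivative - 2 * t * exp (- t\<^sup>2)) (at t)"
      by (auto intro!: derivative_eq_intros)
    then show ?thesis by (simp add: 1 gauss_deriv.simps(1)[abs_def])
  next
    case 2
    have "((\<lambda>t. - 2 * t * exp (- t\<^sup>2)) has_real_derivative
        - 2 * t * (- 2 * t * exp (- t\<^sup>2)) - 2 * exp (- t\<^sup>2)) (at t)"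
      by (auto intro!: derivative_eq_intros simp: algebra_simps)
    then show ?thesis by (simp add: 2 gauss_deriv.simps(2)[abs_def])
  next
    case 3
    have "((\<lambda>t. - 2 * t * gauss_deriv (Suc m) t - 2 * (real m + 1) * gauss_deriv m t) has_real_derivative
        - 2 * gauss_deriv (Suc m) t - 2 * t * gauss_deriv (Suc (Suc m)) t - 2 * (real m + 1) * gauss_deriv (Suc m) t) (at t)"
      using less[of m t] less[of "Suc m" t] 3
      by (auto intro!: derivative_eq_intros simp del: gauss_deriv.simps)
    moreover have "- 2 * gauss_deriv (Suc m) t - 2 * t * gauss_deriv (Suc (Suc m)) t
        - 2 * (real m + 1) * gauss_deriv (Suc m) t = gauss_deriv (Suc k) t"
      by (simp add: 3 algebra_simps)
    moreover have "(\<lambda>t. - 2 * t * gauss_deriv (Suc m) t - 2 * (real m + 1) * gauss_deriv m t) = gauss_deriv k"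
      by (simp add: 3 fun_eq_iff)
    ultimately show ?thesis by (simp only:)
  qed
qed

lemma continuous_gauss_deriv [continuous_intros]:
  "continuous_on A (gauss_deriv k)"
  by (meson gauss_deriv_has_derivative DERIV_isCont continuous_at_imp_continuous_on)

lemma borel_measurable_gauss_deriv [measurable]: "gauss_deriv k \<in> borel_measurable borel"
  by (intro borel_measurable_continuous_onI continuous_intros)

text \<open>The recurrence solved for the multiplication by t, which later trades powers of t for
  shifts of the Hermite index. At k = 0 the truncated \<open>k - 1\<close> does no harm, as its
  coefficient vanishes.\<close>

lemma times_gauss_deriv:
  "t * gauss_deriv k t = - (gauss_deriv (Suc k) t + 2 * real k * gauss_deriv (k - 1) t) / 2"
  by (cases k rule: nat.exhaust[case_product nat.exhaust]; cases k)
     (auto simp: algebra_simps elim: gauss_deriv.elims split: nat.splits)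

text \<open>The polynomial factor is replaced by exp(k |t|): each step of the recurrence costs one
  factor |t|, and |t| is at most exp |t|. This crude form avoids any bookkeeping of degrees and
  coefficients.\<close>

lemma gauss_deriv_bound:
  "\<exists>C\<ge>0. \<forall>t. \<bar>gauss_deriv k t\<bar> \<le> C * exp (real k * \<bar>t\<bar> - t\<^sup>2)"
proof (induction k rule: less_induct)
  case (less k)
  have te: "\<bar>t\<bar> \<le> exp \<bar>t\<bar>" for t :: real
    using exp_ge_add_one_self[of "\<bar>t\<bar>"] by linarith
  consider "k = 0" | "k = 1" | m where "k = Suc (Suc m)"
    by (metis One_nat_def not0_implies_Suc)
  then show ?case
  proof cases
    case 1
    then show ?thesis by (intro exI[of _ 1]) auto
  next
    case 2
    have "\<bar>gauss_deriv k t\<bar> \<le> 2 * exp (real k * \<bar>t\<bar> - t\<^sup>2)" for t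
      using mult_right_mono[OF te[of t], of "exp (- t\<^sup>2)"]
      by (simp add: 2 abs_mult exp_diff exp_minus field_simps)
    then show ?thesis by (intro exI[of _ 2]) auto
  next
    case 3
    from less[of "Suc m"] 3 obtain C where C: "C \<ge> 0"
      "\<And>t. \<bar>gauss_deriv (Suc m) t\<bar> \<le> C * exp (real (Suc m) * \<bar>t\<bar> - t\<^sup>2)" by auto
    from less[of m] 3 obtain D where D: "D \<ge> 0"
      "\<And>t. \<bar>gauss_deriv m t\<bar> \<le> D * exp (real m * \<bar>t\<bar> - t\<^sup>2)" by auto
    have "\<bar>gauss_deriv k t\<bar> \<le> (2 * C + 2 * (real m + 1) * D) * exp (real k * \<bar>t\<bar> - t\<^sup>2)" for t
    proof -
      have "\<bar>gauss_deriv k t\<bar> \<le> 2 * (\<bar>t\<bar> * \<bar>gauss_deriv (Suc m) t\<bar>) + 2 * (real m + 1) * \<bar>gauss_deriv m t\<bar>"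
        using abs_triangle_ineq4[of "- 2 * t * gauss_deriv (Suc m) t" "2 * (real m + 1) * gauss_deriv m t"]
        unfolding 3 gauss_deriv.simps abs_mult by simp
      moreover have "\<bar>t\<bar> * \<bar>gauss_deriv (Suc m) t\<bar> \<le> C * exp (real k * \<bar>t\<bar> - t\<^sup>2)"
      proof -
        have "\<bar>t\<bar> * \<bar>gauss_deriv (Suc m) t\<bar> \<le> exp \<bar>t\<bar> * (C * exp (real (Suc m) * \<bar>t\<bar> - t\<^sup>2))"
          by (intro mult_mono te C) auto
        then show ?thesis by (simp add: 3 algebra_simps flip: exp_add)
      qed
      moreover have "2 * (real m + 1) * \<bar>gauss_deriv m t\<bar> \<le> 2 * (real m + 1) * (D * exp (real k * \<bar>t\<bar> - t\<^sup>2))"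
      proof (rule mult_left_mono[OF order_trans[OF D(2)]])
        show "D * exp (real m * \<bar>t\<bar> - t\<^sup>2) \<le> D * exp (real k * \<bar>t\<bar> - t\<^sup>2)"
          using D(1) by (intro mult_left_mono) (auto simp: 3 algebra_simps)
      qed simp
      ultimately show ?thesis unfolding ring_distribs by linarith
    qed
    then show ?thesis using C D by (intro exI[of _ "2 * C + 2 * (real m + 1) * D"]) auto
  qed
qed

section \<open>Gaussian integrals against complex exponentials\<close>

lemma has_bochner_integral_gaussian_char:
  "has_bochner_integral lborel (\<lambda>t. exp (- (of_real t)\<^sup>2 + \<i> * of_real b * of_real t))
     (of_real (sqrt pi * exp (- b\<^sup>2 / 4)))"
proof -
  \<comment> \<open>Replacing t by t / sqrt 2 turns exp(-t^2) into the standard normal profile and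
    the frequency b into \<open>s\<close>, so the value is read off from the characteristic function
    of the normal law.\<close>
  define s where "s = b / sqrt 2"
  interpret S: real_distribution std_normal_distribution by (rule real_dist_normal_dist)
  have int: "integrable std_normal_distribution (\<lambda>t. iexp (s * t))"
    by (rule S.integrable_const_bound[where B = 1]) auto
  have val: "(LINT t|std_normal_distribution. iexp (s * t)) = exp (- s\<^sup>2 / 2)"
    using fun_cong[OF char_std_normal_distribution, of s] by (simp add: char_def)
  have "has_bochner_integral lborel (\<lambda>t. std_normal_density t *\<^sub>R iexp (s * t)) (exp (- s\<^sup>2 / 2))"
    unfolding has_bochner_integral_iff using int val
    by (subst (asm) integrable_density, simp, simp, simp, subst (asm) integral_density) auto
  then have "has_bochner_integral lborel (\<lambda>t. sqrt (2 * pi) *\<^sub>R (std_normal_density t *\<^sub>R iexp (s * t)))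
      (sqrt (2 * pi) *\<^sub>R complex_of_real (exp (- s\<^sup>2 / 2)))"
    by (rule has_bochner_integral_scaleR_right)
  also have "(\<lambda>t. sqrt (2 * pi) *\<^sub>R (std_normal_density t *\<^sub>R iexp (s * t))) =
      (\<lambda>t. exp (- (of_real (0 + (1 / sqrt 2) * t))\<^sup>2 + \<i> * of_real b * of_real (0 + (1 / sqrt 2) * t)))"
    by (rule ext) (simp add: std_normal_density_def s_def scaleR_conv_of_real exp_add power_divide
        exp_of_real mult.assoc exp_minus flip: of_real_power of_real_divide of_real_minus of_real_mult)
  also have "sqrt (2 * pi) *\<^sub>R complex_of_real (exp (- s\<^sup>2 / 2)) =
     complex_of_real (sqrt pi * exp (- b\<^sup>2 / 4)) /\<^sub>R \<bar>1 / sqrt 2\<bar>"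
    by (simp add: s_def scaleR_conv_of_real power_divide real_sqrt_mult)
  finally show ?thesis
    by (subst lborel_has_bochner_integral_real_affine_iff[where t = 0 and c = "1 / sqrt 2"]) simp_all
qed

text \<open>Only the imaginary part b of w is a frequency. The real part a is removed by the real
  translation by a/2, so no contour is shifted; completing the square leaves the constant factor
  \<open>c\<close>.\<close>

lemma has_bochner_integral_gaussian_exp:
  fixes w :: complex
  shows "has_bochner_integral lborel (\<lambda>t. exp (- (of_real t)\<^sup>2 + w * of_real t))
     (of_real (sqrt pi) * exp (w\<^sup>2 / 4))"
proof -
  obtain a b where w: "w = Complex a b" by (cases w)
  have w': "w = of_real a + \<i> * of_real b" by (simp add: w complex_eq_iff)
  define c where "c = exp (of_real (a\<^sup>2 / 4) + \<i> * of_real (a * b / 2))"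
  have "has_bochner_integral lborel (\<lambda>t. c * exp (- (of_real t)\<^sup>2 + \<i> * of_real b * of_real t))
     (c * of_real (sqrt pi * exp (- b\<^sup>2 / 4)))"
    by (intro has_bochner_integral_mult_right has_bochner_integral_gaussian_char)
  also have "(\<lambda>t. c * exp (- (of_real t)\<^sup>2 + \<i> * of_real b * of_real t)) =
     (\<lambda>t. exp (- (of_real (a / 2 + 1 * t))\<^sup>2 + w * of_real (a / 2 + 1 * t)))"
    by (rule ext, unfold c_def w' exp_add[symmetric], rule arg_cong[where f = exp])
      (simp add: power2_eq_square field_simps)
  also have "c * of_real (sqrt pi * exp (- b\<^sup>2 / 4)) = (of_real (sqrt pi) * exp (w\<^sup>2 / 4)) /\<^sub>R \<bar>1\<bar>"
    unfolding c_def w' of_real_mult exp_of_real[symmetric]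
    by (simp add: flip: exp_add, rule arg_cong[where f = exp])
      (simp add: power2_eq_square field_simps)
  finally show ?thesis
    by (subst lborel_has_bochner_integral_real_affine_iff[where t = "a / 2" and c = 1]) simp_all
qed

text \<open>Half of the Gaussian absorbs the exponential growth, by r |t| \<le> r^2/2 +
  t^2/2.\<close>

lemma exp_gauss_deriv_bound:
  "\<exists>C\<ge>0. \<forall>t. norm (exp (w * of_real t) * complex_of_real (gauss_deriv k t)) \<le> C * exp (- t\<^sup>2 / 2)"
proof -
  obtain D where D: "D \<ge> 0" "\<And>t. \<bar>gauss_deriv k t\<bar> \<le> D * exp (real k * \<bar>t\<bar> - t\<^sup>2)"
    using gauss_deriv_bound by blast
  define r where "r = cmod w + real k"
  have "norm (exp (w * of_real t) * complex_of_real (gauss_deriv k t)) \<le> D * exp (r\<^sup>2 / 2) * exp (- t\<^sup>2 / 2)" for t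
  proof -
    have "norm (exp (w * of_real t)) \<le> exp (cmod w * \<bar>t\<bar>)"
      using norm_exp[of "w * of_real t"] by (simp add: norm_mult)
    then have "norm (exp (w * of_real t) * complex_of_real (gauss_deriv k t))
        \<le> exp (cmod w * \<bar>t\<bar>) * (D * exp (real k * \<bar>t\<bar> - t\<^sup>2))"
      unfolding norm_mult norm_of_real by (intro mult_mono D) auto
    also have "\<dots> = D * exp (r * \<bar>t\<bar> - t\<^sup>2)"
      by (simp add: r_def algebra_simps flip: exp_add)
    also have "\<dots> \<le> D * exp (r\<^sup>2 / 2 - t\<^sup>2 / 2)"
    proof (intro mult_left_mono D iffD2[OF exp_le_cancel_iff])
      have "0 \<le> (r - \<bar>t\<bar>)\<^sup>2" by simp
      then show "r * \<bar>t\<bar> - t\<^sup>2 \<le> r\<^sup>2 / 2 - t\<^sup>2 / 2"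
        unfolding power2_diff by (simp add: field_simps)
    qed
    finally show ?thesis by (simp add: mult.assoc flip: exp_add)
  qed
  then show ?thesis using D by (intro exI[of _ "D * exp (r\<^sup>2 / 2)"]) auto
qed

lemma integrable_exp_neg_half_square: "integrable lborel (\<lambda>t::real. exp (- t\<^sup>2 / 2))"
proof -
  have "integrable lborel (\<lambda>t. sqrt (2 * pi) * std_normal_density t)"
    by (intro integrable_mult_right integrable_normal_density) auto
  then show ?thesis by (simp add: std_normal_density_def)
qed

lemma integrable_exp_gauss_deriv:
  "integrable lborel (\<lambda>t. exp (w * of_real t) * complex_of_real (gauss_deriv k t))"
proof -
  obtain C where C: "\<And>t. norm (exp (w * of_real t) * complex_of_real (gauss_deriv k t)) \<le> C * exp (- t\<^sup>2 / 2)"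
    using exp_gauss_deriv_bound by blast
  show ?thesis
  proof (rule Bochner_Integration.integrable_bound)
    show "integrable lborel (\<lambda>t::real. C * exp (- t\<^sup>2 / 2))"
      by (intro integrable_mult_right integrable_exp_neg_half_square)
    show "AE t in lborel. norm (exp (w * of_real t) * complex_of_real (gauss_deriv k t)) \<le> norm (C * exp (- t\<^sup>2 / 2))"
      using C by (intro AE_I2) (auto intro: order_trans[OF _ abs_ge_self])
    show "(\<lambda>t. exp (w * of_real t) * complex_of_real (gauss_deriv k t)) \<in> borel_measurable lborel"
      by measurable
  qed
qed

lemma tendsto_exp_gauss_deriv:
  assumes "F = at_top \<or> F = at_bot"
  shows "((\<lambda>t. exp (w * of_real t) * complex_of_real (gauss_deriv k t)) \<longlongrightarrow> 0) F"
proof -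
  obtain C where C: "\<And>t. norm (exp (w * of_real t) * complex_of_real (gauss_deriv k t)) \<le> C * exp (- t\<^sup>2 / 2)"
    using exp_gauss_deriv_bound by blast
  have "((\<lambda>t::real. C * exp (- t\<^sup>2 / 2)) \<longlongrightarrow> 0) at_top" "((\<lambda>t::real. C * exp (- t\<^sup>2 / 2)) \<longlongrightarrow> 0) at_bot"
    by real_asymp+
  with assms have "((\<lambda>t::real. C * exp (- t\<^sup>2 / 2)) \<longlongrightarrow> 0) F" by auto
  then show ?thesis
    by (rule Lim_null_comparison[rotated]) (use C in \<open>auto intro: always_eventually\<close>)
qed

text \<open>Integration by parts: the derivative of \<open>P k\<close> is w \<open>P k\<close> +
  \<open>P (Suc k)\<close>, and \<open>P k\<close> vanishes at both ends of the line, so each order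
  of differentiation contributes a factor -w to the Gaussian integral.\<close>

lemma integral_exp_gauss_deriv:
  "(LINT t|lborel. exp (w * of_real t) * complex_of_real (gauss_deriv k t))
     = (- w) ^ k * (of_real (sqrt pi) * exp (w\<^sup>2 / 4))"
proof (induction k)
  case 0
  show ?case
    using has_bochner_integral_integral_eq[OF has_bochner_integral_gaussian_exp[of w]]
    by (simp add: exp_diff exp_minus field_simps flip: exp_of_real of_real_power)
next
  case (Suc k)
  define P where "P k t = exp (w * of_real t) * complex_of_real (gauss_deriv k t)" for k t
  have int: "integrable lborel (P k)" for k
    unfolding P_def by (rule integrable_exp_gauss_deriv)
  have cont: "continuous_on UNIV (P k)" for k
    unfolding P_def by (intro continuous_intros)
  have d: "(P k has_vector_derivative (w * P k t + P (Suc k) t)) (at t)" for t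
  proof -
    have "((\<lambda>t. exp (w * of_real t)) has_vector_derivative w * exp (w * of_real t)) (at t)"
      by (rule has_vector_derivative_real_field) (auto intro!: derivative_eq_intros)
    from has_vector_derivative_mult[OF this has_vector_derivative_of_real[OF gauss_deriv_has_derivative[of k t]]]
    show ?thesis
      unfolding P_def by (simp add: mult.assoc add.commute del: gauss_deriv.simps)
  qed
  have "(LBINT t=-\<infinity>..\<infinity>. w * P k t + P (Suc k) t) = 0 - 0"
  proof (rule interval_integral_FTC_integrable[where F = "P k"])
    show "isCont (\<lambda>t. w * P k t + P (Suc k) t) x" for x
      using cont[of k] cont[of "Suc k"] unfolding continuous_on_eq_continuous_at[OF open_UNIV]
      by (intro isCont_add isCont_mult continuous_const) (simp_all del: gauss_deriv.simps)
    show "set_integrable lborel (einterval (- \<infinity>) \<infinity>) (\<lambda>t. w * P k t + P (Suc k) t)"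
      using int[of k] int[of "Suc k"] by (simp add: set_integrable_def einterval_def)
    show "((P k \<circ> real_of_ereal) \<longlongrightarrow> 0) (at_right (- \<infinity>))"
      unfolding P_def unfolding ereal_tendsto_simps by (rule tendsto_exp_gauss_deriv, simp)
    show "((P k \<circ> real_of_ereal) \<longlongrightarrow> 0) (at_left \<infinity>)"
      unfolding P_def unfolding ereal_tendsto_simps by (rule tendsto_exp_gauss_deriv, simp)
  qed (use d in simp_all)
  then have "(LINT t|lborel. w * P k t + P (Suc k) t) = 0"
    by (simp add: interval_integral_to_infinity_eq interval_lebesgue_integral_def einterval_def set_lebesgue_integral_def)
  then have "w * (LINT t|lborel. P k t) + (LINT t|lborel. P (Suc k) t) = 0"
    using int by simp
  then show ?case
    using Suc by (simp add: P_def eq_neg_iff_add_eq_0 algebra_simps del: gauss_deriv.simps)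
qed

text \<open>Fubini for finite products, after \<open>lborel\<close> has been written as the image of
  a product of real Lebesgue measures indexed by \<open>Basis\<close>. The map \<open>idx\<close>
  recovers the coordinate that a basis vector stands for.\<close>

lemma
  fixes f :: "'n::finite \<Rightarrow> real \<Rightarrow> complex"
  assumes "\<And>j. integrable lborel (f j)"
  shows integrable_lborel_vec_prod:
      "integrable (lborel :: (real^'n) measure) (\<lambda>x. \<Prod>j\<in>UNIV. f j (x $ j))" (is ?A)
    and integral_lborel_vec_prod:
      "(LINT x|(lborel :: (real^'n) measure). (\<Prod>j\<in>UNIV. f j (x $ j))) = (\<Prod>j\<in>UNIV. LINT t|lborel. f j t)" (is ?B)
proof -
  let ?Ba = "Basis :: (real^'n) set"
  let ?T = "\<lambda>g. \<Sum>b\<in>?Ba. g b *\<^sub>R b"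
  define idx where "idx b = (THE j. b = axis j (1::real))" for b :: "real^'n"
  have idx: "idx (axis j 1) = j" for j
    unfolding idx_def by (auto simp: axis_eq_axis)
  have bas: "?Ba = range (\<lambda>j. axis j 1)" by (auto simp: Basis_vec_def)
  have inj: "inj (\<lambda>j::'n. axis j (1::real))" by (auto simp: inj_on_def axis_eq_axis)
  interpret product_sigma_finite "\<lambda>b::real^'n. lborel :: real measure" ..
  have [measurable]: "f j \<in> borel_measurable borel" for j
    using borel_measurable_integrable[OF assms[of j]] by simp
  have meas: "(\<lambda>x::real^'n. \<Prod>j\<in>UNIV. f j (x $ j)) \<in> borel_measurable borel"
    by measurable
  have T: "?T \<in> measurable (\<Pi>\<^sub>M b\<in>?Ba. lborel) borel"
    by measurable
  have eq: "(\<Prod>j\<in>UNIV. f j (?T g $ j)) = (\<Prod>b\<in>?Ba. f (idx b) (g b))" for g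
  proof -
    have "?T g $ j = g (axis j 1)" for j
    proof -
      have "?T g $ j = ?T g \<bullet> axis j 1" by (simp add: inner_axis)
      also have "\<dots> = g (axis j 1)" by (rule inner_sum_left_Basis) (auto simp: Basis_vec_def)
      finally show ?thesis .
    qed
    then show ?thesis
      by (simp add: bas prod.reindex[OF inj] idx)
  qed
  have E: "(lborel :: (real^'n) measure) = distr (\<Pi>\<^sub>M b\<in>?Ba. lborel) borel ?T"
    by (rule lborel_eq)
  show ?A
    by (subst E, subst integrable_distr_eq[OF T meas], unfold eq, rule product_integrable_prod) (auto intro: assms)
  have "(LINT x|(lborel :: (real^'n) measure). (\<Prod>j\<in>UNIV. f j (x $ j))) = (\<Prod>b\<in>?Ba. LINT t|lborel. f (idx b) t)"
    by (subst E, subst integral_distr[OF T meas], unfold eq, rule product_integral_prod) (auto intro: assms)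
  then show ?B
    by (simp add: bas prod.reindex[OF inj] idx)
qed

section \<open>Hermite functions\<close>

text \<open>Isolates the one factor affected by a further derivative in direction j; the others act
  as constants in the induction below.\<close>

lemma prod_count_list_Cons:
  fixes q :: "nat \<Rightarrow> real \<Rightarrow> real" and x :: "real^'n::finite"
  shows "(\<Prod>i\<in>UNIV. q (count_list (j # js) i) (x $ i)) =
    q (Suc (count_list js j)) (x $ j) * (\<Prod>i\<in>UNIV - {j}. q (count_list js i) (x $ i))"
  by (subst prod.remove[of UNIV j]) (auto intro!: prod.cong)

text \<open>The Gaussian is a product of one-variable functions and each partial derivative acts on
  one factor. The result depends on the list only through its counts, so the unspecified order in
  \<open>mi_deriv\<close> is immaterial here.\<close>

lemma iter_partial_gaussian:
  "iter_partial js (\<lambda>y::real^'n::finite. exp (- (norm y)\<^sup>2)) =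
     (\<lambda>x. \<Prod>i\<in>UNIV. gauss_deriv (count_list js i) (x $ i))"
proof (induction js)
  case Nil
  have "exp (- (norm x)\<^sup>2) = (\<Prod>i\<in>UNIV. exp (- (x $ i)\<^sup>2))" for x :: "real^'n"
    unfolding norm_vec_def L2_set_def
    by (simp add: sum_nonneg exp_sum[symmetric] sum_negf)
  then show ?case by (simp add: iter_partial_def)
next
  case (Cons j js)
  have "((\<lambda>t. \<Prod>i\<in>UNIV. gauss_deriv (count_list js i) ((x + t *\<^sub>R axis j 1) $ i)) has_vector_derivative
      (\<Prod>i\<in>UNIV. gauss_deriv (count_list (j # js) i) (x $ i))) (at 0)" for x :: "real^'n"
  proof -
    have "(\<lambda>t. \<Prod>i\<in>UNIV. gauss_deriv (count_list js i) ((x + t *\<^sub>R axis j 1) $ i)) =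
      (\<lambda>t. gauss_deriv (count_list js j) (x $ j + t) * (\<Prod>i\<in>UNIV - {j}. gauss_deriv (count_list js i) (x $ i)))"
      by (subst prod.remove[of UNIV j]) (auto intro!: prod.cong simp: axis_def)
    moreover have "((\<lambda>t. gauss_deriv (count_list js j) (x $ j + t)) has_real_derivative
       gauss_deriv (Suc (count_list js j)) (x $ j)) (at 0)"
      using gauss_deriv_has_derivative[of "count_list js j" "x $ j"]
        DERIV_shift[of "gauss_deriv (count_list js j)" _ 0 "x $ j"] by (simp add: add.commute)
    ultimately show ?thesis
      unfolding prod_count_list_Cons has_real_derivative_iff_has_vector_derivative[symmetric]
      by (auto intro!: derivative_eq_intros simp del: gauss_deriv.simps)
  qed
  then have "vector_derivative (\<lambda>t. \<Prod>i\<in>UNIV. gauss_deriv (count_list js i) ((x + t *\<^sub>R axis j 1) $ i)) (at 0)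
      = (\<Prod>i\<in>UNIV. gauss_deriv (count_list (j # js) i) (x $ i))" for x :: "real^'n"
    by (rule vector_derivative_at)
  then show ?case
    using Cons by (simp add: iter_partial_def partial_deriv_def[abs_def] fun_eq_iff)
qed

text \<open>Guarantees that the choice operator in \<open>mi_deriv\<close> selects a list with the
  required counts.\<close>

lemma ex_count_list:
  fixes \<alpha> :: "'n::finite \<Rightarrow> nat"
  shows "\<exists>js. \<forall>j. count_list js j = \<alpha> j"
proof -
  obtain js where "mset js = (\<Sum>j\<in>UNIV. replicate_mset (\<alpha> j) j)"
    using ex_mset by blast
  then have "count (mset js) j = \<alpha> j" for j
    by (simp add: count_sum if_distrib sum.delta cong: if_cong)
  then show ?thesis by (auto simp: count_mset_0_iff count_mset)
qed

lemma mi_deriv_gaussian: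
  "mi_deriv \<alpha> (\<lambda>y::real^'n::finite. exp (- (norm y)\<^sup>2)) x = (\<Prod>i\<in>UNIV. gauss_deriv (\<alpha> i) (x $ i))"
proof -
  have "\<forall>j. count_list (SOME js. \<forall>j. count_list js j = \<alpha> j) j = \<alpha> j"
    by (rule someI_ex[OF ex_count_list])
  then show ?thesis
    unfolding mi_deriv_def iter_partial_gaussian by simp
qed

definition hermite_const :: "'n::finite multi_index \<Rightarrow> real" where
  "hermite_const \<alpha> = pi powr (- real CARD('n) / 4) * (-1) ^ mi_abs \<alpha> * (2 ^ mi_abs \<alpha> * mi_fact \<alpha>) powr (- 1 / 2)"

lemma mi_fact_pos: "mi_fact \<alpha> > 0"
  by (simp add: mi_fact_def prod_pos)

lemma hermite_const_nonzero: "hermite_const \<alpha> \<noteq> 0"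
  using mi_fact_pos[of \<alpha>] by (simp add: hermite_const_def)

lemma hermite_fun_eq:
  "hermite_fun \<alpha> x = hermite_const \<alpha> * (\<Prod>i\<in>UNIV. exp ((x $ i)\<^sup>2 / 2) * gauss_deriv (\<alpha> i) (x $ i))"
proof -
  have "exp ((norm x)\<^sup>2 / 2) = (\<Prod>i\<in>UNIV. exp ((x $ i)\<^sup>2 / 2))"
    unfolding norm_vec_def L2_set_def
    by (simp add: sum_nonneg exp_sum[symmetric] sum_divide_distrib)
  then show ?thesis
    by (simp add: hermite_fun_def hermite_const_def mi_deriv_gaussian prod.distrib)
qed

text \<open>The inequality k |t| \<le> k^2 + t^2/4 spends half of the remaining exponent -t^2/2. The
  envelope exp(-t^2/4) is the one demanded of every factor in
  \<open>integrable_L2_mult_prod\<close>.\<close>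

lemma exp_half_gauss_deriv_bound:
  "\<exists>C\<ge>0. \<forall>t. \<bar>exp (t\<^sup>2 / 2) * gauss_deriv k t\<bar> \<le> C * exp (- t\<^sup>2 / 4)"
proof -
  obtain D where D: "D \<ge> 0" "\<And>t. \<bar>gauss_deriv k t\<bar> \<le> D * exp (real k * \<bar>t\<bar> - t\<^sup>2)"
    using gauss_deriv_bound by blast
  have "\<bar>exp (t\<^sup>2 / 2) * gauss_deriv k t\<bar> \<le> D * exp ((real k)\<^sup>2) * exp (- t\<^sup>2 / 4)" for t
  proof -
    have "\<bar>exp (t\<^sup>2 / 2) * gauss_deriv k t\<bar> \<le> exp (t\<^sup>2 / 2) * (D * exp (real k * \<bar>t\<bar> - t\<^sup>2))"
      unfolding abs_mult abs_exp_cancel by (intro mult_left_mono D) auto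
    also have "\<dots> = D * exp (real k * \<bar>t\<bar> - t\<^sup>2 / 2)"
      by (simp add: algebra_simps flip: exp_add)
    also have "\<dots> \<le> D * exp ((real k)\<^sup>2 - t\<^sup>2 / 4)"
    proof (intro mult_left_mono D iffD2[OF exp_le_cancel_iff])
      have "0 \<le> (real k - \<bar>t\<bar> / 2)\<^sup>2" by simp
      then show "real k * \<bar>t\<bar> - t\<^sup>2 / 2 \<le> (real k)\<^sup>2 - t\<^sup>2 / 4"
        unfolding power2_diff by (simp add: field_simps)
    qed
    finally show ?thesis by (simp add: mult.assoc flip: exp_add)
  qed
  then show ?thesis using D by (intro exI[of _ "D * exp ((real k)\<^sup>2)"]) auto
qed

lemma integrable_exp_neg_quarter_square: "integrable lborel (\<lambda>t::real. exp (- t\<^sup>2 / 4))"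
proof -
  have "integrable lborel (\<lambda>t. sqrt (2 * pi * (sqrt 2)\<^sup>2) * normal_density 0 (sqrt 2) t)"
    by (intro integrable_mult_right integrable_normal_density) auto
  then show ?thesis by (simp add: normal_density_def)
qed

lemma integrable_exp_half_gauss_deriv:
  "integrable lborel (\<lambda>t. exp (t\<^sup>2 / 2) * gauss_deriv k t)"
proof -
  obtain C where C: "\<And>t. \<bar>exp (t\<^sup>2 / 2) * gauss_deriv k t\<bar> \<le> C * exp (- t\<^sup>2 / 4)"
    using exp_half_gauss_deriv_bound by blast
  show ?thesis
  proof (rule Bochner_Integration.integrable_bound)
    show "integrable lborel (\<lambda>t::real. C * exp (- t\<^sup>2 / 4))"
      by (intro integrable_mult_right integrable_exp_neg_quarter_square)
    show "AE t in lborel. norm (exp (t\<^sup>2 / 2) * gauss_deriv k t) \<le> norm (C * exp (- t\<^sup>2 / 4))"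
      using C by (intro AE_I2) (auto intro: order_trans[OF _ abs_ge_self])
  qed measurable
qed

lemma borel_measurable_hermite_fun [measurable]: "hermite_fun \<alpha> \<in> borel_measurable borel"
  unfolding hermite_fun_eq[abs_def] by measurable

lemma integrable_hermite_fun:
  "integrable lborel (\<lambda>x. complex_of_real (hermite_fun \<alpha> x))"
proof -
  have "integrable lborel (\<lambda>x::real^'a. \<Prod>i\<in>UNIV. complex_of_real (exp ((x $ i)\<^sup>2 / 2) * gauss_deriv (\<alpha> i) (x $ i)))"
    by (rule integrable_lborel_vec_prod) (rule integrable_of_real[OF integrable_exp_half_gauss_deriv])
  then show ?thesis
    unfolding hermite_fun_eq of_real_mult of_real_prod by (rule integrable_mult_right)
qed

lemma exp_norm_square_vec:
  fixes x :: "real^'n::finite"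
  shows "exp (c * (norm x)\<^sup>2) = (\<Prod>i\<in>UNIV. exp (c * (x $ i)\<^sup>2))"
  unfolding norm_vec_def L2_set_def
  by (simp add: sum_nonneg exp_sum[symmetric] sum_distrib_left)

text \<open>The weight exp(-|x|^2/2) cancels the growing exponential in the Hermite function, so the
  integrand is a product of the one-variable functions treated in
  \<open>integral_exp_gauss_deriv\<close>. This is the integrated form of the generating
  function.\<close>

lemma integral_exp_hermite_fun:
  fixes w :: "complex^'n::finite"
  shows "(LINT x|lborel. exp (\<Sum>j\<in>UNIV. w $ j * of_real (x $ j)) * of_real (exp (- (norm x)\<^sup>2 / 2) * hermite_fun \<alpha> x))
    = of_real (pi powr (real CARD('n) / 4) * (2 ^ mi_abs \<alpha> * mi_fact \<alpha>) powr (- 1 / 2))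
      * (\<Prod>j\<in>UNIV. (w $ j) ^ \<alpha> j) * exp (\<Sum>j\<in>UNIV. (w $ j)\<^sup>2 / 4)"
proof -
  define P where "P j t = exp (w $ j * of_real t) * complex_of_real (gauss_deriv (\<alpha> j) t)" for j t
  have "exp (\<Sum>j\<in>UNIV. w $ j * of_real (x $ j)) * of_real (exp (- (norm x)\<^sup>2 / 2) * hermite_fun \<alpha> x) =
      of_real (hermite_const \<alpha>) * (\<Prod>j\<in>UNIV. P j (x $ j))" for x :: "real^'n"
  proof -
    have "exp (- (norm x)\<^sup>2 / 2) * hermite_fun \<alpha> x = hermite_const \<alpha> * (\<Prod>j\<in>UNIV. gauss_deriv (\<alpha> j) (x $ j))"
    proof -
      have "exp (- (norm x)\<^sup>2 / 2) = (\<Prod>i\<in>UNIV. exp (- ((x $ i)\<^sup>2 / 2)))"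
        using exp_norm_square_vec[of "- (1 / 2)" x] by simp
      moreover have cancel: "exp (t\<^sup>2 / 2) * (exp (- (t\<^sup>2 / 2)) * y) = y" for t y :: real
        by (simp add: exp_minus)
      ultimately show ?thesis
        by (simp add: hermite_fun_eq mult.left_commute cancel flip: prod.distrib)
    qed
    then show ?thesis
      unfolding P_def by (simp add: exp_sum prod.distrib)
  qed
  then have "(LINT x|lborel. exp (\<Sum>j\<in>UNIV. w $ j * of_real (x $ j)) * of_real (exp (- (norm x)\<^sup>2 / 2) * hermite_fun \<alpha> x))
    = of_real (hermite_const \<alpha>) * (\<Prod>j\<in>UNIV. LINT t|lborel. P j t)"
    by (simp add: P_def integral_lborel_vec_prod[OF integrable_exp_gauss_deriv] del: of_real_mult)
  also have "\<dots> = of_real (hermite_const \<alpha>) * ((- 1) ^ mi_abs \<alpha> * of_real (sqrt pi ^ CARD('n))) *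
      (\<Prod>j\<in>UNIV. (w $ j) ^ \<alpha> j) * exp (\<Sum>j\<in>UNIV. (w $ j)\<^sup>2 / 4)"
    unfolding P_def integral_exp_gauss_deriv power_minus[of "_ $ _"]
    by (simp add: prod.distrib exp_sum mi_abs_def power_sum)
  \<comment> \<open>The sign in \<open>hermite_const\<close> meets the one from (-w)^\<alpha> and
    squares to 1, and sqrt pi to the power d is the square of pi^(d/4), one factor of which cancels
    the normalisation.\<close>
  also have "of_real (hermite_const \<alpha>) * ((- 1) ^ mi_abs \<alpha> * of_real (sqrt pi ^ CARD('n))) =
     complex_of_real (pi powr (real CARD('n) / 4) * (2 ^ mi_abs \<alpha> * mi_fact \<alpha>) powr (- 1 / 2))"
  proof -
    define a where "a = pi powr (real CARD('n) / 4)"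
    define c where "c = (2 ^ mi_abs \<alpha> * mi_fact \<alpha>) powr (- 1 / 2)"
    have "sqrt pi ^ CARD('n) = pi powr (real CARD('n) / 2)"
      by (simp add: powr_half_sqrt[symmetric] powr_powr flip: powr_realpow)
    also have "\<dots> = a * a"
      by (simp add: a_def flip: powr_add)
    finally have s: "sqrt pi ^ CARD('n) = a * a" .
    have "hermite_const \<alpha> = inverse a * (-1) ^ mi_abs \<alpha> * c"
      by (simp add: hermite_const_def a_def c_def powr_minus[symmetric])
    then have "hermite_const \<alpha> * ((- 1) ^ mi_abs \<alpha> * sqrt pi ^ CARD('n)) =
        (inverse a * a) * ((-1) ^ mi_abs \<alpha> * (-1) ^ mi_abs \<alpha>) * (a * c)"
      unfolding s by (simp only: ac_simps)
    also have "\<dots> = a * c"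
      by (simp add: a_def flip: power_add mult_2)
    finally have "hermite_const \<alpha> * ((- 1) ^ mi_abs \<alpha> * sqrt pi ^ CARD('n)) =
        pi powr (real CARD('n) / 4) * (2 ^ mi_abs \<alpha> * mi_fact \<alpha>) powr (- 1 / 2)"
      by (simp add: a_def c_def)
    from arg_cong[OF this, of complex_of_real] show ?thesis
      by (simp only: of_real_mult of_real_power of_real_minus of_real_1)
  qed
  finally show ?thesis .
qed

section \<open>Completeness of the Hermite functions\<close>

text \<open>Uniqueness of characteristic functions for a signed density. The positive and negative
  parts of h have the same mass m, by the hypothesis at frequency 0; divided by m, their images
  under \<open>u\<close> are probability laws with equal characteristic functions, hence equal by
  Levy.\<close>

lemma signed_char_zero_imp_indicator_zero_real:
  fixes h :: "'a \<Rightarrow> real" and u :: "'a \<Rightarrow> real"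
  assumes int: "integrable M h" and u [measurable]: "u \<in> borel_measurable M"
    and zero: "\<And>s. (LINT x|M. complex_of_real (h x) * iexp (s * u x)) = 0"
    and A [measurable]: "A \<in> sets borel"
  shows "(LINT x|M. h x * indicator A (u x)) = 0"
proof -
  define p n where "p x = max 0 (h x)" and "n x = max 0 (- h x)" for x
  have [measurable]: "h \<in> borel_measurable M" using int by auto
  have pn: "h x = p x - n x" for x by (auto simp: p_def n_def)
  have int': "integrable M p" "integrable M n"
    unfolding p_def n_def using int by auto
  have intb: "integrable M (\<lambda>x. complex_of_real (q x) * iexp (s * u x))" if "integrable M q" for q s
    by (rule Bochner_Integration.integrable_bound[OF that]) (use that in \<open>auto simp: norm_mult\<close>)
  have inti: "integrable M (\<lambda>x. q x * indicator A (u x))" if "integrable M q" for q :: "'a \<Rightarrow> real"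
    by (rule Bochner_Integration.integrable_bound[OF that])
       (use that in \<open>auto simp: indicator_def intro!: AE_I2\<close>)
  define m where "m = (LINT x|M. p x)"
  have mn: "m = (LINT x|M. n x)"
  proof -
    have "complex_of_real (LINT x|M. h x) = 0"
      using zero[of 0] by simp
    then have "(LINT x|M. h x) = 0" by simp
    then show ?thesis unfolding pn m_def using int' by simp
  qed
  show ?thesis
  \<comment> \<open>Normalisation is impossible if m = 0, but then both parts vanish almost
    everywhere.\<close>
  proof (cases "m = 0")
    case True
    then have "AE x in M. p x = 0" "AE x in M. n x = 0"
      using integral_nonneg_eq_0_iff_AE[OF int'(1)] integral_nonneg_eq_0_iff_AE[OF int'(2)] mn
      unfolding m_def by (simp_all add: p_def[abs_def] n_def[abs_def])
    then have "AE x in M. h x * indicator A (u x) = 0" by eventually_elim (simp add: pn)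
    then show ?thesis by (simp add: integral_eq_zero_AE)
  next
    case False
    have "m \<ge> 0" unfolding m_def p_def by (rule integral_nonneg_AE) auto
    with False have m: "m > 0" by simp
    define D where "D q = distr (density M (\<lambda>x. ennreal (q x / m))) borel u" for q
    have dist: "real_distribution (D q)"
      and charD: "char (D q) s = (LINT x|M. complex_of_real (q x) * iexp (s * u x)) / of_real m"
      and measD: "measure (D q) A = (LINT x|M. q x * indicator A (u x)) / m"
      if q: "integrable M q" "\<And>x. q x \<ge> 0" "(LINT x|M. q x) = m" for q s
    proof -
      have [measurable]: "q \<in> borel_measurable M" using q by auto
      have "emeasure (D q) UNIV = (\<integral>\<^sup>+x. ennreal (q x / m) \<partial>M)"
        unfolding D_def by (subst emeasure_distr) (auto simp: emeasure_density space_density cong: nn_integral_cong)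
      also have "\<dots> = ennreal (LINT x|M. q x / m)"
        by (rule nn_integral_eq_integral) (use q m in auto)
      finally have "emeasure (D q) UNIV = 1" using q m by simp
      then interpret D: prob_space "D q"
        by (intro prob_spaceI) (simp add: D_def)
      show "real_distribution (D q)"
        by unfold_locales (simp_all add: D_def)
      show "char (D q) s = (LINT x|M. complex_of_real (q x) * iexp (s * u x)) / of_real m"
        unfolding char_def D_def
        by (subst integral_distr, simp, simp, subst integral_density)
           (use q m in \<open>auto simp: scaleR_conv_of_real field_simps simp flip: Bochner_Integration.integral_divide_zero\<close>)
      have "measure (D q) A = (LINT x|D q. indicator A x)"
        by (simp add: D_def)
      also have "\<dots> = (LINT x|M. q x * indicator A (u x)) / m"
        unfolding D_def by (subst integral_distr, simp, simp, subst integral_density)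
           (use q m in \<open>auto simp flip: Bochner_Integration.integral_divide_zero\<close>)
      finally show "measure (D q) A = (LINT x|M. q x * indicator A (u x)) / m" .
    qed
    have p: "integrable M p" "\<And>x. p x \<ge> 0" "(LINT x|M. p x) = m"
      and n: "integrable M n" "\<And>x. n x \<ge> 0" "(LINT x|M. n x) = m"
      using int' mn by (auto simp: p_def n_def m_def)
    have "char (D p) s = char (D n) s" for s
    proof -
      have "(LINT x|M. complex_of_real (p x) * iexp (s * u x)) - (LINT x|M. complex_of_real (n x) * iexp (s * u x)) = 0"
        using zero[of s] intb[OF int'(1), of s] intb[OF int'(2), of s]
        by (simp add: pn left_diff_distrib)
      then show ?thesis by (simp add: charD[OF p] charD[OF n])
    qed
    then have "char (D p) = char (D n)" ..
    then have "D p = D n" by (intro Levy_uniqueness dist p n)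
    then have "(LINT x|M. p x * indicator A (u x)) / m = (LINT x|M. n x * indicator A (u x)) / m"
      using measD[OF p] measD[OF n] by (simp only:)
    then show ?thesis using m inti[OF int'(1)] inti[OF int'(2)]
      by (simp add: pn left_diff_distrib)
  qed
qed

text \<open>Conjugation turns frequency s into -s, so the hypothesis passes to the conjugate of h
  and hence to its real and imaginary parts, to which the real version applies.\<close>

lemma signed_char_zero_imp_indicator_zero:
  fixes h :: "'a \<Rightarrow> complex" and u :: "'a \<Rightarrow> real"
  assumes int: "integrable M h" and u [measurable]: "u \<in> borel_measurable M"
    and zero: "\<And>s. (LINT x|M. h x * iexp (s * u x)) = 0"
    and A [measurable]: "A \<in> sets borel"
  shows "(LINT x|M. h x * indicator A (u x)) = 0"
proof -
  have hm [measurable]: "h \<in> borel_measurable M" using int by auto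
  have [measurable]: "(\<lambda>x. cnj (h x)) \<in> borel_measurable M"
    using int by (intro borel_measurable_integrable) (simp add: complex_integrable_cnj)
  have intb: "integrable M (\<lambda>x. h x * iexp (s * u x))" for s
    by (rule Bochner_Integration.integrable_bound[OF int]) (auto simp: norm_mult)
  have intc: "integrable M (\<lambda>x. cnj (h x) * iexp (s * u x))" for s
    by (rule Bochner_Integration.integrable_bound[OF int]) (auto simp: norm_mult)
  have inti: "integrable M (\<lambda>x. h x * indicator A (u x))"
    by (rule Bochner_Integration.integrable_bound[OF int]) (auto simp: indicator_def)
  have zeroc: "(LINT x|M. cnj (h x) * iexp (s * u x)) = 0" for s
  proof -
    have "(LINT x|M. cnj (h x) * iexp (s * u x)) = (LINT x|M. cnj (h x * iexp (- s * u x)))"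
      by (intro Bochner_Integration.integral_cong) (auto simp: exp_cnj)
    also have "\<dots> = cnj (LINT x|M. h x * iexp (- s * u x))"
      by (rule Bochner_Integration.integral_cnj)
    finally show ?thesis using zero[of "- s"] by simp
  qed
  have re: "(LINT x|M. complex_of_real (Re (h x)) * iexp (s * u x)) = 0" for s
  proof -
    have "(LINT x|M. complex_of_real (Re (h x)) * iexp (s * u x)) =
      (LINT x|M. (h x * iexp (s * u x) + cnj (h x) * iexp (s * u x)) / 2)"
      by (intro Bochner_Integration.integral_cong refl)
        (simp add: complex_add_cnj flip: distrib_right)
    also have "\<dots> = 0" using intb[of s] intc[of s] zero[of s] zeroc[of s] by simp
    finally show ?thesis .
  qed
  have im: "(LINT x|M. complex_of_real (Im (h x)) * iexp (s * u x)) = 0" for s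
  proof -
    have "(LINT x|M. complex_of_real (Im (h x)) * iexp (s * u x)) =
      (LINT x|M. (h x * iexp (s * u x) - cnj (h x) * iexp (s * u x)) / (2 * \<i>))"
      by (intro Bochner_Integration.integral_cong refl)
        (simp add: complex_diff_cnj field_simps flip: left_diff_distrib)
    also have "\<dots> = 0" using intb[of s] intc[of s] zero[of s] zeroc[of s] by simp
    finally show ?thesis .
  qed
  have "(LINT x|M. Re (h x) * indicator A (u x)) = 0" "(LINT x|M. Im (h x) * indicator A (u x)) = 0"
    by (rule signed_char_zero_imp_indicator_zero_real; use int re im in auto)+
  moreover have "Re (LINT x|M. h x * indicator A (u x)) = (LINT x|M. Re (h x) * indicator A (u x))"
    "Im (LINT x|M. h x * indicator A (u x)) = (LINT x|M. Im (h x) * indicator A (u x))"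
    unfolding integral_Re[OF inti, symmetric] integral_Im[OF inti, symmetric]
    by (intro Bochner_Integration.integral_cong refl; simp add: indicator_def)+
  ultimately show ?thesis by (simp add: complex_eq_iff)
qed

lemma sum_power_fact_le_exp:
  fixes x :: real
  assumes "x \<ge> 0"
  shows "(\<Sum>m<n. x ^ m / fact m) \<le> exp x"
proof -
  have "(\<lambda>m. x ^ m / fact m) sums exp x"
    using exp_converges[of x] by (simp add: divide_inverse mult.commute)
  then show ?thesis
    using assms by (metis (no_types, lifting) sum_le_suminf sums_iff divide_nonneg_nonneg fact_ge_zero
        finite_lessThan zero_le_power)
qed

text \<open>The one-variable completeness step: \<open>u\<close> will be a single coordinate, with
  the remaining variables hidden in \<Psi>. Vanishing Hermite pairings give vanishing polynomial
  moments for the Gaussian weight, the exponential series then gives a vanishing Fourier transform,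
  and uniqueness of characteristic functions gives the indicators.\<close>

lemma hermite_zero_imp_indicator_zero:
  fixes \<Psi> :: "'a \<Rightarrow> complex" and u :: "'a \<Rightarrow> real"
  assumes [measurable]: "\<Psi> \<in> borel_measurable M" "u \<in> borel_measurable M" "A \<in> sets borel"
    and int: "\<And>a. integrable M (\<lambda>x. \<Psi> x * of_real (exp (a * \<bar>u x\<bar> - (u x)\<^sup>2 / 2)))"
    and zero: "\<And>k. (LINT x|M. \<Psi> x * of_real (exp ((u x)\<^sup>2 / 2) * gauss_deriv k (u x))) = 0"
  shows "(LINT x|M. \<Psi> x * of_real (exp (- (u x)\<^sup>2 / 2) * indicator A (u x))) = 0"
proof -
  define I where "I m k x = \<Psi> x * of_real (u x ^ m * (exp ((u x)\<^sup>2 / 2) * gauss_deriv k (u x)))" for m k x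
  have pow_le: "\<bar>t\<bar> ^ m \<le> fact m * exp \<bar>t\<bar>" for t :: real and m
    using order_trans[OF member_le_sum[of m "{..<Suc m}" "\<lambda>m. \<bar>t\<bar> ^ m / fact m"] sum_power_fact_le_exp[of "\<bar>t\<bar>" "Suc m"]]
    by (simp add: field_simps)
  have intI: "integrable M (I m k)" for m k
  proof -
    obtain C where C: "C \<ge> 0" "\<And>t. \<bar>gauss_deriv k t\<bar> \<le> C * exp (real k * \<bar>t\<bar> - t\<^sup>2)"
      using gauss_deriv_bound by blast
    show ?thesis
    proof (rule Bochner_Integration.integrable_bound[OF integrable_mult_right[OF int[of "real k + 1"], of "of_real (fact m * C)"]])
      show "AE x in M. norm (I m k x) \<le> norm (of_real (fact m * C) * (\<Psi> x * of_real (exp ((real k + 1) * \<bar>u x\<bar> - (u x)\<^sup>2 / 2))))"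
      proof (rule AE_I2)
        fix x
        have "\<bar>u x ^ m * (exp ((u x)\<^sup>2 / 2) * gauss_deriv k (u x))\<bar> \<le>
           (fact m * exp \<bar>u x\<bar>) * (exp ((u x)\<^sup>2 / 2) * (C * exp (real k * \<bar>u x\<bar> - (u x)\<^sup>2)))"
          unfolding abs_mult power_abs abs_exp_cancel
          by (intro mult_mono pow_le C order_refl) (use C in auto)
        also have "\<dots> = fact m * C * exp ((real k + 1) * \<bar>u x\<bar> - (u x)\<^sup>2 / 2)"
          by (simp add: algebra_simps flip: exp_add)
        finally have "norm (\<Psi> x) * \<bar>u x ^ m * (exp ((u x)\<^sup>2 / 2) * gauss_deriv k (u x))\<bar> \<le>
            norm (\<Psi> x) * (fact m * C * exp ((real k + 1) * \<bar>u x\<bar> - (u x)\<^sup>2 / 2))"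
          by (rule mult_left_mono) simp
        then show "norm (I m k x) \<le> norm (of_real (fact m * C) * (\<Psi> x * of_real (exp ((real k + 1) * \<bar>u x\<bar> - (u x)\<^sup>2 / 2))))"
          unfolding I_def norm_mult norm_of_real using C by (simp add: ac_simps)
      qed
    qed (unfold I_def, measurable)
  qed
  \<comment> \<open>A power of \<open>u\<close> is removed at the expense of moving to the
    neighbouring Hermite indices k + 1 and k - 1, so the index k has to stay arbitrary in the
    induction.\<close>
  have zeroI: "(LINT x|M. I m k x) = 0" for m k
  proof (induction m arbitrary: k)
    case 0
    then show ?case using zero[of k] by (simp add: I_def)
  next
    case (Suc m)
    have "I (Suc m) k x = - (I m (Suc k) x + of_real (2 * real k) * I m (k - 1) x) / 2" for x
    proof -
      have "I (Suc m) k x = \<Psi> x * of_real (u x ^ m * (exp ((u x)\<^sup>2 / 2) * (u x * gauss_deriv k (u x))))"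
        by (simp add: I_def ac_simps)
      also have "\<dots> = - (I m (Suc k) x + of_real (2 * real k) * I m (k - 1) x) / 2"
        unfolding times_gauss_deriv I_def by (simp add: field_simps del: gauss_deriv.simps)
      finally show ?thesis .
    qed
    then have "(LINT x|M. I (Suc m) k x) = (LINT x|M. - (I m (Suc k) x + of_real (2 * real k) * I m (k - 1) x) / 2)"
      by (simp only:)
    then show ?case
      using Suc[of "Suc k"] Suc[of "k - 1"] intI by simp
  qed
  have I0: "I m 0 x = \<Psi> x * (of_real (u x) ^ m * of_real (exp (- (u x)\<^sup>2 / 2)))" for m x
  proof -
    have "exp ((u x)\<^sup>2 / 2) * exp (- (u x)\<^sup>2) = exp (- (u x)\<^sup>2 / 2)"
      by (simp flip: exp_add)
    then show ?thesis by (simp only: I_def gauss_deriv.simps of_real_mult of_real_power)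
  qed
  have z: "(LINT x|M. \<Psi> x * of_real (exp (- (u x)\<^sup>2 / 2)) * (\<i> * of_real (s * u x)) ^ m / fact m) = 0" for m s
  proof -
    have "(LINT x|M. \<Psi> x * of_real (exp (- (u x)\<^sup>2 / 2)) * (\<i> * of_real (s * u x)) ^ m / fact m) =
      (LINT x|M. (\<i> * of_real s) ^ m / fact m * I m 0 x)"
      by (intro Bochner_Integration.integral_cong refl)
         (simp add: I0 power_mult_distrib ac_simps)
    then show ?thesis using zeroI[of m 0] by simp
  qed
  have "(LINT x|M. \<Psi> x * of_real (exp (- (u x)\<^sup>2 / 2)) * iexp (s * u x)) = 0" for s
  proof -
    let ?S = "\<lambda>n x. \<Sum>m<n. \<Psi> x * of_real (exp (- (u x)\<^sup>2 / 2)) * (\<i> * of_real (s * u x)) ^ m / fact m"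
    have "(\<lambda>n. LINT x|M. ?S n x) \<longlonglongrightarrow> (LINT x|M. \<Psi> x * of_real (exp (- (u x)\<^sup>2 / 2)) * iexp (s * u x))"
    \<comment> \<open>All partial sums of the exponential series are dominated by exp(|s| |u|), and
      \<open>int\<close> with rate |s| makes this majorant integrable against the Gaussian
      weight.\<close>
    proof (rule integral_dominated_convergence[where w = "\<lambda>x. norm (\<Psi> x * of_real (exp (\<bar>s\<bar> * \<bar>u x\<bar> - (u x)\<^sup>2 / 2)))"])
      show "AE x in M. (\<lambda>n. ?S n x) \<longlonglongrightarrow> \<Psi> x * of_real (exp (- (u x)\<^sup>2 / 2)) * iexp (s * u x)"
      proof (rule AE_I2)
        fix x
        have "(\<lambda>m. (\<i> * of_real (s * u x)) ^ m / fact m) sums iexp (s * u x)"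
          using exp_converges[of "\<i> * of_real (s * u x)"]
          by (simp add: scaleR_conv_of_real divide_inverse mult.commute)
        from sums_mult[OF this, of "\<Psi> x * of_real (exp (- (u x)\<^sup>2 / 2))"]
        show "(\<lambda>n. ?S n x) \<longlonglongrightarrow> \<Psi> x * of_real (exp (- (u x)\<^sup>2 / 2)) * iexp (s * u x)"
          by (simp add: sums_def)
      qed
      show "AE x in M. norm (?S n x) \<le> norm (\<Psi> x * of_real (exp (\<bar>s\<bar> * \<bar>u x\<bar> - (u x)\<^sup>2 / 2)))" for n
      proof (rule AE_I2)
        fix x
        have "norm (\<Sum>m<n. (\<i> * complex_of_real (s * u x)) ^ m / fact m) \<le> (\<Sum>m<n. \<bar>s * u x\<bar> ^ m / fact m)"
          by (rule sum_norm_le) (simp add: norm_divide norm_power norm_mult abs_mult)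
        also have "\<dots> \<le> exp (\<bar>s * u x\<bar>)"
          by (rule sum_power_fact_le_exp) simp
        finally have "norm (\<Psi> x) * exp (- (u x)\<^sup>2 / 2) * norm (\<Sum>m<n. (\<i> * complex_of_real (s * u x)) ^ m / fact m)
          \<le> norm (\<Psi> x) * exp (- (u x)\<^sup>2 / 2) * exp (\<bar>s * u x\<bar>)"
          by (rule mult_left_mono) simp
        moreover have "?S n x = \<Psi> x * of_real (exp (- (u x)\<^sup>2 / 2)) * (\<Sum>m<n. (\<i> * complex_of_real (s * u x)) ^ m / fact m)"
          by (simp add: sum_distrib_left)
        ultimately show "norm (?S n x) \<le> norm (\<Psi> x * of_real (exp (\<bar>s\<bar> * \<bar>u x\<bar> - (u x)\<^sup>2 / 2)))"
          by (simp add: norm_mult abs_mult mult.assoc flip: exp_add)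
      qed
      show "integrable M (\<lambda>x. norm (\<Psi> x * of_real (exp (\<bar>s\<bar> * \<bar>u x\<bar> - (u x)\<^sup>2 / 2))))"
        by (rule integrable_norm[OF int])
    qed measurable
    moreover have "(LINT x|M. ?S n x) = 0" for n
    proof -
      have "integrable M (\<lambda>x. (\<i> * of_real s) ^ m / fact m * I m 0 x)" for m
        by (rule integrable_mult_right[OF intI])
      then have "integrable M (\<lambda>x. \<Psi> x * of_real (exp (- (u x)\<^sup>2 / 2)) * (\<i> * of_real (s * u x)) ^ m / fact m)" for m
        by (rule Bochner_Integration.integrable_cong[THEN iffD1, rotated -1])
           (simp_all add: I0 power_mult_distrib ac_simps)
      then have "(LINT x|M. ?S n x) = (\<Sum>m<n. LINT x|M. \<Psi> x * of_real (exp (- (u x)\<^sup>2 / 2)) * (\<i> * of_real (s * u x)) ^ m / fact m)"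
        by (intro Bochner_Integration.integral_sum)
      then show ?thesis unfolding z by simp
    qed
    ultimately show ?thesis
      using LIMSEQ_unique[OF _ tendsto_const] by simp
  qed
  from signed_char_zero_imp_indicator_zero[OF _ _ this \<open>A \<in> sets borel\<close>]
  have "(LINT x|M. \<Psi> x * of_real (exp (- (u x)\<^sup>2 / 2)) * indicator A (u x)) = 0"
    using int[of 0] by simp
  then show ?thesis by (simp add: of_real_indicator ac_simps)
qed

text \<open>Both the square of |f| and the square of the product are integrable, and a product of
  two non-negative reals is at most the sum of their squares.\<close>

lemma integrable_L2_mult_prod:
  fixes f :: "real^'n::finite \<Rightarrow> complex" and q :: "'n \<Rightarrow> real \<Rightarrow> real"
  assumes [measurable]: "f \<in> borel_measurable borel" "\<And>j. q j \<in> borel_measurable borel"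
    and f: "integrable lborel (\<lambda>x. (cmod (f x))\<^sup>2)"
    and q: "\<And>j. \<exists>C. \<forall>t. \<bar>q j t\<bar> \<le> C * exp (- t\<^sup>2 / 4)"
  shows "integrable lborel (\<lambda>x. f x * complex_of_real (\<Prod>j\<in>UNIV. q j (x $ j)))"
proof -
  obtain C where C: "\<And>j t. \<bar>q j t\<bar> \<le> C j * exp (- t\<^sup>2 / 4)" using q by metis
  have "integrable lborel (\<lambda>t. complex_of_real ((q j t)\<^sup>2))" for j
  proof (rule Bochner_Integration.integrable_bound)
    show "integrable lborel (\<lambda>t::real. (C j)\<^sup>2 * exp (- t\<^sup>2 / 2))"
      by (intro integrable_mult_right integrable_exp_neg_half_square)
    show "AE t in lborel. norm (complex_of_real ((q j t)\<^sup>2)) \<le> norm ((C j)\<^sup>2 * exp (- t\<^sup>2 / 2))"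
    proof (rule AE_I2)
      fix t :: real
      have "\<bar>q j t\<bar>\<^sup>2 \<le> (C j * exp (- t\<^sup>2 / 4))\<^sup>2" by (rule power_mono[OF C]) simp
      also have "\<dots> = (C j)\<^sup>2 * exp (- t\<^sup>2 / 2)"
        by (simp add: power_mult_distrib flip: exp_double)
      finally show "norm (complex_of_real ((q j t)\<^sup>2)) \<le> norm ((C j)\<^sup>2 * exp (- t\<^sup>2 / 2))"
        by (simp add: norm_power abs_mult)
    qed
  qed measurable
  from integrable_lborel_vec_prod[OF this]
  have "integrable lborel (\<lambda>x::real^'n. Re (\<Prod>j\<in>UNIV. complex_of_real ((q j (x $ j))\<^sup>2)))"
    by (rule integrable_Re)
  then have G: "integrable lborel (\<lambda>x::real^'n. (\<Prod>j\<in>UNIV. q j (x $ j))\<^sup>2)"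
    unfolding of_real_prod[symmetric] Re_complex_of_real prod_power_distrib .
  show ?thesis
  proof (rule Bochner_Integration.integrable_bound[OF Bochner_Integration.integrable_add[OF f G]])
    show "AE x in lborel. norm (f x * complex_of_real (\<Prod>j\<in>UNIV. q j (x $ j))) \<le>
        norm ((cmod (f x))\<^sup>2 + (\<Prod>j\<in>UNIV. q j (x $ j))\<^sup>2)"
    proof (rule AE_I2)
      fix x
      have "2 * cmod (f x) * \<bar>\<Prod>j\<in>UNIV. q j (x $ j)\<bar> \<le> (cmod (f x))\<^sup>2 + \<bar>\<Prod>j\<in>UNIV. q j (x $ j)\<bar>\<^sup>2"
        by (rule sum_squares_bound)
      moreover have "0 \<le> cmod (f x) * \<bar>\<Prod>j\<in>UNIV. q j (x $ j)\<bar>" by simp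
      ultimately have "cmod (f x) * \<bar>\<Prod>j\<in>UNIV. q j (x $ j)\<bar> \<le> (cmod (f x))\<^sup>2 + (\<Prod>j\<in>UNIV. q j (x $ j))\<^sup>2"
        unfolding power2_abs by linarith
      then show "norm (f x * complex_of_real (\<Prod>j\<in>UNIV. q j (x $ j))) \<le>
        norm ((cmod (f x))\<^sup>2 + (\<Prod>j\<in>UNIV. q j (x $ j))\<^sup>2)"
        by (simp add: norm_mult del: of_real_prod)
    qed
  qed measurable
qed

lemma exp_linear_minus_square_bound: "exp (a * \<bar>t\<bar> - t\<^sup>2 / 2) \<le> exp (a\<^sup>2) * exp (- t\<^sup>2 / 4)" for a t :: real
proof -
  have "0 \<le> (a - \<bar>t\<bar> / 2)\<^sup>2" by simp
  then have "a * \<bar>t\<bar> - t\<^sup>2 / 2 \<le> a\<^sup>2 - t\<^sup>2 / 4"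
    unfolding power2_diff by (simp add: field_simps)
  then show ?thesis by (simp flip: exp_add)
qed

text \<open>Hermite factors are exchanged for weighted indicators one coordinate at a time. The
  induction runs over the set J of coordinates already exchanged, with arbitrary Hermite indices in
  the others.\<close>

lemma hermite_zero_imp_box_zero:
  fixes f :: "real^'n::finite \<Rightarrow> complex"
  assumes [measurable]: "f \<in> borel_measurable borel" "\<And>j. A j \<in> sets borel"
    and f: "integrable lborel (\<lambda>x. (cmod (f x))\<^sup>2)"
    and zero: "\<And>\<alpha>. (LINT x|lborel. f x * of_real (\<Prod>j\<in>UNIV. exp ((x $ j)\<^sup>2 / 2) * gauss_deriv (\<alpha> j) (x $ j))) = 0"
  shows "(LINT x|lborel. f x * of_real (\<Prod>j\<in>UNIV. exp (- (x $ j)\<^sup>2 / 2) * indicator (A j) (x $ j))) = 0"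
proof -
  define g where "g j t = exp (- t\<^sup>2 / 2) * indicat_real (A j) t" for j t
  define h where "h k t = exp (t\<^sup>2 / 2) * gauss_deriv k t" for k t
  define q where "q J \<alpha> j = (if j \<in> J then g j else h (\<alpha> j))" for J \<alpha> j
  have gb: "\<exists>C. \<forall>t. \<bar>g j t\<bar> \<le> C * exp (- t\<^sup>2 / 4)" for j
    using exp_linear_minus_square_bound[of 0]
    by (intro exI[of _ 1]) (auto simp: g_def indicator_def)
  have hb: "\<exists>C. \<forall>t. \<bar>h k t\<bar> \<le> C * exp (- t\<^sup>2 / 4)" for k
    using exp_half_gauss_deriv_bound[of k] unfolding h_def by blast
  have [measurable]: "g j \<in> borel_measurable borel" "h k \<in> borel_measurable borel" for j k
    unfolding g_def[abs_def] h_def[abs_def] by measurable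
  have [measurable]: "q J \<alpha> j \<in> borel_measurable borel" for J \<alpha> j
    unfolding q_def by simp
  have "(LINT x|lborel. f x * of_real (\<Prod>j\<in>UNIV. q J \<alpha> j (x $ j))) = 0" for J \<alpha>
    using finite[of J]
  proof (induction J arbitrary: \<alpha> rule: finite_induct)
    case empty
    then show ?case using zero[of \<alpha>] by (simp add: q_def h_def)
  next
    case (insert k J)
    define \<Psi> where "\<Psi> x = f x * of_real (\<Prod>j\<in>UNIV - {k}. q J \<alpha> j (x $ j))" for x
    have [measurable]: "\<Psi> \<in> borel_measurable borel"
      unfolding \<Psi>_def[abs_def] by measurable
    have split: "f x * of_real (\<Prod>j\<in>UNIV. p j (x $ j)) = \<Psi> x * of_real (p k (x $ k))"
      if "\<And>j. j \<noteq> k \<Longrightarrow> p j = q J \<alpha> j" for x p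
    proof -
      have "(\<Prod>j\<in>UNIV. p j (x $ j)) = p k (x $ k) * (\<Prod>j\<in>UNIV - {k}. p j (x $ j))"
        by (rule prod.remove) auto
      also have "(\<Prod>j\<in>UNIV - {k}. p j (x $ j)) = (\<Prod>j\<in>UNIV - {k}. q J \<alpha> j (x $ j))"
        by (rule prod.cong) (auto simp: that)
      finally show ?thesis by (simp add: \<Psi>_def)
    qed
    have "(LINT x|lborel. \<Psi> x * of_real (exp (- (x $ k)\<^sup>2 / 2) * indicator (A k) (x $ k))) = 0"
    proof (rule hermite_zero_imp_indicator_zero)
      fix a :: real
      \<comment> \<open>Factor k is replaced by the majorant itself, so that the integrability
        required by the one-variable step is another instance of
        \<open>integrable_L2_mult_prod\<close>.\<close>
      define p where "p j = (if j = k then \<lambda>t. exp (a * \<bar>t\<bar> - t\<^sup>2 / 2) else q J \<alpha> j)" for j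
      have [measurable]: "p j \<in> borel_measurable borel" for j
        unfolding p_def by simp
      have "integrable lborel (\<lambda>x. f x * of_real (\<Prod>j\<in>UNIV. p j (x $ j)))"
      proof (rule integrable_L2_mult_prod[OF _ _ f])
        show "\<exists>C. \<forall>t. \<bar>p j t\<bar> \<le> C * exp (- t\<^sup>2 / 4)" for j
          using gb hb exp_linear_minus_square_bound[of a] by (auto simp: p_def q_def)
      qed measurable
      then show "integrable lborel (\<lambda>x. \<Psi> x * of_real (exp (a * \<bar>x $ k\<bar> - (x $ k)\<^sup>2 / 2)))"
        by (subst (asm) split) (auto simp: p_def)
    next
      fix m
      have "(\<lambda>x. f x * of_real (\<Prod>j\<in>UNIV. q J (\<alpha>(k := m)) j (x $ j))) =
         (\<lambda>x. \<Psi> x * of_real (h m (x $ k)))"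
        using insert.hyps by (subst split) (auto simp: q_def)
      then show "(LINT x|lborel. \<Psi> x * of_real (exp ((x $ k)\<^sup>2 / 2) * gauss_deriv m (x $ k))) = 0"
        using insert.IH[of "\<alpha>(k := m)"] unfolding h_def by (simp only:)
    qed measurable
    moreover have "(\<lambda>x. f x * of_real (\<Prod>j\<in>UNIV. q (insert k J) \<alpha> j (x $ j))) =
         (\<lambda>x. \<Psi> x * of_real (g k (x $ k)))"
      by (subst split) (auto simp: q_def)
    ultimately show ?case by (simp add: g_def)
  qed
  from this[of UNIV] show ?thesis by (simp add: q_def g_def)
qed

lemma hermite_complete_borel:
  fixes f :: "real^'n::finite \<Rightarrow> complex"
  assumes [measurable]: "f \<in> borel_measurable borel"
    and f: "integrable lborel (\<lambda>x. (cmod (f x))\<^sup>2)"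
    and zero: "\<And>\<alpha>. (LINT x|lborel. f x * of_real (hermite_fun \<alpha> x)) = 0"
  shows "AE x in lborel. f x = 0"
proof -
  have zero': "(LINT x|lborel. f x * of_real (\<Prod>j\<in>UNIV. exp ((x $ j)\<^sup>2 / 2) * gauss_deriv (\<alpha> j) (x $ j))) = 0" for \<alpha>
    using zero[of \<alpha>] hermite_const_nonzero[of \<alpha>]
    by (simp add: hermite_fun_eq mult.left_commute[of _ "of_real (hermite_const \<alpha>)"] del: of_real_prod)
  \<comment> \<open>An L^2 function need not be integrable; the Gaussian factor makes it so and,
    vanishing nowhere, loses no information.\<close>
  define g where "g x = f x * of_real (\<Prod>j\<in>UNIV. exp (- (x $ j)\<^sup>2 / 2))" for x
  have [measurable]: "g \<in> borel_measurable borel" unfolding g_def[abs_def] by measurable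
  have g: "integrable lborel g"
    unfolding g_def[abs_def]
  proof (rule integrable_L2_mult_prod[OF _ _ f])
    show "\<exists>C. \<forall>t. \<bar>exp (- t\<^sup>2 / 2 :: real)\<bar> \<le> C * exp (- t\<^sup>2 / 4)"
      using exp_linear_minus_square_bound[of 0] by (intro exI[of _ 1]) auto
  qed measurable
  have box: "(LINT x|lborel. g x * indicator {x. \<forall>j. x $ j \<in> A j} x) = 0"
    if [measurable]: "\<And>j. A j \<in> sets borel" for A
  proof -
    have "indicator {x. \<forall>j. x $ j \<in> A j} x = (\<Prod>j\<in>UNIV. indicat_real (A j) (x $ j))" for x
      by (auto simp: indicator_def prod_zero_iff)
    then have "g x * indicator {x. \<forall>j. x $ j \<in> A j} x =
        f x * of_real (\<Prod>j\<in>UNIV. exp (- (x $ j)\<^sup>2 / 2) * indicator (A j) (x $ j))" for x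
      unfolding g_def by (simp add: prod.distrib indicator_def)
    then show ?thesis using hermite_zero_imp_box_zero[OF _ that f zero'] by simp
  qed
  have inti: "integrable lborel (\<lambda>x. g x * indicator S x)" if "S \<in> sets borel" for S
    using that by (intro Bochner_Integration.integrable_bound[OF g]) (auto simp: indicator_def)
  \<comment> \<open>From boxes to all Borel sets: open boxes form an intersection-stable generator,
    and the sets with vanishing integral are closed under complements and countable disjoint
    unions.\<close>
  have all: "(LINT x|lborel. g x * indicator S x) = 0" if "S \<in> sets borel" for S
  proof -
    have S: "S \<in> sigma_sets UNIV (range (\<lambda>(a, b). box a b))"
      using that by (simp add: borel_eq_box)
    have istab: "Int_stable (range (\<lambda>(a, b). box a (b :: real^'n)))"
      by (auto simp: Int_stable_def Int_interval box_Int_box intro: )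
    from S show ?thesis
    proof (induction rule: sigma_sets_induct_disjoint[OF istab, of UNIV])
      case 1 show ?case by simp
    next
      case 2 show ?case by (fact S)
    next
      case (3 B)
      then obtain a b where B: "B = box a b" by auto
      have "B = {x. \<forall>j. x $ j \<in> {a $ j<..<b $ j}}" by (auto simp: B mem_box_cart)
      then show ?case using box[of "\<lambda>j. {a $ j<..<b $ j}"] by simp
    next
      case 4 then show ?case by simp
    next
      case (5 B)
      then have B: "B \<in> sets borel" by (simp add: borel_eq_box)
      have "g x * indicator (UNIV - B) x = g x - g x * indicator B x" for x
        by (auto simp: indicator_def)
      moreover have "(LINT x|lborel. g x) = 0"
        using box[of "\<lambda>_. UNIV"] by simp
      ultimately show ?case using 5 g inti[OF B] by simp
    next
      case (6 B)
      then have B: "B i \<in> sets borel" for i by (auto simp: borel_eq_box)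
      have "set_integrable lborel (\<Union>(range B)) g"
        unfolding set_integrable_def using inti[of "\<Union>(range B)"] B
        by (simp add: mult.commute scaleR_conv_of_real of_real_indicator)
      then have "(LINT x:\<Union>(range B)|lborel. g x) = (\<Sum>i. LINT x:B i|lborel. g x)"
        using 6 B by (intro lebesgue_integral_countable_add) (auto simp: disjoint_family_on_def)
      moreover have "(LINT x|lborel. g x * indicator (B i) x) = 0" for i
        using 6 by auto
      ultimately show ?case
        by (simp add: set_lebesgue_integral_def scaleR_conv_of_real of_real_indicator mult.commute)
    qed
  qed
  have "AE x in lborel. g x = 0"
  proof (rule sigma_finite_measure.density_zero[OF sigma_finite_lborel g])
    fix S :: "(real^'n) set" assume "S \<in> sets lborel"
    then show "(LINT x:S|lborel. g x) = 0"
      using all[of S] by (simp add: set_lebesgue_integral_def scaleR_conv_of_real of_real_indicator mult.commute)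
  qed
  then show ?thesis
    by eventually_elim (simp add: g_def)
qed

section \<open>The adjoint short-time Fourier transform\<close>

text \<open>Elements of L^2 are only Lebesgue measurable, whereas the completeness argument above is
  stated for Borel functions and \<open>lborel\<close>.\<close>

lemma borel_version:
  fixes F :: "'a::euclidean_space \<Rightarrow> complex"
  assumes "F \<in> borel_measurable lebesgue"
  obtains F' where "F' \<in> borel_measurable borel" "AE p in lborel. F p = F' p"
proof -
  have "(\<lambda>p. Re (F p)) \<in> borel_measurable lebesgue" "(\<lambda>p. Im (F p)) \<in> borel_measurable lebesgue"
    using assms by measurable
  then obtain a b where ab [measurable]: "a \<in> borel_measurable lborel" "b \<in> borel_measurable lborel"
    "AE p in lborel. Re (F p) = a p" "AE p in lborel. Im (F p) = b p"
    using completion_ex_borel_measurable_real by metis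
  from ab have m: "(\<lambda>p. Complex (a p) (b p)) \<in> borel_measurable borel"
    unfolding Complex_eq by simp
  have "AE p in lborel. F p = Complex (a p) (b p)"
    using ab(3,4) by eventually_elim (simp add: complex_eq_iff)
  then show thesis by (rule that[OF m])
qed

lemma measurable_lebesgueI: "f \<in> borel_measurable borel \<Longrightarrow> f \<in> borel_measurable lebesgue"
  by (rule measurable_completion) simp

lemma integral_lebesgue_cong_AE_lborel:
  fixes f g :: "'a::euclidean_space \<Rightarrow> 'b::euclidean_space"
  assumes "f \<in> borel_measurable lebesgue" "g \<in> borel_measurable borel" "AE p in lborel. f p = g p"
  shows "integral\<^sup>L lebesgue f = integral\<^sup>L lborel g"
proof -
  have "integral\<^sup>L lebesgue f = integral\<^sup>L lebesgue g"
    using assms(1) measurable_lebesgueI[OF assms(2)] AE_completion[OF assms(3)] by (rule integral_cong_AE)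
  then show ?thesis using assms(2) by (simp add: integral_completion)
qed

text \<open>The complement of the support is a possibly uncountable union of open sets on which g
  vanishes almost everywhere; by Lindelof countably many of them suffice, so the exceptional null
  sets add up to a null set.\<close>

lemma AE_zero_outside_ess_support:
  "AE p in lebesgue. p \<notin> ess_support g \<longrightarrow> g p = 0"
proof -
  let ?U = "{U. open U \<and> (AE p in lebesgue. p \<in> U \<longrightarrow> g p = 0)}"
  obtain V where V: "V \<subseteq> ?U" "countable V" "\<Union>V = \<Union>?U"
    by (rule Lindelof[of ?U]) auto
  have "AE p in lebesgue. \<forall>U\<in>V. p \<in> U \<longrightarrow> g p = 0"
    using V by (subst AE_ball_countable) auto
  then show ?thesis
    by eventually_elim (use V in \<open>auto simp: ess_support_def\<close>)
qed

section \<open>Decay and Hermite coefficients of the synthesised function\<close>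

lemma integrable_exp_norm_square:
  "integrable lborel (\<lambda>x::real^'n::finite. exp (- (norm x)\<^sup>2 / 2))"
proof -
  have "integrable lborel (\<lambda>x::real^'n. Re (\<Prod>j\<in>UNIV. complex_of_real (exp (- (x $ j)\<^sup>2 / 2))))"
    by (intro integrable_Re integrable_lborel_vec_prod integrable_of_real integrable_exp_neg_half_square)
  also have "(\<lambda>x::real^'n. Re (\<Prod>j\<in>UNIV. complex_of_real (exp (- (x $ j)\<^sup>2 / 2)))) = (\<lambda>x. exp (- (norm x)\<^sup>2 / 2))"
    using exp_norm_square_vec[of "- (1 / 2)", where 'n = 'n]
    by (simp add: fun_eq_iff del: of_real_prod flip: of_real_prod)
  finally show ?thesis .
qed

lemma integrable_lborel_pair_times:
  fixes f :: "'a::euclidean_space \<Rightarrow> complex" and g :: "'b::euclidean_space \<Rightarrow> complex"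
  assumes f: "integrable lborel f" and g: "integrable lborel g"
  shows "integrable (lborel \<Otimes>\<^sub>M lborel) (\<lambda>(x, y). f x * g y)"
proof (rule lborel_pair.Fubini_integrable)
  have [measurable]: "f \<in> borel_measurable borel" "g \<in> borel_measurable borel"
    using f g by (auto dest: borel_measurable_integrable)
  show "(\<lambda>(x, y). f x * g y) \<in> borel_measurable (lborel \<Otimes>\<^sub>M lborel)"
    by measurable
  show "integrable lborel (\<lambda>x. LINT y|lborel. norm (case (x, y) of (x, y) \<Rightarrow> f x * g y))"
    using f g by (simp add: norm_mult)
  show "AE x in lborel. integrable lborel (\<lambda>y. case (x, y) of (x, y) \<Rightarrow> f x * g y)"
    using g by simp
qed

text \<open>Bound and support are imposed at every point and F is Borel, so the kernel estimates
  hold without exceptional sets. General classes modulo null sets are reduced to this by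
  \<open>stft_adjoint_cong_AE\<close>.\<close>

locale bounded_compact_phase_function =
  fixes F :: "(real^'n::finite) \<times> (real^'n) \<Rightarrow> complex" and C R :: real
  assumes meas [measurable]: "F \<in> borel_measurable borel"
    and bound: "cmod (F p) \<le> C * indicator (cball 0 R) p"
begin

definition synthesis where "synthesis x = stft_adjoint gauss_window F x"

definition kernel where "kernel x p = F p * gauss_window (x - fst p) * exp (\<i> * complex_of_real (x \<bullet> snd p))"

lemma measurable_kernel [measurable]: "(\<lambda>(x, p). kernel x p) \<in> borel_measurable (lborel \<Otimes>\<^sub>M lborel)"
proof -
  have "(\<lambda>z. F (snd z)) \<in> borel_measurable (borel :: ((real^'n) \<times> (real^'n) \<times> (real^'n)) measure)"
    by (intro measurable_compose[OF _ meas] borel_measurable_continuous_onI continuous_intros)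
  moreover have "(\<lambda>z. gauss_window (fst z - fst (snd z)) * exp (\<i> * complex_of_real (fst z \<bullet> snd (snd z))))
      \<in> borel_measurable (borel :: ((real^'n) \<times> (real^'n) \<times> (real^'n)) measure)"
    unfolding gauss_window_def by (intro borel_measurable_continuous_onI continuous_intros) auto
  ultimately have "(\<lambda>z. F (snd z) * (gauss_window (fst z - fst (snd z)) * exp (\<i> * complex_of_real (fst z \<bullet> snd (snd z)))))
      \<in> borel_measurable (borel :: ((real^'n) \<times> (real^'n) \<times> (real^'n)) measure)"
    by (rule borel_measurable_times)
  then show ?thesis
    by (simp add: kernel_def case_prod_unfold lborel_prod mult.assoc)
qed

lemma measurable_kernel_section [measurable]: "kernel x \<in> borel_measurable borel"
proof -
  have "(\<lambda>p. gauss_window (x - fst p) * exp (\<i> * complex_of_real (x \<bullet> snd p)))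
      \<in> borel_measurable (borel :: ((real^'n) \<times> (real^'n)) measure)"
    unfolding gauss_window_def by (intro borel_measurable_continuous_onI continuous_intros) auto
  from borel_measurable_times[OF meas this] show ?thesis
    by (simp add: kernel_def[abs_def] mult.assoc)
qed

lemma synthesis_eq: "synthesis x = (LINT p|lborel. kernel x p)"
proof -
  have "synthesis x = (LINT p|lebesgue. kernel x p)"
    unfolding synthesis_def stft_adjoint_def kernel_def by (simp add: case_prod_unfold)
  then show ?thesis by (simp add: integral_completion)
qed

lemma measurable_synthesis [measurable]: "synthesis \<in> borel_measurable borel"
proof -
  have "(\<lambda>x. LINT p|lborel. kernel x p) \<in> borel_measurable lborel"
    by (rule lborel.borel_measurable_lebesgue_integral) measurable
  then show ?thesis by (simp add: synthesis_eq[abs_def])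
qed

lemma C_nonneg: "R \<ge> 0 \<Longrightarrow> C \<ge> 0"
  using order_trans[OF norm_ge_zero bound[of 0]] by simp

text \<open>For |y| \<le> R one has |x|^2 \<le> 2 |x - y|^2 + 2 R^2, so the shifted Gaussian still
  decays in x, with half the exponent and a constant exp(R^2/2).\<close>

lemma kernel_bound: "cmod (kernel x p) \<le> C * indicator (cball 0 R) p * (pi powr (- real CARD('n) / 4) * exp (R\<^sup>2 / 2)) * exp (- (norm x)\<^sup>2 / 4)"
proof (cases "p \<in> cball 0 R")
  case True
  then have R: "norm (fst p) \<le> R"
    using norm_fst_le[of "fst p" "snd p"] by (simp add: mem_cball_0)
  have "(norm x)\<^sup>2 \<le> 2 * (norm (x - fst p))\<^sup>2 + 2 * R\<^sup>2"
  proof -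
    have "norm x \<le> norm (x - fst p) + norm (fst p)" using norm_triangle_ineq[of "x - fst p" "fst p"] by simp
    then have "norm x \<le> norm (x - fst p) + R" using R by simp
    then have "(norm x)\<^sup>2 \<le> (norm (x - fst p) + R)\<^sup>2" by (intro power_mono) auto
    also have "\<dots> \<le> 2 * (norm (x - fst p))\<^sup>2 + 2 * R\<^sup>2"
      using sum_squares_bound[of "norm (x - fst p)" R] by (simp add: power2_sum)
    finally show ?thesis .
  qed
  then have "exp (- (norm (x - fst p))\<^sup>2 / 2) \<le> exp (R\<^sup>2 / 2) * exp (- (norm x)\<^sup>2 / 4)"
    by (simp flip: exp_add)
  then have "cmod (gauss_window (x - fst p)) \<le> pi powr (- real CARD('n) / 4) * exp (R\<^sup>2 / 2) * exp (- (norm x)\<^sup>2 / 4)"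
    by (simp add: gauss_window_def norm_mult mult.assoc mult_left_mono)
  moreover have "cmod (F p) \<le> C" "C \<ge> 0"
    using bound[of p] True C_nonneg order_trans[OF norm_ge_zero R] by simp_all
  ultimately have "cmod (F p) * cmod (gauss_window (x - fst p))
      \<le> C * (pi powr (- real CARD('n) / 4) * exp (R\<^sup>2 / 2) * exp (- (norm x)\<^sup>2 / 4))"
    by (intro mult_mono) simp_all
  moreover have "cmod (kernel x p) = cmod (F p) * cmod (gauss_window (x - fst p))"
    by (simp add: kernel_def norm_mult)
  ultimately show ?thesis
    using True by (simp only: indicator_simps mult_1_right mult.assoc)
next
  case False
  then have "F p = 0" using bound[of p] by simp
  then show ?thesis using False by (simp add: kernel_def)
qed

lemma integrable_kernel_bound: "integrable lborel (\<lambda>p::(real^'n) \<times> (real^'n). C * indicator (cball 0 R) p * (pi powr (- real CARD('n) / 4) * exp (R\<^sup>2 / 2)))"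
  by (intro integrable_mult_left integrable_mult_right integrable_real_indicator emeasure_lborel_cball_finite) auto

definition kernel_mass where "kernel_mass = (LINT p|lborel. C * indicator (cball 0 R) (p::(real^'n) \<times> (real^'n)) * (pi powr (- real CARD('n) / 4) * exp (R\<^sup>2 / 2)))"

lemma synthesis_bound: "cmod (synthesis x) \<le> kernel_mass * exp (- (norm x)\<^sup>2 / 4)"
proof -
  have "cmod (synthesis x) \<le> (LINT p|lborel. C * indicator (cball 0 R) (p :: (real^'n) \<times> (real^'n)) * (pi powr (- real CARD('n) / 4) * exp (R\<^sup>2 / 2)) * exp (- (norm x)\<^sup>2 / 4))"
    unfolding synthesis_eq
  proof (rule Bochner_Integration.integral_norm_bound_integral)
    show *: "integrable lborel (\<lambda>p::(real^'n) \<times> (real^'n). C * indicator (cball 0 R) p *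
        (pi powr (- real CARD('n) / 4) * exp (R\<^sup>2 / 2)) * exp (- (norm x)\<^sup>2 / 4))"
      by (rule integrable_mult_left[OF integrable_kernel_bound])
    show "integrable lborel (kernel x)"
      by (rule Bochner_Integration.integrable_bound[OF *])
        (auto intro!: AE_I2 order_trans[OF kernel_bound] abs_ge_self simp del: abs_mult)
  qed (rule kernel_bound)
  also have "\<dots> = kernel_mass * exp (- (norm x)\<^sup>2 / 4)"
    unfolding kernel_mass_def by simp
  finally show ?thesis .
qed

lemma synthesis_square_integrable: "integrable lborel (\<lambda>x. (cmod (synthesis x))\<^sup>2)"
proof (rule Bochner_Integration.integrable_bound)
  show "integrable lborel (\<lambda>x::real^'n. kernel_mass\<^sup>2 * exp (- (norm x)\<^sup>2 / 2))"
    by (intro integrable_mult_right integrable_exp_norm_square)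
  show "AE x in lborel. norm ((cmod (synthesis x))\<^sup>2) \<le> norm (kernel_mass\<^sup>2 * exp (- (norm x)\<^sup>2 / 2))"
  proof (rule AE_I2)
    fix x
    have "(cmod (synthesis x))\<^sup>2 \<le> (kernel_mass * exp (- (norm x)\<^sup>2 / 4))\<^sup>2" by (rule power_mono[OF synthesis_bound]) simp
    also have "\<dots> = kernel_mass\<^sup>2 * exp (- (norm x)\<^sup>2 / 2)"
      by (simp add: power_mult_distrib flip: exp_double)
    finally show "norm ((cmod (synthesis x))\<^sup>2) \<le> norm (kernel_mass\<^sup>2 * exp (- (norm x)\<^sup>2 / 2))" by simp
  qed
qed measurable

lemma synthesis_in_L2: "synthesis \<in> L2"
proof -
  have "integrable lebesgue (\<lambda>x. (cmod (synthesis x))\<^sup>2)"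
    using synthesis_square_integrable by (subst integrable_completion) auto
  then show ?thesis
    by (auto simp: L2_def intro: measurable_lebesgueI measurable_synthesis)
qed

text \<open>After Fubini, expanding |x - y|^2 gathers all dependence on x in exp(x.w) exp(-|x|^2/2),
  because x.y + i x.\<eta> = x.w for w = y + i\<eta>; this is the integral of
  \<open>integral_exp_hermite_fun\<close>. The two powers of pi cancel.\<close>

lemma hermite_coeff_synthesis:
  "hermite_coeff synthesis \<alpha> = of_real ((2 ^ mi_abs \<alpha> * mi_fact \<alpha>) powr (- 1 / 2)) *
    (LINT p|lborel. F p * of_real (exp (- (norm (fst p))\<^sup>2 / 2)) *
      exp (\<Sum>j\<in>UNIV. (cplx_vec (fst p) (snd p) $ j)\<^sup>2 / 4) * (\<Prod>j\<in>UNIV. (cplx_vec (fst p) (snd p) $ j) ^ \<alpha> j))"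
proof -
  let ?h = "\<lambda>x. complex_of_real (hermite_fun \<alpha> x)"
  define a where "a = pi powr (- real CARD('n) / 4)"
  have "hermite_coeff synthesis \<alpha> = (LINT x|lebesgue. synthesis x * ?h x)"
    by (simp add: hermite_coeff_def L2_inner_def)
  also have "\<dots> = (LINT x|lborel. synthesis x * ?h x)"
    by (rule integral_completion) measurable
  also have "\<dots> = (LINT x|lborel. LINT p|lborel. kernel x p * ?h x)"
    unfolding synthesis_eq by simp
  also have "\<dots> = (LINT p|lborel. LINT x|lborel. kernel x p * ?h x)"
  proof (rule lborel_pair.Fubini_integral[symmetric])
    show "integrable (lborel \<Otimes>\<^sub>M lborel) (\<lambda>(x, p). kernel x p * ?h x)"
    proof (rule Bochner_Integration.integrable_bound)
      let ?B = "\<lambda>p::(real^'n) \<times> (real^'n). C * indicator (cball 0 R) p * (pi powr (- real CARD('n) / 4) * exp (R\<^sup>2 / 2))"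
      show "integrable (lborel \<Otimes>\<^sub>M lborel) (\<lambda>(x, p). ?h x * of_real (?B p))"
        by (intro integrable_lborel_pair_times integrable_hermite_fun integrable_of_real integrable_kernel_bound)
      show "AE xp in lborel \<Otimes>\<^sub>M lborel. norm (case xp of (x, p) \<Rightarrow> kernel x p * ?h x) \<le> norm (case xp of (x, p) \<Rightarrow> ?h x * of_real (?B p))"
      proof (rule AE_I2)
        fix xp :: "(real^'n) \<times> (real^'n) \<times> (real^'n)"
        obtain x p where xp: "xp = (x, p)" by (cases xp)
        have "C * indicator (cball 0 R) p \<ge> 0" using order_trans[OF norm_ge_zero bound] .
        then have B: "0 \<le> ?B p" by simp
        have "cmod (kernel x p) \<le> ?B p * exp (- (norm x)\<^sup>2 / 4)" by (rule kernel_bound)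
        also have "\<dots> \<le> ?B p * 1" by (rule mult_left_mono[OF _ B]) simp
        finally have "cmod (kernel x p) * cmod (?h x) \<le> ?B p * cmod (?h x)" by (intro mult_right_mono) auto
        then show "norm (case xp of (x, p) \<Rightarrow> kernel x p * ?h x) \<le> norm (case xp of (x, p) \<Rightarrow> ?h x * of_real (?B p))"
          using B by (simp add: xp norm_mult mult.commute del: of_real_mult abs_mult)
      qed
    qed measurable
  qed
  also have "\<dots> = (LINT p|lborel. of_real ((2 ^ mi_abs \<alpha> * mi_fact \<alpha>) powr (- 1 / 2)) * (F p * of_real (exp (- (norm (fst p))\<^sup>2 / 2)) *
      exp (\<Sum>j\<in>UNIV. (cplx_vec (fst p) (snd p) $ j)\<^sup>2 / 4) * (\<Prod>j\<in>UNIV. (cplx_vec (fst p) (snd p) $ j) ^ \<alpha> j)))"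
  proof (intro Bochner_Integration.integral_cong refl)
    fix p :: "(real^'n) \<times> (real^'n)"
    let ?w = "cplx_vec (fst p) (snd p)"
    have K: "kernel x p * ?h x = F p * of_real (a * exp (- (norm (fst p))\<^sup>2 / 2)) *
      (exp (\<Sum>j\<in>UNIV. ?w $ j * of_real (x $ j)) * of_real (exp (- (norm x)\<^sup>2 / 2) * hermite_fun \<alpha> x))" for x
    proof -
      have "(norm (x - fst p))\<^sup>2 = (norm x)\<^sup>2 - 2 * (x \<bullet> fst p) + (norm (fst p))\<^sup>2"
        by (simp add: power2_norm_eq_inner inner_diff inner_commute algebra_simps)
      then have "exp (- (norm (x - fst p))\<^sup>2 / 2) = exp (- (norm x)\<^sup>2 / 2) * exp (x \<bullet> fst p) * exp (- (norm (fst p))\<^sup>2 / 2)"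
        by (simp add: field_simps flip: exp_add)
      moreover have "(\<Sum>j\<in>UNIV. ?w $ j * of_real (x $ j)) = of_real (x \<bullet> fst p) + \<i> * of_real (x \<bullet> snd p)"
        by (simp add: cplx_vec_def Complex_eq inner_vec_def sum_distrib_left algebra_simps sum.distrib)
      ultimately show ?thesis
        unfolding kernel_def gauss_window_def a_def
        by (simp only: exp_add exp_of_real of_real_mult ac_simps)
    qed
    have "(LINT x|lborel. kernel x p * ?h x) = F p * of_real (a * exp (- (norm (fst p))\<^sup>2 / 2)) *
      (of_real (pi powr (real CARD('n) / 4) * (2 ^ mi_abs \<alpha> * mi_fact \<alpha>) powr (- 1 / 2))
      * (\<Prod>j\<in>UNIV. (?w $ j) ^ \<alpha> j) * exp (\<Sum>j\<in>UNIV. (?w $ j)\<^sup>2 / 4))"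
      unfolding K by (subst integral_mult_right_zero) (simp only: integral_exp_hermite_fun)
    also have "\<dots> = of_real (a * pi powr (real CARD('n) / 4)) * (of_real ((2 ^ mi_abs \<alpha> * mi_fact \<alpha>) powr (- 1 / 2)) * (F p * of_real (exp (- (norm (fst p))\<^sup>2 / 2)) *
      exp (\<Sum>j\<in>UNIV. (?w $ j)\<^sup>2 / 4) * (\<Prod>j\<in>UNIV. (?w $ j) ^ \<alpha> j)))"
      by (simp only: of_real_mult ac_simps)
    also have "a * pi powr (real CARD('n) / 4) = 1"
      by (simp add: a_def flip: powr_add)
    finally show "(LINT x|lborel. kernel x p * ?h x) = of_real ((2 ^ mi_abs \<alpha> * mi_fact \<alpha>) powr (- 1 / 2)) * (F p * of_real (exp (- (norm (fst p))\<^sup>2 / 2)) *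
      exp (\<Sum>j\<in>UNIV. (?w $ j)\<^sup>2 / 4) * (\<Prod>j\<in>UNIV. (?w $ j) ^ \<alpha> j))"
      by simp
  qed
  finally show ?thesis by simp
qed

end

section \<open>Entire functions and power series on complex coordinate space\<close>

text \<open>The coefficient condition for power series converging on the whole space and, after the
  factor (2^|\<alpha>| \<alpha>!)^(1/2), the condition in \<open>H0_flat1\<close>. A single radius
  replaces the vector of radii there, as the smallest coordinate of that vector already
  decides.\<close>

definition rapidly_decreasing :: "('n::finite multi_index \<Rightarrow> complex) \<Rightarrow> bool" where
  "rapidly_decreasing a \<longleftrightarrow> (\<forall>r>0. \<exists>C\<ge>0. \<forall>\<alpha>. cmod (a \<alpha>) \<le> C * r ^ mi_abs \<alpha>)"

lemma power_mi_abs: "(r :: 'a :: comm_monoid_mult) ^ mi_abs \<alpha> = (\<Prod>j\<in>UNIV. r ^ \<alpha> j)"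
  by (simp add: mi_abs_def power_sum)

lemma finite_multi_index_subset_PiE:
  fixes X :: "('n::finite multi_index) set"
  assumes "finite X"
  shows "\<exists>N. X \<subseteq> PiE UNIV (\<lambda>_. {..<N})"
proof -
  have "finite (\<Union>\<beta>\<in>X. range \<beta>)" using assms by auto
  then obtain N where "\<And>\<beta> j. \<beta> \<in> X \<Longrightarrow> \<beta> j < N"
    by (meson UN_iff finite_nat_set_iff_bounded rangeI)
  then show ?thesis by (intro exI[of _ N]) auto
qed

text \<open>A finite set of multi-indices lies in a cube, over which the sum of the products factors
  into a product of partial sums.\<close>

lemma summable_on_prod_multi_index:
  fixes f :: "nat \<Rightarrow> real"
  assumes "summable f" "\<And>k. f k \<ge> 0"
  shows "(\<lambda>\<beta>::'n::finite multi_index. \<Prod>j\<in>UNIV. f (\<beta> j)) summable_on UNIV"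
proof (rule nonneg_bdd_above_summable_on)
  show "bdd_above (sum (\<lambda>\<beta>::'n multi_index. \<Prod>j\<in>UNIV. f (\<beta> j)) ` {X. X \<subseteq> UNIV \<and> finite X})"
  proof (rule bdd_aboveI2)
    fix X :: "'n multi_index set" assume "X \<in> {X. X \<subseteq> UNIV \<and> finite X}"
    then obtain N where N: "X \<subseteq> PiE UNIV (\<lambda>_. {..<N})"
      using finite_multi_index_subset_PiE by auto
    have "(\<Sum>\<beta>\<in>X. \<Prod>j\<in>UNIV. f (\<beta> j)) \<le> (\<Sum>\<beta>\<in>PiE (UNIV :: 'n set) (\<lambda>_. {..<N}). \<Prod>j\<in>UNIV. f (\<beta> j))"
      by (rule sum_mono2[OF _ N]) (auto intro!: finite_PiE prod_nonneg assms)
    also have "\<dots> = (\<Prod>j\<in>(UNIV::'n set). \<Sum>k<N. f k)"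
      by (rule prod_sum_PiE[symmetric]) auto
    also have "\<dots> \<le> (\<Prod>j\<in>(UNIV::'n set). suminf f)"
      by (intro prod_mono conjI sum_nonneg sum_le_suminf assms) auto
    finally show "(\<Sum>\<beta>\<in>X. \<Prod>j\<in>UNIV. f (\<beta> j)) \<le> (\<Prod>j\<in>(UNIV::'n set). suminf f)" .
  qed
qed (auto intro!: prod_nonneg assms)

lemma summable_on_geometric_multi_index:
  fixes r :: real
  assumes "0 \<le> r" "r < 1"
  shows "(\<lambda>\<beta>::'n::finite multi_index. r ^ mi_abs \<beta>) summable_on UNIV"
  unfolding power_mi_abs using assms by (intro summable_on_prod_multi_index summable_geometric) auto

lemma summable_on_exp_multi_index:
  fixes r :: real
  assumes "0 \<le> r"
  shows "(\<lambda>\<beta>::'n::finite multi_index. r ^ mi_abs \<beta> / mi_fact \<beta>) summable_on UNIV"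
proof -
  have "summable (\<lambda>k. r ^ k / fact k)"
    using summable_exp_generic[of r] by (simp add: divide_inverse mult.commute)
  then have "(\<lambda>\<beta>::'n multi_index. \<Prod>j\<in>UNIV. r ^ \<beta> j / fact (\<beta> j)) summable_on UNIV"
    using assms by (intro summable_on_prod_multi_index) auto
  then show ?thesis by (simp add: power_mi_abs mi_fact_def prod_dividef)
qed

lemma infsum_exp_multi_index:
  fixes z :: "'n::finite \<Rightarrow> complex"
  shows "(\<Sum>\<^sub>\<infinity>\<gamma>. (\<Prod>j\<in>UNIV. z j ^ \<gamma> j) / of_real (mi_fact \<gamma>)) = exp (\<Sum>j\<in>UNIV. z j)"
proof -
  have s: "(\<lambda>k. norm (x ^ k / fact k)) summable_on UNIV" "infsum (\<lambda>k. x ^ k / fact k) UNIV = exp x" for x :: complex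
  proof -
    have "summable (\<lambda>k. norm (x ^ k / fact k))"
      using summable_norm_exp[of x] by (simp add: norm_mult norm_inverse norm_power divide_inverse mult.commute)
    moreover have "(\<lambda>k. x ^ k / fact k) sums exp x"
      using exp_converges[of x] by (simp add: scaleR_conv_of_real divide_inverse mult.commute)
    ultimately show "(\<lambda>k. norm (x ^ k / fact k)) summable_on UNIV" "infsum (\<lambda>k. x ^ k / fact k) UNIV = exp x"
      by (auto intro!: infsumI norm_summable_imp_has_sum summable_nonneg_imp_summable_on)
  qed
  have "(\<Sum>\<^sub>\<infinity>\<gamma>\<in>PiE UNIV (\<lambda>_. UNIV). \<Prod>j\<in>UNIV. z j ^ \<gamma> j / fact (\<gamma> j)) = (\<Prod>j\<in>UNIV. \<Sum>\<^sub>\<infinity>k. z j ^ k / fact k)"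
    by (rule infsum_prod_PiE_abs) (auto simp: s)
  then show ?thesis
    by (simp add: s exp_sum mi_fact_def prod_dividef)
qed

text \<open>Turns a sum over a countable index type into an ordinary series, so that theorems on
  termwise integration and differentiation of series apply. Numbers that encode no index contribute
  0.\<close>

definition enum_fun :: "('b::countable \<Rightarrow> 'c::zero) \<Rightarrow> nat \<Rightarrow> 'c" where
  "enum_fun f n = (if n \<in> range (to_nat :: 'b \<Rightarrow> nat) then f (from_nat n) else 0)"

lemma enum_fun_has_sum:
  fixes f :: "'b::countable \<Rightarrow> 'c::{comm_monoid_add, topological_space}"
  assumes "(f has_sum s) UNIV"
  shows "(enum_fun f has_sum s) UNIV"
proof -
  have "((enum_fun f \<circ> (to_nat :: 'b \<Rightarrow> nat)) has_sum s) UNIV"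
    using assms by (simp add: enum_fun_def o_def)
  then have "(enum_fun f has_sum s) (range (to_nat :: 'b \<Rightarrow> nat))"
    by (subst has_sum_reindex) auto
  then show ?thesis
    by (subst has_sum_cong_neutral[of _ _ _ "enum_fun f"]) (auto simp: enum_fun_def)
qed

lemma enum_fun_sums:
  fixes f :: "'b::countable \<Rightarrow> 'c::{comm_monoid_add, t2_space}"
  assumes "f summable_on UNIV"
  shows "enum_fun f sums infsum f UNIV"
  using assms by (intro has_sum_imp_sums enum_fun_has_sum has_sum_infsum)

lemma norm_enum_fun: "norm (enum_fun f n) = enum_fun (\<lambda>b. norm (f b)) n"
  by (simp add: enum_fun_def)

lemma enum_fun_mono: "(\<And>b. f b \<le> g b) \<Longrightarrow> enum_fun f n \<le> (enum_fun g n :: real)"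
  by (simp add: enum_fun_def)

lemma summable_on_comparison:
  fixes f :: "'b \<Rightarrow> complex"
  assumes "d summable_on A" "\<And>b. b \<in> A \<Longrightarrow> cmod (f b) \<le> d b"
  shows "f summable_on A"
proof (rule Infinite_Sum.abs_summable_summable)
  show "(\<lambda>b. cmod (f b)) summable_on A"
    by (rule Infinite_Sum.summable_on_comparison_test[OF assms(1)]) (use assms(2) in auto)
qed

text \<open>On a finite measure summable constants serve as majorants. The index type is countable,
  so the bounds hold simultaneously outside one null set, and the claim reduces to termwise
  integration of the enumerated series.\<close>

lemma (in finite_measure) integral_infsum:
  fixes f :: "'b::countable \<Rightarrow> 'a \<Rightarrow> complex"
  assumes meas [measurable]: "\<And>b. f b \<in> borel_measurable M" "g \<in> borel_measurable M"
    and bound: "\<And>b. AE x in M. cmod (f b x) \<le> c b"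
    and c: "c summable_on UNIV"
    and g: "AE x in M. (\<Sum>\<^sub>\<infinity>b. f b x) = g x"
  shows "(LINT x|M. g x) = (\<Sum>\<^sub>\<infinity>b. (LINT x|M. f b x))"
proof -
  have ae: "AE x in M. \<forall>b. cmod (f b x) \<le> c b"
    using bound by (subst AE_all_countable) auto
  have cs: "summable (enum_fun c)"
    using enum_fun_sums[OF c] by (rule sums_summable)
  have int: "integrable M (f b)" for b
    by (rule integrable_const_bound[OF bound]) measurable
  have cnn: "(LINT x|M. cmod (f b x)) \<le> c b * measure M (space M)" for b
  proof -
    have "(LINT x|M. cmod (f b x)) \<le> (LINT x|M. c b)"
      by (rule integral_mono_AE) (use int bound in auto)
    then show ?thesis by (simp add: mult.commute)
  qed
  let ?e = "\<lambda>n x. enum_fun (\<lambda>b. f b x) n"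
  have inte: "integrable M (?e n)" for n
    using int by (cases "n \<in> range (to_nat :: 'b \<Rightarrow> nat)") (simp_all add: enum_fun_def)
  have [measurable]: "?e n \<in> borel_measurable M" for n
    using inte by auto
  have "(LINT x|M. g x) = (LINT x|M. (\<Sum>n. ?e n x))"
  proof (rule integral_cong_AE)
    show "AE x in M. g x = (\<Sum>n. ?e n x)"
      using ae g
    proof eventually_elim
      case (elim x)
      have "(\<lambda>b. f b x) summable_on UNIV"
        by (rule summable_on_comparison[OF c]) (use elim in auto)
      from enum_fun_sums[OF this] show ?case using elim by (simp add: sums_iff)
    qed
  qed measurable
  also have "\<dots> = (\<Sum>n. LINT x|M. ?e n x)"
  proof (rule integral_suminf[OF inte])
    show "AE x in M. summable (\<lambda>i. norm (?e i x))"
      using ae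
    proof eventually_elim
      case (elim x)
      show ?case
        by (rule summable_comparison_test'[OF cs]) (use elim in \<open>auto simp: norm_enum_fun intro!: enum_fun_mono simp: enum_fun_def\<close>)
    qed
    show "summable (\<lambda>i. LINT x|M. norm (?e i x))"
    proof (rule summable_comparison_test'[OF summable_mult2[OF cs, of "measure M (space M)"]])
      show "norm (LINT x|M. norm (?e n x)) \<le> enum_fun c n * measure M (space M)" for n
        using cnn by (auto simp: enum_fun_def)
    qed
  qed
  also have "\<dots> = (\<Sum>n. enum_fun (\<lambda>b. LINT x|M. f b x) n)"
    by (rule arg_cong[where f = suminf]) (auto simp: enum_fun_def)
  also have "\<dots> = (\<Sum>\<^sub>\<infinity>b. (LINT x|M. f b x))"
  proof (rule sums_unique[symmetric], rule enum_fun_sums, rule summable_on_comparison)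
    show "cmod (LINT x|M. f b x) \<le> c b * measure M (space M)" for b
      by (rule order_trans[OF integral_norm_bound cnn])
    show "(\<lambda>b. c b * measure M (space M)) summable_on UNIV"
      using c by (rule summable_on_cmult_left)
  qed
  finally show ?thesis .
qed

lemma mi_abs_add: "mi_abs (\<lambda>j. \<alpha> j + \<beta> j) = mi_abs \<alpha> + mi_abs \<beta>"
  by (simp add: mi_abs_def sum.distrib)

lemma mi_abs_double: "mi_abs (\<lambda>j. 2 * \<beta> j) = 2 * mi_abs \<beta>"
  by (simp add: mi_abs_def sum_distrib_left)

section \<open>Entire functions of several variables\<close>

lemma entire_exp_power_sum:
  "(\<lambda>z::complex^'n::finite. exp (c * (\<Sum>j\<in>UNIV. (z $ j)\<^sup>2))) \<in> entire"
proof -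
  have "((\<lambda>z. exp (c * (\<Sum>j\<in>UNIV. (z $ j)\<^sup>2))) has_derivative
      (\<lambda>h. exp (c * (\<Sum>j\<in>UNIV. (z $ j)\<^sup>2)) * (c * (\<Sum>j\<in>UNIV. 2 * z $ j * h $ j)))) (at z)" for z :: "complex^'n"
  proof -
    have "((\<lambda>z. c * (\<Sum>j\<in>UNIV. (z $ j)\<^sup>2)) has_derivative (\<lambda>h. c * (\<Sum>j\<in>UNIV. 2 * z $ j * h $ j))) (at z)"
      by (auto intro!: derivative_eq_intros bounded_linear_imp_has_derivative[OF bounded_linear_vec_nth] simp: ac_simps)
    from has_derivative_compose[OF this has_field_derivative_imp_has_derivative[OF DERIV_exp]]
    show ?thesis by simp
  qed
  then show ?thesis
    unfolding entire_def by (intro CollectI allI exI conjI) (assumption, simp add: sum_distrib_left ac_simps)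
qed

lemma entire_mult:
  assumes "F \<in> entire" "G \<in> entire"
  shows "(\<lambda>z. F z * G z) \<in> entire"
proof -
  have "\<exists>L. ((\<lambda>z. F z * G z) has_derivative L) (at z) \<and> (\<forall>c v. L (c *s v) = c * L v)" for z
  proof -
    from assms obtain L M where L: "(F has_derivative L) (at z)" "\<And>c v. L (c *s v) = c * L v"
      and M: "(G has_derivative M) (at z)" "\<And>c v. M (c *s v) = c * M v"
      unfolding entire_def by blast
    have "((\<lambda>z. F z * G z) has_derivative (\<lambda>h. F z * M h + L h * G z)) (at z)"
      by (rule has_derivative_mult[OF L(1) M(1)])
    then show ?thesis
      by (intro exI[of _ "\<lambda>h. F z * M h + L h * G z"] conjI) (auto simp: L M algebra_simps)
  qed
  then show ?thesis by (auto simp: entire_def)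
qed

lemma entire_continuous_on: "F \<in> entire \<Longrightarrow> continuous_on A F"
  unfolding entire_def
  by (blast intro: continuous_at_imp_continuous_on has_derivative_continuous)

lemma entire_line_holomorphic:
  assumes "F \<in> entire"
  shows "(\<lambda>c. F (c *s v)) holomorphic_on A"
proof -
  have "(\<lambda>c. F (c *s v)) field_differentiable (at c)" for c
  proof -
    from assms obtain L where L: "(F has_derivative L) (at (c *s v))" "\<And>c v. L (c *s v) = c * L v"
      unfolding entire_def by blast
    have "((\<lambda>c. c *s v) has_derivative (\<lambda>h. h *s v)) (at c)"
      by (rule bounded_linear_imp_has_derivative)
         (auto intro!: linear_conv_bounded_linear[THEN iffD1] linearI simp: vec_eq_iff algebra_simps)
    from diff_chain_at[OF this L(1)] have "((\<lambda>c. F (c *s v)) has_derivative (\<lambda>h. L (h *s v))) (at c)"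
      by (simp add: o_def)
    then have "((\<lambda>c. F (c *s v)) has_field_derivative L v) (at c)"
      by (simp add: has_field_derivative_def L(2) fun_eq_iff mult.commute[of _ "L v"])
    then show ?thesis by (auto simp: field_differentiable_def)
  qed
  then show ?thesis
    by (intro holomorphic_onI) (auto intro: field_differentiable_at_within)
qed

lemma cmod_monomial_le:
  assumes "\<And>j. cmod (z $ j) \<le> T"
  shows "cmod (\<Prod>j\<in>UNIV. (z $ j) ^ \<beta> j) \<le> T ^ mi_abs \<beta>"
  unfolding power_mi_abs prod_norm[symmetric] norm_power
  by (intro prod_mono conjI power_mono assms) auto

lemma rapidly_decreasing_monomial_bound:
  assumes "rapidly_decreasing G" "T > 0"
  shows "\<exists>C\<ge>0. \<forall>z \<beta>. (\<forall>j. cmod (z $ j) \<le> T) \<longrightarrow> cmod (G \<beta> * (\<Prod>j\<in>UNIV. (z $ j) ^ \<beta> j)) \<le> C * (1 / 2) ^ mi_abs \<beta>"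
proof -
  \<comment> \<open>The rate 1/(2T) compensates the growth T^|\<beta>| of the monomials and leaves
    the ratio 1/2.\<close>
  obtain C where C: "C \<ge> 0" "\<And>\<beta>. cmod (G \<beta>) \<le> C * (1 / (2 * T)) ^ mi_abs \<beta>"
    using assms unfolding rapidly_decreasing_def by (metis divide_pos_pos mult_pos_pos zero_less_numeral zero_less_one)
  have "cmod (G \<beta> * (\<Prod>j\<in>UNIV. (z $ j) ^ \<beta> j)) \<le> C * (1 / 2) ^ mi_abs \<beta>"
    if "\<forall>j. cmod (z $ j) \<le> T" for z \<beta>
  proof -
    have "cmod (G \<beta>) * cmod (\<Prod>j\<in>UNIV. (z $ j) ^ \<beta> j) \<le> (C * (1 / (2 * T)) ^ mi_abs \<beta>) * T ^ mi_abs \<beta>"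
      using that C assms by (intro mult_mono C cmod_monomial_le) auto
    also have "\<dots> = C * (1 / 2) ^ mi_abs \<beta>"
      using assms by (simp add: power_divide power_mult_distrib)
    finally show ?thesis by (simp add: norm_mult)
  qed
  then show ?thesis using C(1) by blast
qed

text \<open>Termwise differentiation on a ball around the given point: the series of derivatives
  converges there uniformly relative to the norm of the direction. Complex linearity of the
  derivative passes from the terms to the sum.\<close>

lemma power_series_entire:
  fixes G :: "'n::finite multi_index \<Rightarrow> complex"
  assumes G: "rapidly_decreasing G"
  shows "(\<lambda>z. \<Sum>\<^sub>\<infinity>\<beta>. G \<beta> * (\<Prod>j\<in>UNIV. (z $ j) ^ \<beta> j)) \<in> entire"
proof -
  define t where "t \<beta> z = G \<beta> * (\<Prod>j\<in>UNIV. (z $ j) ^ \<beta> j)" for \<beta> and z :: "complex^'n"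
  define t' where "t' \<beta> z h = G \<beta> * (\<Sum>j\<in>UNIV. (of_nat (\<beta> j) * h $ j * z $ j ^ (\<beta> j - 1)) * (\<Prod>i\<in>UNIV - {j}. (z $ i) ^ \<beta> i))"
    for \<beta> and z h :: "complex^'n"
  have der: "((t \<beta>) has_derivative t' \<beta> z) (at z within S)" for \<beta> z S
    unfolding t_def t'_def
    by (intro has_derivative_mult_right has_derivative_prod has_derivative_power
        bounded_linear_imp_has_derivative[OF bounded_linear_vec_nth])
  have "\<exists>L. ((\<lambda>z. \<Sum>\<^sub>\<infinity>\<beta>. t \<beta> z) has_derivative L) (at z\<^sub>0) \<and> (\<forall>c v. L (c *s v) = c * L v)" for z\<^sub>0
  proof -
    \<comment> \<open>The added 1 puts the point inside the open ball and gives T \<ge> 1, so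
      lowering an exponent by one, including the truncated 0 - 1, never increases the power of
      T.\<close>
    define T where "T = norm z\<^sub>0 + 1"
    have T: "T \<ge> 1" "T > 0" using norm_ge_zero[of z\<^sub>0] unfolding T_def by linarith+
    define S where "S = ball (0 :: complex^'n) T"
    have zT: "cmod (z $ j) \<le> T" if "z \<in> S" for z j
      using that Finite_Cartesian_Product.norm_nth_le[of z j] by (simp add: S_def)
    \<comment> \<open>The factor 4 is shared: one 2 pays for the degree |\<beta>| \<le> 2^|\<beta>|
      produced by differentiation, the other leaves the ratio 1/2.\<close>
    obtain C where C: "C \<ge> 0" "\<And>\<beta>. cmod (G \<beta>) \<le> C * (1 / (4 * T)) ^ mi_abs \<beta>"
      using G T unfolding rapidly_decreasing_def by (metis divide_pos_pos mult_pos_pos zero_less_numeral zero_less_one)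
    define c where "c \<beta> = C * (1 / 2) ^ mi_abs \<beta>" for \<beta> :: "'n multi_index"
    have csum: "c summable_on UNIV"
      unfolding c_def by (intro summable_on_cmult_right summable_on_geometric_multi_index) auto
    have tsum: "(\<lambda>\<beta>. t \<beta> z) summable_on UNIV" if "z \<in> S" for z
    proof -
      obtain D where "\<And>z \<beta>. (\<forall>j. cmod (z $ j) \<le> T) \<Longrightarrow> cmod (t \<beta> z) \<le> D * (1 / 2) ^ mi_abs \<beta>"
        using rapidly_decreasing_monomial_bound[OF G T(2)] unfolding t_def by blast
      with zT[OF that] show ?thesis
        by (intro summable_on_comparison[OF summable_on_cmult_right[OF summable_on_geometric_multi_index[of "1/2"], of D]]) auto
    qed
    have tb: "cmod (t' \<beta> z h) \<le> c \<beta> * norm h" if "z \<in> S" for \<beta> z h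
    proof -
      have "cmod (\<Sum>j\<in>UNIV. (of_nat (\<beta> j) * h $ j * z $ j ^ (\<beta> j - 1)) * (\<Prod>i\<in>UNIV - {j}. (z $ i) ^ \<beta> i))
        \<le> (\<Sum>j\<in>UNIV. real (\<beta> j) * (norm h * T ^ mi_abs \<beta>))"
      proof (rule sum_norm_le)
        fix j
        have "cmod (z $ j ^ (\<beta> j - 1)) \<le> T ^ \<beta> j"
        proof -
          have "cmod (z $ j ^ (\<beta> j - 1)) \<le> T ^ (\<beta> j - 1)"
            using zT[OF that] by (simp add: norm_power power_mono)
          also have "\<dots> \<le> T ^ \<beta> j" using T by (intro power_increasing) auto
          finally show ?thesis .
        qed
        moreover have "cmod (\<Prod>i\<in>UNIV - {j}. (z $ i) ^ \<beta> i) \<le> (\<Prod>i\<in>UNIV - {j}. T ^ \<beta> i)"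
          unfolding prod_norm[symmetric] norm_power
          by (intro prod_mono conjI power_mono zT[OF that]) auto
        ultimately have "cmod (z $ j ^ (\<beta> j - 1)) * cmod (\<Prod>i\<in>UNIV - {j}. (z $ i) ^ \<beta> i) \<le> T ^ \<beta> j * (\<Prod>i\<in>UNIV - {j}. T ^ \<beta> i)"
          using T by (intro mult_mono) auto
        also have "\<dots> = T ^ mi_abs \<beta>"
          unfolding power_mi_abs by (rule prod.remove[symmetric]) auto
        finally have "cmod (h $ j) * (cmod (z $ j ^ (\<beta> j - 1)) * cmod (\<Prod>i\<in>UNIV - {j}. (z $ i) ^ \<beta> i)) \<le> norm h * T ^ mi_abs \<beta>"
          by (intro mult_mono Finite_Cartesian_Product.norm_nth_le) auto
        then show "cmod ((of_nat (\<beta> j) * h $ j * z $ j ^ (\<beta> j - 1)) * (\<Prod>i\<in>UNIV - {j}. (z $ i) ^ \<beta> i))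
           \<le> real (\<beta> j) * (norm h * T ^ mi_abs \<beta>)"
          by (simp add: norm_mult mult.assoc mult_left_mono)
      qed
      also have "\<dots> = real (mi_abs \<beta>) * (norm h * T ^ mi_abs \<beta>)"
        by (simp add: mi_abs_def sum_distrib_right)
      also have "\<dots> \<le> 2 ^ mi_abs \<beta> * (norm h * T ^ mi_abs \<beta>)"
        using T by (intro mult_right_mono less_imp_le[OF of_nat_less_two_power] mult_nonneg_nonneg zero_le_power) simp_all
      finally have "cmod (t' \<beta> z h) \<le> (C * (1 / (4 * T)) ^ mi_abs \<beta>) * (2 ^ mi_abs \<beta> * (norm h * T ^ mi_abs \<beta>))"
        unfolding t'_def norm_mult[of "G \<beta>"] using C T by (intro mult_mono) auto
      also have "\<dots> = C * ((1 / (4 * T)) * 2 * T) ^ mi_abs \<beta> * norm h"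
        by (simp only: power_mult_distrib ac_simps)
      also have "(1 / (4 * T)) * 2 * T = 1 / 2" using T by simp
      finally show ?thesis by (simp add: c_def)
    qed
    have esum: "summable (enum_fun c)"
      using enum_fun_sums[OF csum] by (rule sums_summable)
    have eb: "cmod (enum_fun (\<lambda>\<beta>. t' \<beta> z h) n) \<le> enum_fun c n * norm h" if "z \<in> S" for z h n
      using tb[OF that] by (auto simp: enum_fun_def)
    have tsum': "summable (enum_fun (\<lambda>\<beta>. t' \<beta> z h))" if "z \<in> S" for z h
      by (rule summable_comparison_test'[OF summable_mult2[OF esum]]) (rule eb[OF that])
    define g' where "g' z h = (\<Sum>n. enum_fun (\<lambda>\<beta>. t' \<beta> z h) n)" for z h
    have z0: "z\<^sub>0 \<in> S" by (simp add: S_def T_def)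
    have "\<exists>g. \<forall>z\<in>S. (\<lambda>n. enum_fun (\<lambda>\<beta>. t \<beta> z) n) sums g z \<and> (g has_derivative g' z) (at z within S)"
    proof (rule has_derivative_series)
      show "convex S" by (simp add: S_def)
      show "((\<lambda>z. enum_fun (\<lambda>\<beta>. t \<beta> z) n) has_derivative (\<lambda>h. enum_fun (\<lambda>\<beta>. t' \<beta> z h) n)) (at z within S)" for n z
        using der by (cases "n \<in> range (to_nat :: 'n multi_index \<Rightarrow> nat)") (simp_all add: enum_fun_def)
      show "(\<lambda>n. enum_fun (\<lambda>\<beta>. t \<beta> z\<^sub>0) n) sums (\<Sum>\<^sub>\<infinity>\<beta>. t \<beta> z\<^sub>0)"
        using enum_fun_sums[OF tsum[OF z0]] by simp
      show "z\<^sub>0 \<in> S" by (rule z0)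
      fix e :: real assume "e > 0"
      then obtain N where N: "\<And>n. n \<ge> N \<Longrightarrow> norm (\<Sum>i. enum_fun c (i + n)) < e"
        using suminf_exist_split[OF _ esum] by blast
      have "norm ((\<Sum>i<n. enum_fun (\<lambda>\<beta>. t' \<beta> z h) i) - g' z h) \<le> e * norm h" if "n \<ge> N" "z \<in> S" for n z h
      proof -
        have "(\<Sum>i<n. enum_fun (\<lambda>\<beta>. t' \<beta> z h) i) - g' z h = - (\<Sum>i. enum_fun (\<lambda>\<beta>. t' \<beta> z h) (i + n))"
          unfolding g'_def using suminf_minus_initial_segment[OF tsum'[OF that(2), of h], of n] by simp
        also have "norm \<dots> \<le> (\<Sum>i. enum_fun c (i + n) * norm h)"
          unfolding norm_minus_cancel
        proof (rule norm_suminf_le)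
          show "summable (\<lambda>i. enum_fun c (i + n) * norm h)"
            by (intro summable_mult2 summable_ignore_initial_segment esum)
        qed (rule eb[OF that(2)])
        also have "\<dots> = (\<Sum>i. enum_fun c (i + n)) * norm h"
          by (intro suminf_mult2[symmetric] summable_ignore_initial_segment esum)
        also have "\<dots> \<le> e * norm h"
          using N[OF that(1)] by (intro mult_right_mono) auto
        finally show ?thesis .
      qed
      then show "\<forall>\<^sub>F n in sequentially. \<forall>z\<in>S. \<forall>h. norm ((\<Sum>i<n. enum_fun (\<lambda>\<beta>. t' \<beta> z h) i) - g' z h) \<le> e * norm h"
        unfolding eventually_sequentially by blast
    qed
    then obtain g where g: "\<And>z. z \<in> S \<Longrightarrow> (\<lambda>n. enum_fun (\<lambda>\<beta>. t \<beta> z) n) sums g z"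
      "\<And>z. z \<in> S \<Longrightarrow> (g has_derivative g' z) (at z within S)" by blast
    have "g z = (\<Sum>\<^sub>\<infinity>\<beta>. t \<beta> z)" if "z \<in> S" for z
      using sums_unique2[OF g(1)[OF that] enum_fun_sums[OF tsum[OF that]]] .
    moreover have "(g has_derivative g' z\<^sub>0) (at z\<^sub>0)"
      using g(2)[OF z0] at_within_open[OF z0] by (simp add: S_def)
    ultimately have "((\<lambda>z. \<Sum>\<^sub>\<infinity>\<beta>. t \<beta> z) has_derivative g' z\<^sub>0) (at z\<^sub>0)"
      using has_derivative_transform_within_open[of g _ z\<^sub>0 UNIV S] z0 by (simp add: S_def)
    moreover have "g' z\<^sub>0 (a *s v) = a * g' z\<^sub>0 v" for a v
    proof -
      have "t' \<beta> z\<^sub>0 (a *s v) = a * t' \<beta> z\<^sub>0 v" for \<beta>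
        unfolding t'_def by (simp add: sum_distrib_left ac_simps)
      then have "enum_fun (\<lambda>\<beta>. t' \<beta> z\<^sub>0 (a *s v)) = (\<lambda>n. a * enum_fun (\<lambda>\<beta>. t' \<beta> z\<^sub>0 v) n)"
        by (simp add: enum_fun_def fun_eq_iff)
      then show ?thesis
        unfolding g'_def using suminf_mult[OF tsum'[OF z0, of v], of a] by (simp only:)
    qed
    ultimately show ?thesis by blast
  qed
  then show ?thesis by (simp add: entire_def t_def)
qed

text \<open>Cauchy's inequality turns the bound on a disc into a bound on the derivatives in a
  smaller one, hence into a Lipschitz bound for almost every x. The difference quotients are then
  dominated by a constant, which is integrable because the measure is finite.\<close>

lemma holomorphic_on_integral:
  fixes \<Phi> :: "complex \<Rightarrow> 'a \<Rightarrow> complex"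
  assumes "finite_measure M" and A: "open A"
    and meas: "\<And>z. z \<in> A \<Longrightarrow> \<Phi> z \<in> borel_measurable M"
    and hol: "\<And>x. (\<lambda>z. \<Phi> z x) holomorphic_on A"
    and bound: "\<And>z r. r > 0 \<Longrightarrow> cball z r \<subseteq> A \<Longrightarrow> \<exists>B. AE x in M. \<forall>y\<in>cball z r. cmod (\<Phi> y x) \<le> B"
  shows "(\<lambda>z. LINT x|M. \<Phi> z x) holomorphic_on A"
proof -
  interpret finite_measure M by fact
  have "(\<lambda>z. LINT x|M. \<Phi> z x) field_differentiable (at z)" if z: "z \<in> A" for z
  proof -
    obtain e where e: "e > 0" "cball z e \<subseteq> A"
      using A z open_contains_cball_eq by blast
    \<comment> \<open>Half the radius: a disc of radius r around any point of
      \<open>ball z r\<close> stays in \<open>cball z e\<close>, where the bound B is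
      available.\<close>
    define r where "r = e / 2"
    have r: "r > 0" "e = r + r" using e by (auto simp: r_def)
    obtain B where B: "AE x in M. \<forall>y\<in>cball z e. cmod (\<Phi> y x) \<le> B"
      using bound[OF e] by blast
    define D where "D y x = deriv (\<lambda>z. \<Phi> z x) y" for y x
    have der: "((\<lambda>z. \<Phi> z x) has_field_derivative D y x) (at y)" if "y \<in> A" for y x
      unfolding D_def by (rule holomorphic_derivI[OF hol A that])
    have int: "integrable M (\<Phi> y)" if "y \<in> cball z e" for y
      by (rule integrable_const_bound[where B = B]) (use B e that in \<open>auto intro: meas elim!: eventually_mono\<close>)
    have lip: "AE x in M. \<forall>y\<in>ball z r. cmod (\<Phi> y x - \<Phi> z x) \<le> B / r * cmod (y - z)"
      using B
    proof eventually_elim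
      case (elim x)
      have Db: "cmod (D y x) \<le> B / r" if "y \<in> ball z r" for y
      proof -
        have sub: "cball y r \<subseteq> cball z e"
        proof
          fix x assume "x \<in> cball y r"
          then show "x \<in> cball z e" using that r dist_triangle[of z x y] by (simp add: dist_commute)
        qed
        have "cmod ((deriv ^^ 1) (\<lambda>z. \<Phi> z x) y) \<le> fact 1 * B / r ^ 1"
        proof (rule Cauchy_inequality)
          show "(\<lambda>z. \<Phi> z x) holomorphic_on ball y r"
            using hol[of x] sub e(2) ball_subset_cball by (blast intro: holomorphic_on_subset)
          show "continuous_on (cball y r) (\<lambda>z. \<Phi> z x)"
            using hol[of x] sub e(2) by (blast intro: holomorphic_on_imp_continuous_on holomorphic_on_subset)
          show "cmod (\<Phi> w x) \<le> B" if "norm (y - w) = r" for w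
            using elim sub that by (auto simp: dist_norm)
        qed (rule r)
        then show ?thesis by (simp add: D_def)
      qed
      show ?case
      proof
        fix y assume y: "y \<in> ball z r"
        have sub: "ball z r \<subseteq> A" using e r by (auto simp: subset_eq)
        show "cmod (\<Phi> y x - \<Phi> z x) \<le> B / r * cmod (y - z)"
          by (rule field_differentiable_bound[where S = "ball z r" and f' = "\<lambda>y. D y x"])
             (use y r Db has_field_derivative_at_within[OF der[OF subsetD[OF sub]]] in auto)
      qed
    qed
    have "((\<lambda>y. ((LINT x|M. \<Phi> y x) - (LINT x|M. \<Phi> z x)) / (y - z)) \<longlongrightarrow> (LINT x|M. D z x)) (at z within ball z r)"
      unfolding tendsto_at_iff_sequentially
    proof (intro allI impI)
      fix X :: "nat \<Rightarrow> complex" assume X: "\<forall>i. X i \<in> ball z r - {z}" and lim: "X \<longlonglongrightarrow> z"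
      let ?Q = "\<lambda>i x. (\<Phi> (X i) x - \<Phi> z x) / (X i - z)"
      have XA: "X i \<in> A" "X i \<in> cball z e" for i
        using X[rule_format, of i] e r by (auto simp: subset_eq)
      have [measurable]: "?Q i \<in> borel_measurable M" for i
        using meas[OF XA(1)] meas[OF z] by measurable
      have conv: "(\<lambda>i. ?Q i x) \<longlonglongrightarrow> D z x" for x
      proof -
        have "((\<lambda>y. (\<Phi> y x - \<Phi> z x) / (y - z)) \<longlongrightarrow> D z x) (at z)"
          using der[OF z, of x] by (simp add: has_field_derivative_iff)
        moreover have "filterlim X (at z) sequentially"
          using lim X by (auto simp: filterlim_at)
        ultimately show ?thesis by (rule filterlim_compose)
      qed
      have "(\<lambda>i. LINT x|M. ?Q i x) \<longlonglongrightarrow> (LINT x|M. D z x)"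
      proof (rule integral_dominated_convergence[where w = "\<lambda>_. B / r"])
        show "D z \<in> borel_measurable M"
          by (rule borel_measurable_LIMSEQ_metric[OF _ conv]) measurable
        show "AE x in M. norm (?Q i x) \<le> B / r" for i
          using lip
        proof eventually_elim
          case (elim x)
          then show ?case using X[rule_format, of i]
            by (auto simp: norm_divide divide_le_eq)
        qed
      qed (use conv in auto)
      moreover have "(LINT x|M. ?Q i x) = ((LINT x|M. \<Phi> (X i) x) - (LINT x|M. \<Phi> z x)) / (X i - z)" for i
        using int[OF XA(2)[of i]] int[of z] e by (simp add: Bochner_Integration.integral_diff)
      ultimately show "((\<lambda>y. ((LINT x|M. \<Phi> y x) - (LINT x|M. \<Phi> z x)) / (y - z)) \<circ> X) \<longlonglongrightarrow> (LINT x|M. D z x)"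
        by (simp only: o_def)
    qed
    then have "((\<lambda>z. LINT x|M. \<Phi> z x) has_field_derivative (LINT x|M. D z x)) (at z)"
      unfolding has_field_derivative_iff using at_within_open[of z "ball z r"] r by simp
    then show ?thesis by (auto simp: field_differentiable_def)
  qed
  then show ?thesis
    by (intro holomorphic_onI) (auto intro: field_differentiable_at_within)
qed

text \<open>The identity theorem on the connected punctured plane: K agrees with the constant K 1 on
  the unit circle, which accumulates at 1.\<close>

lemma holomorphic_punctured_constant:
  assumes hol: "K holomorphic_on - {0}" and rot: "\<And>\<theta>. K (cis \<theta>) = K 1" and z: "z \<noteq> 0"
  shows "K z = K 1"
proof -
  have "(\<lambda>z. K z - K 1) z = 0"
  proof (rule analytic_continuation[of "\<lambda>z. K z - K 1" "- {0}" "sphere 0 1" 1])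
    show "(\<lambda>z. K z - K 1) holomorphic_on - {0}"
      by (intro holomorphic_intros hol)
    show "connected (- {0 :: complex})"
      by (rule connected_punctured_universe) simp
    show "1 islimpt sphere (0 :: complex) 1"
    proof (rule connected_imp_perfect)
      have "-1 \<in> sphere (0 :: complex) 1" "1 \<in> sphere (0 :: complex) 1" by simp_all
      then show "sphere (0 :: complex) 1 \<noteq> {a}" for a by (metis singletonD one_neq_neg_one)
      show "connected (sphere (0 :: complex) 1)" by (rule connected_sphere) simp
    qed simp
    show "K z - K 1 = 0" if "z \<in> sphere 0 1" for z
      using that rot[of "Arg z"] rcis_cmod_Arg[of z] by (simp add: rcis_def)
  qed (use z in auto)
  then show ?thesis by simp
qed

definition conj_vec :: "complex^'n::finite \<Rightarrow> complex^'n" where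
  "conj_vec w = (\<chi> j. cnj (w $ j))"

definition monomial :: "'n::finite multi_index \<Rightarrow> complex^'n \<Rightarrow> complex" where
  "monomial \<alpha> w = (\<Prod>j\<in>UNIV. (w $ j) ^ \<alpha> j)"

lemma entire_bounded:
  fixes F :: "complex^'n::finite \<Rightarrow> complex"
  assumes "F \<in> entire"
  shows "\<exists>B\<ge>0. \<forall>u. (\<forall>j. cmod (u $ j) \<le> T) \<longrightarrow> cmod (F u) \<le> B"
proof -
  have "compact (F ` cball 0 (real CARD('n) * T))"
    by (intro compact_continuous_image entire_continuous_on assms compact_cball)
  then obtain B where B: "\<And>u. u \<in> cball 0 (real CARD('n) * T) \<Longrightarrow> cmod (F u) \<le> B"
    by (meson bounded_iff compact_imp_bounded image_eqI)
  have "u \<in> cball 0 (real CARD('n) * T)" if "\<forall>j. cmod (u $ j) \<le> T" for u :: "complex^'n"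
  proof -
    have "norm u \<le> (\<Sum>j\<in>UNIV. cmod (u $ j))"
      unfolding norm_vec_def by (rule L2_set_le_sum) auto
    also have "\<dots> \<le> (\<Sum>j\<in>(UNIV::'n set). T)" by (rule sum_mono) (use that in auto)
    finally show ?thesis by simp
  qed
  with B show ?thesis by (intro exI[of _ "max 0 B"]) (auto simp: le_max_iff_disj)
qed

section \<open>Moments of rotation invariant measures\<close>

text \<open>The angles in the coordinates are independent. Equal angles drive the rescaling
  argument, and an angle in a single coordinate yields the orthogonality of monomials.\<close>

locale toric_measure = finite_measure M for M :: "(complex^'n::finite) measure" +
  fixes R :: real
  assumes sets_M [measurable_cong]: "sets M = sets borel"
    and R_pos: "R > 0"
    and bounded: "AE w in M. \<forall>j. cmod (w $ j) \<le> R"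
    and rotate: "distr M borel (\<lambda>w. \<chi> j. cis (\<theta> j) * w $ j) = M"
begin

lemma measurable_continuous: "continuous_on UNIV f \<Longrightarrow> (f :: complex^'n \<Rightarrow> complex) \<in> borel_measurable M"
  using borel_measurable_continuous_onI measurable_cong_sets[OF sets_M refl] by blast

lemma continuous_on_conj_vec: "continuous_on A conj_vec"
  unfolding conj_vec_def by (intro continuous_intros)

lemma continuous_on_monomial: "continuous_on A (monomial \<alpha>)"
  unfolding monomial_def[abs_def] by (intro continuous_intros)

lemma integral_rotate:
  assumes "continuous_on UNIV f"
  shows "(LINT w|M. f (\<chi> j. cis (\<theta> j) * w $ j)) = (LINT w|M. (f w :: complex))"
proof -
  have rm: "(\<lambda>w::complex^'n. \<chi> j. cis (\<theta> j) * w $ j) \<in> borel_measurable M"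
    unfolding measurable_cong_sets[OF sets_M refl]
    by (intro borel_measurable_continuous_onI continuous_intros)
  show ?thesis
    by (subst (2) rotate[of \<theta>, symmetric], subst integral_distr[OF rm])
       (auto intro!: borel_measurable_continuous_onI assms)
qed

lemma integrable_bounded_on_support:
  assumes "continuous_on UNIV f" "\<And>w. (\<forall>j. cmod (w $ j) \<le> R) \<Longrightarrow> cmod (f w) \<le> B"
  shows "integrable M f"
  by (rule integrable_const_bound[where B = B])
     (use bounded assms in \<open>auto intro: measurable_continuous elim!: eventually_mono\<close>)

lemma integral_bound_on_support:
  assumes "continuous_on UNIV f" "\<And>w. (\<forall>j. cmod (w $ j) \<le> R) \<Longrightarrow> cmod (f w) \<le> B"
  shows "cmod (LINT w|M. f w) \<le> B * measure M (space M)"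
proof -
  have "cmod (LINT w|M. f w) \<le> (LINT w|M. cmod (f w))" by (rule integral_norm_bound)
  also have "\<dots> \<le> (LINT w|M. B)"
    by (rule integral_mono_AE)
       (use bounded integrable_bounded_on_support[OF assms] assms(2) in \<open>auto elim!: eventually_mono\<close>)
  finally show ?thesis by (simp add: mult.commute)
qed

text \<open>The part of the Gaussian kernel that is not rotation invariant; the invariant part will
  belong to the measure.\<close>

definition twist :: "complex^'n \<Rightarrow> complex" where
  "twist w = exp ((1 / 8) * (\<Sum>j\<in>UNIV. (conj_vec w $ j)\<^sup>2) - (1 / 8) * (\<Sum>j\<in>UNIV. (w $ j)\<^sup>2))"

text \<open>On the unit circle \<open>inverse z\<close> is the conjugate of z, so there this is the
  moment integrand at the rotated point, by \<open>scaled_cis\<close>. Writing the inverse in place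
  of the conjugate makes the dependence on z holomorphic off the origin.\<close>

definition scaled :: "(complex^'n \<Rightarrow> complex) \<Rightarrow> 'n multi_index \<Rightarrow> complex \<Rightarrow> complex^'n \<Rightarrow> complex" where
  "scaled F \<alpha> z w = F (inverse z *s conj_vec w) *
     exp ((1 / 8) * (\<Sum>j\<in>UNIV. (inverse z * conj_vec w $ j)\<^sup>2) - (1 / 8) * (\<Sum>j\<in>UNIV. (z * w $ j)\<^sup>2)) *
     (z ^ mi_abs \<alpha> * monomial \<alpha> w)"

lemma scaled_1: "scaled F \<alpha> 1 w = F (conj_vec w) * twist w * monomial \<alpha> w"
  by (simp add: scaled_def twist_def)

lemma continuous_on_scaled: "F \<in> entire \<Longrightarrow> continuous_on A (scaled F \<alpha> z)"
  unfolding scaled_def[abs_def] conj_vec_def vector_scalar_mult_def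
  by (intro continuous_intros continuous_on_monomial continuous_on_compose2[OF entire_continuous_on[of F UNIV]]) auto

lemma holomorphic_scaled:
  assumes "F \<in> entire"
  shows "(\<lambda>z. scaled F \<alpha> z w) holomorphic_on - {0}"
proof -
  have "(\<lambda>z. F (inverse z *s conj_vec w)) holomorphic_on - {0}"
  proof -
    have "(\<lambda>z. inverse z) holomorphic_on - {0 :: complex}"
      by (intro holomorphic_intros) auto
    from holomorphic_on_compose_gen[OF this entire_line_holomorphic[OF assms, of "conj_vec w" UNIV]]
    show ?thesis by (simp add: o_def)
  qed
  then show ?thesis
    unfolding scaled_def by (intro holomorphic_intros) auto
qed

lemma scaled_cis: "scaled F \<alpha> (cis t) w = scaled F \<alpha> 1 (\<chi> j. cis t * w $ j)"
proof -
  have "monomial \<alpha> (\<chi> j. cis t * w $ j) = cis t ^ mi_abs \<alpha> * monomial \<alpha> w"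
    by (simp add: monomial_def power_mult_distrib prod.distrib power_mi_abs)
  moreover have "inverse (cis t) *s conj_vec w = conj_vec (\<chi> j. cis t * w $ j)"
    by (simp add: conj_vec_def vec_eq_iff cis_cnj cis_inverse)
  moreover have "(inverse (cis t) * conj_vec w $ j) = conj_vec (\<chi> j. cis t * w $ j) $ j" for j
    by (simp add: conj_vec_def cis_cnj cis_inverse)
  ultimately show ?thesis
    by (simp add: scaled_def)
qed

text \<open>For z in an annulus the arguments of F and of the exponential stay in a fixed bounded
  set, whence one constant for all \<alpha>. The power of |z| is kept explicit because it is the
  source of the decay.\<close>

lemma scaled_bound:
  assumes F: "F \<in> entire" and d: "0 < d"
  shows "\<exists>B\<ge>0. \<forall>\<alpha> z w. d \<le> cmod z \<longrightarrow> cmod z \<le> D \<longrightarrow> (\<forall>j. cmod (w $ j) \<le> R) \<longrightarrow>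
    cmod (scaled F \<alpha> z w) \<le> B * (cmod z * R) ^ mi_abs \<alpha>"
proof -
  obtain B where B: "B \<ge> 0" "\<And>u. (\<forall>j. cmod (u $ j) \<le> R / d) \<Longrightarrow> cmod (F u) \<le> B"
    using entire_bounded[OF F] by blast
  define E where "E = exp (real CARD('n) * (R / d)\<^sup>2 + real CARD('n) * (D * R)\<^sup>2)"
  have "cmod (scaled F \<alpha> z w) \<le> (B * E) * (cmod z * R) ^ mi_abs \<alpha>"
    if z: "d \<le> cmod z" "cmod z \<le> D" and w: "\<forall>j. cmod (w $ j) \<le> R" for \<alpha> z w
  proof -
    have u: "cmod (inverse z * conj_vec w $ j) \<le> R / d" for j
    proof -
      have "inverse (cmod z) * cmod (w $ j) \<le> inverse d * R"
        using z d w by (intro mult_mono le_imp_inverse_le) auto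
      then show ?thesis by (simp add: norm_mult norm_inverse conj_vec_def divide_inverse mult.commute)
    qed
    have v: "cmod (z * w $ j) \<le> D * R" for j
      unfolding norm_mult using z d w by (intro mult_mono) auto
    have 1: "cmod (F (inverse z *s conj_vec w)) \<le> B"
      using u by (intro B) simp
    have "cmod ((1 / 8) * (\<Sum>j\<in>UNIV. (inverse z * conj_vec w $ j)\<^sup>2) - (1 / 8) * (\<Sum>j\<in>UNIV. (z * w $ j)\<^sup>2))
        \<le> cmod (\<Sum>j\<in>UNIV. (inverse z * conj_vec w $ j)\<^sup>2) + cmod (\<Sum>j\<in>UNIV. (z * w $ j)\<^sup>2)"
      by (rule order_trans[OF norm_triangle_ineq4 add_mono]) (simp_all add: norm_mult field_simps)
    also have "\<dots> \<le> (\<Sum>j\<in>(UNIV :: 'n set). (R / d)\<^sup>2) + (\<Sum>j\<in>(UNIV :: 'n set). (D * R)\<^sup>2)"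
      using u v by (intro add_mono sum_norm_le) (simp_all only: norm_power power_mono norm_ge_zero)
    finally have 2: "cmod (exp ((1 / 8) * (\<Sum>j\<in>UNIV. (inverse z * conj_vec w $ j)\<^sup>2) - (1 / 8) * (\<Sum>j\<in>UNIV. (z * w $ j)\<^sup>2))) \<le> E"
      by (intro order_trans[OF norm_exp]) (simp add: E_def)
    have 3: "cmod (z ^ mi_abs \<alpha> * monomial \<alpha> w) \<le> (cmod z * R) ^ mi_abs \<alpha>"
      using cmod_monomial_le[of w R \<alpha>] w
      by (simp add: monomial_def norm_mult norm_power power_mult_distrib mult_left_mono)
    show ?thesis
      unfolding scaled_def norm_mult[of "_ * _" "_ * monomial _ _"] norm_mult[of "F _"]
      using B(1) by (intro mult_mono 1 2 3 mult_nonneg_nonneg) (auto simp: E_def)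
  qed
  then show ?thesis using B(1) by (intro exI[of _ "B * E"]) (auto simp: E_def)
qed

lemma integral_scaled_constant:
  assumes F: "F \<in> entire" and z: "z \<noteq> 0"
  shows "(LINT w|M. scaled F \<alpha> z w) = (LINT w|M. scaled F \<alpha> 1 w)"
proof (rule holomorphic_punctured_constant[OF _ _ z])
  show "(\<lambda>z. LINT w|M. scaled F \<alpha> z w) holomorphic_on - {0}"
  proof (rule holomorphic_on_integral)
    show "finite_measure M" by (rule finite_measure_axioms)
    fix z :: complex and r :: real assume r: "r > 0" "cball z r \<subseteq> - {0}"
    \<comment> \<open>A lower bound for |y| on the disc, which keeps the inverse in
      \<open>scaled\<close> bounded.\<close>
    define d where "d = cmod z - r"
    have d: "d > 0"
    proof (rule ccontr)
      assume "\<not> d > 0"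
      then have "0 \<in> cball z r" by (simp add: d_def)
      then show False using r by auto
    qed
    obtain B where B: "B \<ge> 0" "\<And>\<alpha> y w. d \<le> cmod y \<Longrightarrow> cmod y \<le> cmod z + r \<Longrightarrow> (\<forall>j. cmod (w $ j) \<le> R) \<Longrightarrow>
      cmod (scaled F \<alpha> y w) \<le> B * (cmod y * R) ^ mi_abs \<alpha>"
      using scaled_bound[OF F d, of "cmod z + r"] by blast
    have "AE w in M. \<forall>y\<in>cball z r. cmod (scaled F \<alpha> y w) \<le> B * ((cmod z + r) * R) ^ mi_abs \<alpha>"
      using bounded
    proof eventually_elim
      case (elim w)
      show ?case
      proof
        fix y assume "y \<in> cball z r"
        then have y: "cmod (z - y) \<le> r" by (simp add: dist_norm)
        have "d \<le> cmod y" "cmod y \<le> cmod z + r"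
          using y norm_triangle_ineq2[of z y] norm_triangle_ineq3[of z y] by (auto simp: d_def)
        with elim have "cmod (scaled F \<alpha> y w) \<le> B * (cmod y * R) ^ mi_abs \<alpha>" by (intro B)
        also have "\<dots> \<le> B * ((cmod z + r) * R) ^ mi_abs \<alpha>"
          using \<open>cmod y \<le> cmod z + r\<close> R_pos B(1) by (intro mult_left_mono power_mono mult_right_mono) auto
        finally show "cmod (scaled F \<alpha> y w) \<le> B * ((cmod z + r) * R) ^ mi_abs \<alpha>" .
      qed
    qed
    then show "\<exists>B. AE w in M. \<forall>y\<in>cball z r. cmod (scaled F \<alpha> y w) \<le> B" by blast
  qed (auto intro: measurable_continuous continuous_on_scaled F holomorphic_scaled)
  show "(LINT w|M. scaled F \<alpha> (cis t) w) = (LINT w|M. scaled F \<alpha> 1 w)" for t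
    unfolding scaled_cis by (rule integral_rotate) (rule continuous_on_scaled[OF F])
qed

lemma moments_rapidly_decreasing:
  assumes F: "F \<in> entire"
  shows "rapidly_decreasing (\<lambda>\<alpha>. LINT w|M. F (conj_vec w) * twist w * monomial \<alpha> w)"
  unfolding rapidly_decreasing_def
proof (intro allI impI)
  fix r :: real assume r: "r > 0"
  \<comment> \<open>Chosen so that |z| R = r: the bound of \<open>scaled_bound\<close> then decays
    exactly like r^|\<alpha>|, with a constant that depends on r but not on \<alpha>.\<close>
  define z where "z = complex_of_real (r / R)"
  have z: "z \<noteq> 0" "cmod z = r / R" using r R_pos by (auto simp: z_def norm_divide)
  obtain B where B: "B \<ge> 0" "\<And>\<alpha> y w. r / R \<le> cmod y \<Longrightarrow> cmod y \<le> r / R \<Longrightarrow> (\<forall>j. cmod (w $ j) \<le> R) \<Longrightarrow>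
      cmod (scaled F \<alpha> y w) \<le> B * (cmod y * R) ^ mi_abs \<alpha>"
    using scaled_bound[OF F divide_pos_pos[OF r R_pos], of "r / R"] by blast
  have "cmod (LINT w|M. F (conj_vec w) * twist w * monomial \<alpha> w) \<le> (B * measure M (space M)) * r ^ mi_abs \<alpha>" for \<alpha>
  proof -
    have "(LINT w|M. F (conj_vec w) * twist w * monomial \<alpha> w) = (LINT w|M. scaled F \<alpha> z w)"
      unfolding scaled_1[symmetric] by (rule integral_scaled_constant[OF F z(1), symmetric])
    also have "cmod \<dots> \<le> (B * (cmod z * R) ^ mi_abs \<alpha>) * measure M (space M)"
    proof (rule integral_bound_on_support[OF continuous_on_scaled[OF F]])
      show "cmod (scaled F \<alpha> z w) \<le> B * (cmod z * R) ^ mi_abs \<alpha>" if "\<forall>j. cmod (w $ j) \<le> R" for w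
        using that by (intro B) (simp_all add: z(2))
    qed
    finally show ?thesis using R_pos by (simp add: z mult.commute mult.left_commute)
  qed
  then show "\<exists>C\<ge>0. \<forall>\<alpha>. cmod (LINT w|M. F (conj_vec w) * twist w * monomial \<alpha> w) \<le> C * r ^ mi_abs \<alpha>"
    using B(1) by (intro exI[of _ "B * measure M (space M)"]) auto
qed

end

section \<open>Inverting the exponential of the double shift on coefficient families\<close>

lemma infsum_If_eq: "(\<Sum>\<^sub>\<infinity>x. if x = a then c else 0) = (c :: 'a :: {comm_monoid_add, t2_space})"
proof -
  have "(\<Sum>\<^sub>\<infinity>x. if x = a then c else 0) = (\<Sum>\<^sub>\<infinity>x\<in>{a}. c)"
    by (rule infsum_cong_neutral) auto
  then show ?thesis by simp
qed

text \<open>The coefficient of z^\<gamma> in exp(c (z_1 + ... + z_d)). Reading z_j as w_j^2, or as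
  the double left shift in coordinate j, gives both exponentials used below.\<close>

definition exp_coeff :: "real \<Rightarrow> 'n::finite multi_index \<Rightarrow> complex" where
  "exp_coeff c \<gamma> = of_real (c ^ mi_abs \<gamma> / mi_fact \<gamma>)"

lemma cmod_exp_coeff: "cmod (exp_coeff c \<gamma>) = \<bar>c\<bar> ^ mi_abs \<gamma> / mi_fact \<gamma>"
  using mi_fact_pos[of \<gamma>] by (simp add: exp_coeff_def norm_divide norm_power power_abs flip: of_real_power)

text \<open>Coefficient form of exp(-c s) exp(c s) = 1. The sum over the box below \<sigma> factors
  over the coordinates, and each factor is an alternating binomial sum.\<close>

lemma sum_exp_coeff_convolution:
  fixes \<sigma> :: "'n::finite multi_index"
  shows "(\<Sum>\<gamma> | \<forall>j. \<gamma> j \<le> \<sigma> j. exp_coeff (- c) \<gamma> * exp_coeff c (\<lambda>j. \<sigma> j - \<gamma> j)) = (if \<sigma> = (\<lambda>_. 0) then 1 else 0)"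
proof -
  define p where "p k = (\<Sum>i\<le>k. (- c) ^ i / fact i * (c ^ (k - i) / fact (k - i)))" for k :: nat
  have p: "p k = (if k = 0 then 1 else 0)" for k
  proof -
    have "p k = (\<Sum>i\<le>k. c ^ k / fact k * ((-1) ^ i * of_nat (k choose i)))"
      unfolding p_def
    proof (rule sum.cong[OF refl])
      fix i assume "i \<in> {..k}"
      then have i: "i \<le> k" by simp
      have "(- c) ^ i * c ^ (k - i) = (-1) ^ i * c ^ k"
        using i by (simp add: power_minus[of c] mult.assoc flip: power_add)
      then show "(- c) ^ i / fact i * (c ^ (k - i) / fact (k - i)) = c ^ k / fact k * ((-1) ^ i * of_nat (k choose i))"
        using i by (simp add: binomial_fact field_simps)
    qed
    also have "\<dots> = c ^ k / fact k * (\<Sum>i\<le>k. (-1) ^ i * of_nat (k choose i))"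
      by (rule sum_distrib_left[symmetric])
    also have "\<dots> = (if k = 0 then 1 else 0)"
      using choose_alternating_sum[of k, where 'a = real] by auto
    finally show ?thesis .
  qed
  have set: "{\<gamma>. \<forall>j. \<gamma> j \<le> \<sigma> j} = PiE UNIV (\<lambda>j. {..\<sigma> j})"
    by (auto simp: PiE_def)
  have "(\<Sum>\<gamma> | \<forall>j. \<gamma> j \<le> \<sigma> j. exp_coeff (- c) \<gamma> * exp_coeff c (\<lambda>j. \<sigma> j - \<gamma> j)) =
     of_real (\<Sum>\<gamma>\<in>PiE UNIV (\<lambda>j. {..\<sigma> j}). \<Prod>j\<in>UNIV. (- c) ^ \<gamma> j / fact (\<gamma> j) * (c ^ (\<sigma> j - \<gamma> j) / fact (\<sigma> j - \<gamma> j)))"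
    unfolding set exp_coeff_def power_mi_abs mi_fact_def
    by (simp add: prod.distrib prod_dividef)
  also have "(\<Sum>\<gamma>\<in>PiE UNIV (\<lambda>j. {..\<sigma> j}). \<Prod>j\<in>UNIV. (- c) ^ \<gamma> j / fact (\<gamma> j) * (c ^ (\<sigma> j - \<gamma> j) / fact (\<sigma> j - \<gamma> j))) = (\<Prod>j\<in>UNIV. p (\<sigma> j))"
    unfolding p_def by (rule prod_sum_PiE[symmetric]) auto
  also have "\<dots> = (if \<sigma> = (\<lambda>_. 0) then 1 else 0)"
    by (auto simp: p fun_eq_iff)
  finally show ?thesis by simp
qed

text \<open>The double series is regrouped by \<sigma> = \<gamma> + \<kappa>. The shifted
  coefficient then depends on \<sigma> only, so the convolution identity leaves just the term
  \<sigma> = 0. For bounded a the factorials give the absolute convergence that permits the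
  regrouping.\<close>

lemma exp_shift_inverse:
  fixes a :: "'n::finite multi_index \<Rightarrow> complex" and c :: real
  assumes A: "\<And>\<beta>. cmod (a \<beta>) \<le> A"
  defines "u \<equiv> \<lambda>\<beta>. \<Sum>\<^sub>\<infinity>\<gamma>. exp_coeff c \<gamma> * a (\<lambda>j. \<beta> j + 2 * \<gamma> j)"
  shows "(\<Sum>\<^sub>\<infinity>\<gamma>. exp_coeff (- c) \<gamma> * u (\<lambda>j. \<alpha> j + 2 * \<gamma> j)) = a \<alpha>"
proof -
  define P where "P \<gamma> \<kappa> = exp_coeff (- c) \<gamma> * exp_coeff c \<kappa> * a (\<lambda>j. \<alpha> j + 2 * (\<gamma> j + \<kappa> j))" for \<gamma> \<kappa> :: "'n multi_index"
  define E where "E \<gamma> = \<bar>c\<bar> ^ mi_abs \<gamma> / mi_fact \<gamma>" for \<gamma> :: "'n multi_index"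
  have E0: "E \<gamma> \<ge> 0" for \<gamma> using mi_fact_pos[of \<gamma>] by (simp add: E_def)
  have A0: "A \<ge> 0" using order_trans[OF norm_ge_zero A] .
  have Es: "E summable_on UNIV" unfolding E_def by (rule summable_on_exp_multi_index) simp
  have Psum: "(\<lambda>(\<gamma>, \<kappa>). P \<gamma> \<kappa>) summable_on UNIV \<times> UNIV"
  proof (rule summable_on_comparison)
    show "(\<lambda>(\<gamma>, \<kappa>). A * (E \<gamma> * E \<kappa>)) summable_on UNIV \<times> UNIV"
    proof (rule summable_on_SigmaI)
      show "((\<lambda>\<kappa>. case (\<gamma>, \<kappa>) of (\<gamma>, \<kappa>) \<Rightarrow> A * (E \<gamma> * E \<kappa>)) has_sum A * (E \<gamma> * infsum E UNIV)) UNIV" for \<gamma>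
        by (simp, intro has_sum_cmult_right has_sum_infsum Es)
      show "(\<lambda>\<gamma>. A * (E \<gamma> * infsum E UNIV)) summable_on UNIV"
        by (intro summable_on_cmult_right summable_on_cmult_left Es)
    qed (auto intro!: mult_nonneg_nonneg A0 E0)
    show "cmod (case b of (\<gamma>, \<kappa>) \<Rightarrow> P \<gamma> \<kappa>) \<le> (case b of (\<gamma>, \<kappa>) \<Rightarrow> A * (E \<gamma> * E \<kappa>))" for b
    proof -
      have "cmod (P \<gamma> \<kappa>) \<le> A * (E \<gamma> * E \<kappa>)" for \<gamma> \<kappa>
      proof -
        have "cmod (P \<gamma> \<kappa>) = (E \<gamma> * E \<kappa>) * cmod (a (\<lambda>j. \<alpha> j + 2 * (\<gamma> j + \<kappa> j)))"
          by (simp add: P_def norm_mult cmod_exp_coeff E_def)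
        also have "\<dots> \<le> (E \<gamma> * E \<kappa>) * A"
          by (intro mult_left_mono A mult_nonneg_nonneg E0)
        finally show ?thesis by (simp add: mult.commute)
      qed
      then show ?thesis by (cases b) simp
    qed
  qed
  let ?B = "\<lambda>\<sigma>::'n multi_index. {\<gamma>. \<forall>j. \<gamma> j \<le> \<sigma> j}"
  let ?Q = "\<lambda>\<sigma> \<gamma>. P \<gamma> (\<lambda>j. \<sigma> j - \<gamma> j)"
  \<comment> \<open>On the box below \<sigma> the truncated subtraction is exact, so pairs
    (\<sigma>, \<gamma>) with \<gamma> \<le> \<sigma> correspond to pairs (\<gamma>,
    \<kappa>).\<close>
  have bij: "bij_betw (\<lambda>(\<sigma>, \<gamma>). (\<gamma>, \<lambda>j. \<sigma> j - \<gamma> j)) (Sigma UNIV ?B) (UNIV \<times> UNIV)"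
    by (rule bij_betwI[where g = "\<lambda>(\<gamma>, \<kappa>). (\<lambda>j. \<gamma> j + \<kappa> j, \<gamma>)"]) auto
  have Qsum: "(\<lambda>(\<sigma>, \<gamma>). ?Q \<sigma> \<gamma>) summable_on Sigma UNIV ?B"
    using summable_on_reindex_bij_betw[OF bij, of "\<lambda>(\<gamma>, \<kappa>). P \<gamma> \<kappa>"] Psum by (simp add: case_prod_unfold)
  have fin: "finite (?B \<sigma>)" for \<sigma>
  proof -
    have "?B \<sigma> = PiE UNIV (\<lambda>j. {..\<sigma> j})" by (auto simp: PiE_def)
    then show ?thesis by (simp add: finite_PiE)
  qed
  have "(\<Sum>\<^sub>\<infinity>\<gamma>. exp_coeff (- c) \<gamma> * u (\<lambda>j. \<alpha> j + 2 * \<gamma> j)) = (\<Sum>\<^sub>\<infinity>\<gamma>. \<Sum>\<^sub>\<infinity>\<kappa>. P \<gamma> \<kappa>)"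
  proof -
    have "P \<gamma> \<kappa> = exp_coeff (- c) \<gamma> * (exp_coeff c \<kappa> * a (\<lambda>j. \<alpha> j + 2 * \<gamma> j + 2 * \<kappa> j))" for \<gamma> \<kappa>
      by (simp add: P_def mult.assoc distrib_left add.assoc)
    then show ?thesis
      unfolding u_def by (simp only: infsum_cmult_right')
  qed
  also have "\<dots> = (\<Sum>\<^sub>\<infinity>(\<gamma>, \<kappa>)\<in>UNIV \<times> UNIV. P \<gamma> \<kappa>)"
    by (rule infsum_Sigma'_banach[OF Psum])
  also have "\<dots> = (\<Sum>\<^sub>\<infinity>(\<sigma>, \<gamma>)\<in>Sigma UNIV ?B. ?Q \<sigma> \<gamma>)"
    using infsum_reindex_bij_betw[OF bij, of "\<lambda>(\<gamma>, \<kappa>). P \<gamma> \<kappa>"] by (simp add: case_prod_unfold)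
  also have "\<dots> = (\<Sum>\<^sub>\<infinity>\<sigma>. \<Sum>\<^sub>\<infinity>\<gamma>\<in>?B \<sigma>. ?Q \<sigma> \<gamma>)"
    by (rule infsum_Sigma'_banach[OF Qsum, symmetric])
  also have "\<dots> = (\<Sum>\<^sub>\<infinity>\<sigma>::'n multi_index. if \<sigma> = (\<lambda>_. 0) then a \<alpha> else 0)"
  proof (rule infsum_cong)
    fix \<sigma> :: "'n multi_index"
    have "(\<Sum>\<^sub>\<infinity>\<gamma>\<in>?B \<sigma>. ?Q \<sigma> \<gamma>) = (\<Sum>\<gamma>\<in>?B \<sigma>. exp_coeff (- c) \<gamma> * exp_coeff c (\<lambda>j. \<sigma> j - \<gamma> j) * a (\<lambda>j. \<alpha> j + 2 * \<sigma> j))"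
      unfolding infsum_finite[OF fin] P_def by (rule sum.cong) auto
    also have "\<dots> = (if \<sigma> = (\<lambda>_. 0) then 1 else 0) * a (\<lambda>j. \<alpha> j + 2 * \<sigma> j)"
      unfolding sum_distrib_right[symmetric] sum_exp_coeff_convolution ..
    finally show "(\<Sum>\<^sub>\<infinity>\<gamma>\<in>?B \<sigma>. ?Q \<sigma> \<gamma>) = (if \<sigma> = (\<lambda>_. 0) then a \<alpha> else 0)" by simp
  qed
  also have "\<dots> = a \<alpha>"
    by (rule infsum_If_eq)
  finally show ?thesis .
qed

text \<open>The shift by 2\<gamma> contributes r^(2|\<gamma>|), which the exponential series with
  parameter |c| r^2 absorbs; the rate r itself is preserved.\<close>

lemma exp_shift_rapidly_decreasing:
  fixes a :: "'n::finite multi_index \<Rightarrow> complex"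
  assumes "rapidly_decreasing a"
  shows "rapidly_decreasing (\<lambda>\<beta>. \<Sum>\<^sub>\<infinity>\<gamma>. exp_coeff c \<gamma> * a (\<lambda>j. \<beta> j + 2 * \<gamma> j))"
  unfolding rapidly_decreasing_def
proof (intro allI impI)
  fix r :: real assume r: "r > 0"
  then obtain C where C: "C \<ge> 0" "\<And>\<alpha>. cmod (a \<alpha>) \<le> C * r ^ mi_abs \<alpha>"
    using assms by (auto simp: rapidly_decreasing_def)
  define E where "E \<gamma> = (\<bar>c\<bar> * r\<^sup>2) ^ mi_abs \<gamma> / mi_fact \<gamma>" for \<gamma> :: "'n multi_index"
  have Es: "E summable_on UNIV" unfolding E_def by (rule summable_on_exp_multi_index) simp
  have E0: "E \<gamma> \<ge> 0" for \<gamma> using mi_fact_pos[of \<gamma>] by (simp add: E_def)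
  have "cmod (\<Sum>\<^sub>\<infinity>\<gamma>. exp_coeff c \<gamma> * a (\<lambda>j. \<beta> j + 2 * \<gamma> j)) \<le> (C * infsum E UNIV) * r ^ mi_abs \<beta>" for \<beta>
  proof -
    have "((\<lambda>\<gamma>. C * r ^ mi_abs \<beta> * E \<gamma>) has_sum C * r ^ mi_abs \<beta> * infsum E UNIV) UNIV"
      by (intro has_sum_cmult_right has_sum_infsum Es)
    note T = this
    have bnd: "cmod (exp_coeff c \<gamma> * a (\<lambda>j. \<beta> j + 2 * \<gamma> j)) \<le> C * r ^ mi_abs \<beta> * E \<gamma>" for \<gamma>
    proof -
      have "\<bar>c\<bar> ^ mi_abs \<gamma> / mi_fact \<gamma> * cmod (a (\<lambda>j. \<beta> j + 2 * \<gamma> j)) \<le>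
          \<bar>c\<bar> ^ mi_abs \<gamma> / mi_fact \<gamma> * (C * r ^ (mi_abs \<beta> + 2 * mi_abs \<gamma>))"
        using C(2)[of "\<lambda>j. \<beta> j + 2 * \<gamma> j"] mi_fact_pos[of \<gamma>]
        by (intro mult_left_mono) (simp_all add: mi_abs_add mi_abs_double)
      then show ?thesis
        by (simp add: norm_mult cmod_exp_coeff E_def power_add mult_2 mult_2_right power2_eq_square power_mult_distrib ac_simps)
    qed
    have "((\<lambda>\<gamma>. exp_coeff c \<gamma> * a (\<lambda>j. \<beta> j + 2 * \<gamma> j)) has_sum (\<Sum>\<^sub>\<infinity>\<gamma>. exp_coeff c \<gamma> * a (\<lambda>j. \<beta> j + 2 * \<gamma> j))) UNIV"
      by (intro has_sum_infsum summable_on_comparison[OF summable_on_cmult_right[OF Es] bnd])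
    then have "cmod (\<Sum>\<^sub>\<infinity>\<gamma>. exp_coeff c \<gamma> * a (\<lambda>j. \<beta> j + 2 * \<gamma> j)) \<le> C * r ^ mi_abs \<beta> * infsum E UNIV"
      by (rule norm_infsum_le[OF _ T bnd])
    then show ?thesis by (simp add: ac_simps)
  qed
  then show "\<exists>C\<ge>0. \<forall>\<alpha>. cmod (\<Sum>\<^sub>\<infinity>\<gamma>. exp_coeff c \<gamma> * a (\<lambda>j. \<alpha> j + 2 * \<gamma> j)) \<le> C * r ^ mi_abs \<alpha>"
    using C(1) infsum_nonneg[of UNIV E] E0 by (intro exI[of _ "C * infsum E UNIV"]) auto
qed

section \<open>Orthogonality of monomials and solution of the moment problem\<close>

context toric_measure
begin

text \<open>The integrand is the squared modulus of the monomial, written as the diagonal case of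
  the integrals in \<open>monomial_orthogonal\<close>.\<close>

definition radial_moment :: "'n multi_index \<Rightarrow> complex" where
  "radial_moment \<delta> = (LINT w|M. monomial \<delta> (conj_vec w) * monomial \<delta> w)"

lemma continuous_on_conj_monomial: "continuous_on A (\<lambda>w. monomial \<beta> (conj_vec w))"
  by (rule continuous_on_compose2[OF continuous_on_monomial[of UNIV] continuous_on_conj_vec]) auto

text \<open>In a coordinate k where the exponents differ, a rotation by t multiplies the integrand
  by exp(i (\<delta> k - \<beta> k) t). The angle \<open>t\<close> makes this factor -1, so the
  integral equals its own negative.\<close>

lemma monomial_orthogonal:
  assumes "\<beta> \<noteq> \<delta>"
  shows "(LINT w|M. monomial \<beta> (conj_vec w) * monomial \<delta> w) = 0"
proof -
  obtain k where k: "\<beta> k \<noteq> \<delta> k" using assms by (auto simp: fun_eq_iff)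
  define t where "t = pi / (real (\<delta> k) - real (\<beta> k))"
  define \<theta> where "\<theta> j = (if j = k then t else 0)" for j
  have cont: "continuous_on UNIV (\<lambda>w. monomial \<beta> (conj_vec w) * monomial \<delta> w)"
    by (intro continuous_intros continuous_on_monomial continuous_on_conj_monomial)
  have "monomial \<beta> (conj_vec (\<chi> j. cis (\<theta> j) * w $ j)) * monomial \<delta> (\<chi> j. cis (\<theta> j) * w $ j) =
      - (monomial \<beta> (conj_vec w) * monomial \<delta> w)" for w
  proof -
    have 1: "(\<Prod>j\<in>UNIV. cis (\<theta> j) ^ \<delta> j) = cis (real (\<delta> k) * t)"
      by (subst prod.remove[of UNIV k]) (auto simp: \<theta>_def Complex.DeMoivre intro!: prod.neutral)
    have 2: "(\<Prod>j\<in>UNIV. cis (- \<theta> j) ^ \<beta> j) = cis (- (real (\<beta> k) * t))"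
      by (subst prod.remove[of UNIV k]) (auto simp: \<theta>_def Complex.DeMoivre intro!: prod.neutral)
    have "cis (- (real (\<beta> k) * t)) * cis (real (\<delta> k) * t) = cis ((real (\<delta> k) - real (\<beta> k)) * t)"
      by (simp add: cis_mult algebra_simps)
    also have "(real (\<delta> k) - real (\<beta> k)) * t = pi" using k by (simp add: t_def)
    finally have 3: "(\<Prod>j\<in>UNIV. cis (- \<theta> j) ^ \<beta> j) * (\<Prod>j\<in>UNIV. cis (\<theta> j) ^ \<delta> j) = -1"
      by (simp add: 1 2)
    have "monomial \<beta> (conj_vec (\<chi> j. cis (\<theta> j) * w $ j)) * monomial \<delta> (\<chi> j. cis (\<theta> j) * w $ j) =
      ((\<Prod>j\<in>UNIV. cis (- \<theta> j) ^ \<beta> j) * (\<Prod>j\<in>UNIV. cis (\<theta> j) ^ \<delta> j)) * (monomial \<beta> (conj_vec w) * monomial \<delta> w)"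
      by (simp add: monomial_def conj_vec_def cis_cnj power_mult_distrib prod.distrib)
    then show ?thesis by (simp add: 3)
  qed
  then have "(LINT w|M. monomial \<beta> (conj_vec w) * monomial \<delta> w) = (LINT w|M. - (monomial \<beta> (conj_vec w) * monomial \<delta> w))"
    using integral_rotate[OF cont, of \<theta>] by simp
  then show ?thesis by simp
qed

text \<open>Only the part of M where every |w_j| is at least \<rho> is kept. This prevents the
  division by the moments from destroying the decay of the coefficients.\<close>

lemma radial_moment_lower:
  assumes "\<rho> > 0"
  shows "\<rho> ^ (2 * mi_abs \<delta>) * measure M {w. \<forall>j. \<rho> \<le> cmod (w $ j)} \<le> cmod (radial_moment \<delta>)"
proof -
  let ?S = "{w. \<forall>j. \<rho> \<le> cmod (w $ j)}"
  define m where "m w = (\<Prod>j\<in>UNIV. cmod (w $ j) ^ (2 * \<delta> j))" for w :: "complex^'n"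
  have "closed ?S"
    by (intro closed_Collect_all closed_Collect_le continuous_intros)
  then have S [measurable]: "?S \<in> sets M" unfolding sets_M by (rule borel_closed)
  have eq: "monomial \<delta> (conj_vec w) * monomial \<delta> w = of_real (m w)" for w
  proof -
    have "cnj z ^ k * z ^ k = of_real (cmod z ^ (2 * k))" for z k
    proof -
      have "cnj z ^ k * z ^ k = (z * cnj z) ^ k" by (simp add: power_mult_distrib mult.commute)
      also have "\<dots> = of_real (cmod z ^ (2 * k))" by (simp only: complex_norm_square[symmetric] power_mult of_real_power)
      finally show ?thesis .
    qed
    then show ?thesis
      by (simp add: monomial_def conj_vec_def m_def prod.distrib[symmetric])
  qed
  have m0: "m w \<ge> 0" for w by (simp add: m_def prod_nonneg)
  have "integrable M (\<lambda>w. complex_of_real (m w))"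
  proof (rule integrable_bounded_on_support)
    show "continuous_on UNIV (\<lambda>w. complex_of_real (m w))"
      unfolding m_def by (intro continuous_intros)
    show "cmod (complex_of_real (m w)) \<le> R ^ (2 * mi_abs \<delta>)" if "\<forall>j. cmod (w $ j) \<le> R" for w
    proof -
      have "m w \<le> (\<Prod>j\<in>UNIV. R ^ (2 * \<delta> j))"
        unfolding m_def by (intro prod_mono conjI power_mono) (use that in auto)
      then show ?thesis using m0[of w] by (simp add: mi_abs_double[symmetric] power_mi_abs)
    qed
  qed
  from integrable_Re[OF this] have int: "integrable M m" by simp
  have "\<rho> ^ (2 * mi_abs \<delta>) * measure M ?S = (LINT w|M. \<rho> ^ (2 * mi_abs \<delta>) * indicator ?S w)"
    by (simp add: Int_absorb2 sets.sets_into_space[OF S])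
  also have "\<dots> \<le> (LINT w|M. m w)"
  proof (rule integral_mono)
    show "integrable M (\<lambda>w. \<rho> ^ (2 * mi_abs \<delta>) * indicat_real ?S w)"
      by (intro integrable_mult_right integrable_real_indicator S) (simp add: emeasure_eq_measure)
    show "\<rho> ^ (2 * mi_abs \<delta>) * indicat_real ?S w \<le> m w" for w
    proof (cases "w \<in> ?S")
      case True
      have "(\<Prod>j\<in>UNIV. \<rho> ^ (2 * \<delta> j)) \<le> m w"
        unfolding m_def by (intro prod_mono conjI power_mono) (use True assms in auto)
      then show ?thesis using True by (simp add: mi_abs_double[symmetric] power_mi_abs)
    qed (simp add: m0)
  qed (rule int)
  also have "\<dots> = cmod (radial_moment \<delta>)"
    unfolding radial_moment_def eq by (simp add: m0 integral_nonneg_AE)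
  finally show ?thesis .
qed

text \<open>On the support of M the terms are dominated by a geometric family, so integration is
  termwise and orthogonality leaves one term.\<close>

lemma integral_power_series:
  assumes G: "rapidly_decreasing G"
  shows "(LINT w|M. (\<Sum>\<^sub>\<infinity>\<beta>. G \<beta> * monomial \<beta> (conj_vec w)) * monomial \<delta> w) = G \<delta> * radial_moment \<delta>"
proof -
  obtain C where C: "C \<ge> 0" "\<And>z \<beta>. (\<forall>j. cmod (z $ j) \<le> R) \<Longrightarrow> cmod (G \<beta> * monomial \<beta> z) \<le> C * (1 / 2) ^ mi_abs \<beta>"
    using rapidly_decreasing_monomial_bound[OF G R_pos] unfolding monomial_def by blast
  have bnd: "cmod (G \<beta> * monomial \<beta> (conj_vec w) * monomial \<delta> w) \<le> C * R ^ mi_abs \<delta> * (1 / 2) ^ mi_abs \<beta>"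
    if "\<forall>j. cmod (w $ j) \<le> R" for w \<beta>
  proof -
    have "cmod (G \<beta> * monomial \<beta> (conj_vec w)) * cmod (monomial \<delta> w) \<le> (C * (1 / 2) ^ mi_abs \<beta>) * R ^ mi_abs \<delta>"
      using that C(1) R_pos
      by (intro mult_mono C(2)) (auto simp: conj_vec_def monomial_def intro!: cmod_monomial_le)
    then show ?thesis by (simp add: norm_mult ac_simps)
  qed
  have ent: "(\<lambda>z. \<Sum>\<^sub>\<infinity>\<beta>. G \<beta> * monomial \<beta> z) \<in> entire"
    unfolding monomial_def by (rule power_series_entire[OF G])
  have cont: "continuous_on UNIV (\<lambda>w. (\<Sum>\<^sub>\<infinity>\<beta>. G \<beta> * monomial \<beta> (conj_vec w)) * monomial \<delta> w)"
    by (intro continuous_intros continuous_on_monomial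
        continuous_on_compose2[OF entire_continuous_on[OF ent, of UNIV] continuous_on_conj_vec]) auto
  have "(LINT w|M. (\<Sum>\<^sub>\<infinity>\<beta>. G \<beta> * monomial \<beta> (conj_vec w)) * monomial \<delta> w) =
      (\<Sum>\<^sub>\<infinity>\<beta>. (LINT w|M. G \<beta> * monomial \<beta> (conj_vec w) * monomial \<delta> w))"
  proof (rule integral_infsum)
    show "(\<lambda>w. G \<beta> * monomial \<beta> (conj_vec w) * monomial \<delta> w) \<in> borel_measurable M" for \<beta>
      by (intro measurable_continuous continuous_intros continuous_on_monomial continuous_on_conj_monomial)
    show "(\<lambda>\<beta>::'n multi_index. C * R ^ mi_abs \<delta> * (1 / 2) ^ mi_abs \<beta>) summable_on UNIV"
      by (intro summable_on_cmult_right summable_on_geometric_multi_index) auto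
    show "AE w in M. cmod (G \<beta> * monomial \<beta> (conj_vec w) * monomial \<delta> w) \<le> C * R ^ mi_abs \<delta> * (1 / 2) ^ mi_abs \<beta>" for \<beta>
      using bounded by eventually_elim (rule bnd)
  qed (auto intro: measurable_continuous cont simp: infsum_cmult_left')
  also have "\<dots> = (\<Sum>\<^sub>\<infinity>\<beta>. if \<beta> = \<delta> then G \<delta> * radial_moment \<delta> else 0)"
    by (rule infsum_cong) (auto simp: radial_moment_def mult.assoc monomial_orthogonal)
  also have "\<dots> = G \<delta> * radial_moment \<delta>"
    by (rule infsum_If_eq)
  finally show ?thesis .
qed

lemma exp_neg_squares_series:
  fixes w :: "complex^'n"
  shows "(\<Sum>\<^sub>\<infinity>\<gamma>. exp_coeff (- c) \<gamma> * monomial (\<lambda>j. 2 * \<gamma> j) w) = exp (- of_real c * (\<Sum>j\<in>UNIV. (w $ j)\<^sup>2))"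
proof -
  define b where "b = complex_of_real (- c)"
  have "exp_coeff (- c) \<gamma> = b ^ mi_abs \<gamma> / of_real (mi_fact \<gamma>)" for \<gamma> :: "'n multi_index"
    by (simp add: exp_coeff_def b_def)
  then have "exp_coeff (- c) \<gamma> * monomial (\<lambda>j. 2 * \<gamma> j) w = (\<Prod>j\<in>UNIV. (b * (w $ j)\<^sup>2) ^ \<gamma> j) / of_real (mi_fact \<gamma>)" for \<gamma>
    by (simp add: monomial_def power_mi_abs power_mult power_mult_distrib prod.distrib)
  then have "(\<Sum>\<^sub>\<infinity>\<gamma>. exp_coeff (- c) \<gamma> * monomial (\<lambda>j. 2 * \<gamma> j) w) = exp (\<Sum>j\<in>UNIV. b * (w $ j)\<^sup>2)"
    using infsum_exp_multi_index[of "\<lambda>j. b * (w $ j)\<^sup>2"] by simp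
  then show ?thesis
    by (simp add: b_def sum_distrib_left)
qed

text \<open>Solves the triangular system backwards: undo the shift operator on a, divide by the
  radial moments, sum the power series, and multiply by the exponential that cancels one half of
  \<open>twist\<close>.\<close>

lemma exists_entire_with_moments:
  assumes \<rho>: "\<rho> > 0" "measure M {w. \<forall>j. \<rho> \<le> cmod (w $ j)} > 0"
    and a: "rapidly_decreasing a"
  shows "\<exists>F\<in>entire. \<forall>\<alpha>. (LINT w|M. F (conj_vec w) * twist w * monomial \<alpha> w) = a \<alpha>"
proof -
  define \<mu> where "\<mu> = measure M {w. \<forall>j. \<rho> \<le> cmod (w $ j)}"
  \<comment> \<open>The moments of the untwisted function g below. The sign +1/8 is opposite to that
    of w^2 in \<open>twist\<close>.\<close>
  define u where "u \<beta> = (\<Sum>\<^sub>\<infinity>\<gamma>. exp_coeff (1 / 8) \<gamma> * a (\<lambda>j. \<beta> j + 2 * \<gamma> j))" for \<beta>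
  have u: "rapidly_decreasing u"
    unfolding u_def by (rule exp_shift_rapidly_decreasing[OF a])
  obtain A where A: "\<And>\<beta>. cmod (a \<beta>) \<le> A"
    using a[unfolded rapidly_decreasing_def, rule_format, of 1] by auto
  have inv: "(\<Sum>\<^sub>\<infinity>\<gamma>. exp_coeff (- (1 / 8)) \<gamma> * u (\<lambda>j. \<alpha> j + 2 * \<gamma> j)) = a \<alpha>" for \<alpha>
    unfolding u_def by (rule exp_shift_inverse[OF A])
  define G where "G \<beta> = u \<beta> / radial_moment \<beta>" for \<beta>
  have low: "\<rho> ^ (2 * mi_abs \<beta>) * \<mu> \<le> cmod (radial_moment \<beta>)" for \<beta>
    unfolding \<mu>_def by (rule radial_moment_lower[OF \<rho>(1)])
  have pos: "\<rho> ^ (2 * mi_abs \<beta>) * \<mu> > 0" for \<beta>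
    using \<rho> by (simp add: \<mu>_def)
  have nz: "radial_moment \<beta> \<noteq> 0" for \<beta>
    using low[of \<beta>] pos[of \<beta>] by auto
  have G: "rapidly_decreasing G"
    unfolding rapidly_decreasing_def
  proof (intro allI impI)
    fix r :: real assume r: "r > 0"
    \<comment> \<open>The rate r \<rho>^2 is chosen for u because dividing by the lower bound
      \<rho>^(2|\<beta>|) of the moments then leaves exactly r.\<close>
    then have "r * \<rho>\<^sup>2 > 0" using \<rho> by simp
    then obtain C where C: "C \<ge> 0" "\<And>\<alpha>. cmod (u \<alpha>) \<le> C * (r * \<rho>\<^sup>2) ^ mi_abs \<alpha>"
      using u unfolding rapidly_decreasing_def by blast
    have "cmod (G \<alpha>) \<le> (C / \<mu>) * r ^ mi_abs \<alpha>" for \<alpha>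
    proof -
      have "cmod (G \<alpha>) \<le> (C * (r * \<rho>\<^sup>2) ^ mi_abs \<alpha>) / (\<rho> ^ (2 * mi_abs \<alpha>) * \<mu>)"
        unfolding G_def norm_divide using C low pos[of \<alpha>] r by (intro frac_le) auto
      also have "\<dots> = (C / \<mu>) * r ^ mi_abs \<alpha>"
        using \<rho> by (simp add: power_mult_distrib mult_2 mult_2_right power_add power2_eq_square field_simps)
      finally show ?thesis .
    qed
    then show "\<exists>C\<ge>0. \<forall>\<alpha>. cmod (G \<alpha>) \<le> C * r ^ mi_abs \<alpha>"
      using C(1) \<rho> by (intro exI[of _ "C / \<mu>"]) (auto simp: \<mu>_def)
  qed
  define g where "g z = (\<Sum>\<^sub>\<infinity>\<beta>. G \<beta> * monomial \<beta> z)" for z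
  have g: "g \<in> entire"
    unfolding g_def[abs_def] monomial_def by (rule power_series_entire[OF G])
  obtain B where B: "B \<ge> 0" "\<And>z. (\<forall>j. cmod (z $ j) \<le> R) \<Longrightarrow> cmod (g z) \<le> B"
    using entire_bounded[OF g] by blast
  have gc: "continuous_on A (\<lambda>w. g (conj_vec w))" for A
    by (rule continuous_on_compose2[OF entire_continuous_on[OF g, of UNIV] continuous_on_conj_vec]) auto
  have monadd: "monomial (\<lambda>j. 2 * \<gamma> j) w * monomial \<alpha> w = monomial (\<lambda>j. \<alpha> j + 2 * \<gamma> j) w" for \<gamma> \<alpha> w
    by (simp add: monomial_def power_add prod.distrib mult.commute)
  have mom: "(LINT w|M. g (conj_vec w) * monomial \<delta> w) = u \<delta>" for \<delta>
    using integral_power_series[OF G, of \<delta>] nz[of \<delta>] by (simp add: g_def G_def)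
  \<comment> \<open>At the conjugate point this exponential cancels the factor of
    \<open>twist\<close> in the conjugate variable; only exp(-w^2/8) survives.\<close>
  define F where "F z = g z * exp (- of_real (1 / 8) * (\<Sum>j\<in>UNIV. (z $ j)\<^sup>2))" for z
  have F: "F \<in> entire"
    unfolding F_def[abs_def] by (intro entire_mult g entire_exp_power_sum)
  have "(LINT w|M. F (conj_vec w) * twist w * monomial \<alpha> w) = a \<alpha>" for \<alpha>
  proof -
    \<comment> \<open>Expanding the surviving exponential raises the index \<alpha> by 2\<gamma> in
      each term, so the integral becomes the series inverted in \<open>inv\<close>.\<close>
    have Feq: "F (conj_vec w) * twist w * monomial \<alpha> w =
        (\<Sum>\<^sub>\<infinity>\<gamma>. exp_coeff (- (1 / 8)) \<gamma> * (g (conj_vec w) * monomial (\<lambda>j. \<alpha> j + 2 * \<gamma> j) w))" for w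
    proof -
      have "F (conj_vec w) * twist w = g (conj_vec w) * exp (- of_real (1 / 8) * (\<Sum>j\<in>UNIV. (w $ j)\<^sup>2))"
        unfolding F_def twist_def mult.assoc exp_add[symmetric] by (simp add: algebra_simps)
      also have "\<dots> = (\<Sum>\<^sub>\<infinity>\<gamma>. g (conj_vec w) * (exp_coeff (- (1 / 8)) \<gamma> * monomial (\<lambda>j. 2 * \<gamma> j) w))"
        unfolding exp_neg_squares_series[symmetric] by (rule infsum_cmult_right'[symmetric])
      finally have "F (conj_vec w) * twist w * monomial \<alpha> w =
         (\<Sum>\<^sub>\<infinity>\<gamma>. g (conj_vec w) * (exp_coeff (- (1 / 8)) \<gamma> * monomial (\<lambda>j. 2 * \<gamma> j) w) * monomial \<alpha> w)"
        by (simp only: infsum_cmult_left')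
      moreover have "g (conj_vec w) * (exp_coeff (- (1 / 8)) \<gamma> * monomial (\<lambda>j. 2 * \<gamma> j) w) * monomial \<alpha> w =
          exp_coeff (- (1 / 8)) \<gamma> * (g (conj_vec w) * monomial (\<lambda>j. \<alpha> j + 2 * \<gamma> j) w)" for \<gamma>
        unfolding monadd[symmetric] by (simp only: ac_simps)
      ultimately show ?thesis by (simp only:)
    qed
    have cont: "continuous_on UNIV (\<lambda>w. F (conj_vec w) * twist w * monomial \<alpha> w)"
      using continuous_on_scaled[OF F, of UNIV \<alpha> 1] by (simp add: scaled_1 cong: continuous_on_cong)
    have "(LINT w|M. F (conj_vec w) * twist w * monomial \<alpha> w) =
       (\<Sum>\<^sub>\<infinity>\<gamma>. (LINT w|M. exp_coeff (- (1 / 8)) \<gamma> * (g (conj_vec w) * monomial (\<lambda>j. \<alpha> j + 2 * \<gamma> j) w)))"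
    proof (rule integral_infsum)
      show "(\<lambda>w. F (conj_vec w) * twist w * monomial \<alpha> w) \<in> borel_measurable M"
        by (rule measurable_continuous[OF cont])
      show "(\<lambda>w. exp_coeff (- (1 / 8)) \<gamma> * (g (conj_vec w) * monomial (\<lambda>j. \<alpha> j + 2 * \<gamma> j) w)) \<in> borel_measurable M" for \<gamma>
        by (intro measurable_continuous continuous_intros continuous_on_monomial gc)
      show "(\<lambda>\<gamma>::'n multi_index. (B * R ^ mi_abs \<alpha>) * ((1 / 8 * R\<^sup>2) ^ mi_abs \<gamma> / mi_fact \<gamma>)) summable_on UNIV"
        by (intro summable_on_cmult_right summable_on_exp_multi_index) simp
      show "AE w in M. cmod (exp_coeff (- (1 / 8)) \<gamma> * (g (conj_vec w) * monomial (\<lambda>j. \<alpha> j + 2 * \<gamma> j) w))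
          \<le> (B * R ^ mi_abs \<alpha>) * ((1 / 8 * R\<^sup>2) ^ mi_abs \<gamma> / mi_fact \<gamma>)" for \<gamma>
        using bounded
      proof eventually_elim
        case (elim w)
        have "cmod (exp_coeff (- (1 / 8)) \<gamma>) * (cmod (g (conj_vec w)) * cmod (monomial (\<lambda>j. \<alpha> j + 2 * \<gamma> j) w))
          \<le> (\<bar>- (1 / 8)\<bar> ^ mi_abs \<gamma> / mi_fact \<gamma>) * (B * R ^ mi_abs (\<lambda>j. \<alpha> j + 2 * \<gamma> j))"
          unfolding cmod_exp_coeff using elim B(1) mi_fact_pos[of \<gamma>] R_pos
          by (intro mult_mono B(2)) (auto simp: conj_vec_def monomial_def intro!: cmod_monomial_le)
        then show ?case
          by (simp add: norm_mult mi_abs_add mi_abs_double power_add mult_2 mult_2_right power2_eq_square power_mult_distrib power_divide ac_simps)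
      qed
      show "AE w in M. (\<Sum>\<^sub>\<infinity>\<gamma>. exp_coeff (- (1 / 8)) \<gamma> * (g (conj_vec w) * monomial (\<lambda>j. \<alpha> j + 2 * \<gamma> j) w))
          = F (conj_vec w) * twist w * monomial \<alpha> w"
        by (rule AE_I2) (simp only: Feq)
    qed
    also have "\<dots> = a \<alpha>"
      using inv[of \<alpha>] by (simp add: mom)
    finally show ?thesis .
  qed
  then show ?thesis using F by blast
qed

end

section \<open>Rotation invariant weights on phase space\<close>

lemma lborel_shear_fst:
  fixes T :: "'b::euclidean_space \<Rightarrow> 'a::euclidean_space"
  assumes T: "continuous_on UNIV T"
  shows "distr lborel borel (\<lambda>p. (fst p + T (snd p), snd p)) = lborel"
proof (rule measure_eqI)
  let ?s = "\<lambda>p. (fst p + T (snd p), snd p)"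
  have s: "?s \<in> borel_measurable borel"
    by (intro borel_measurable_continuous_onI continuous_intros continuous_on_compose2[OF T]) auto
  fix A :: "('a \<times> 'b) set" assume "A \<in> sets (distr lborel borel ?s)"
  then have A: "A \<in> sets borel" by simp
  have mA: "indicator A \<in> borel_measurable (lborel \<Otimes>\<^sub>M lborel :: ('a \<times> 'b) measure)"
    using A by (simp add: lborel_prod)
  have mA': "(\<lambda>p. indicator A (?s p) :: ennreal) \<in> borel_measurable (lborel \<Otimes>\<^sub>M lborel :: ('a \<times> 'b) measure)"
    using measurable_compose[OF s borel_measurable_indicator[OF A]] by (simp add: lborel_prod)
  have "emeasure (distr lborel borel ?s) A = (\<integral>\<^sup>+p. indicator A p \<partial>distr lborel borel ?s)"
    using A by simp
  also have "\<dots> = (\<integral>\<^sup>+p. indicator A (?s p) \<partial>(lborel \<Otimes>\<^sub>M lborel))"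
    using s A by (subst nn_integral_distr) (auto simp: lborel_prod)
  also have "\<dots> = (\<integral>\<^sup>+y. \<integral>\<^sup>+x. indicator A (x + T y, y) \<partial>lborel \<partial>lborel)"
    using lborel_pair.nn_integral_snd[OF mA'] by simp
  also have "\<dots> = (\<integral>\<^sup>+y. \<integral>\<^sup>+x. indicator A (x, y) \<partial>lborel \<partial>lborel)"
  proof (rule nn_integral_cong)
    fix y :: 'b
    have m: "(\<lambda>x. indicator A (x, y) :: ennreal) \<in> borel_measurable borel"
      using measurable_compose[OF _ borel_measurable_indicator[OF A], of "\<lambda>x. (x, y)" borel]
      by (auto intro: borel_measurable_continuous_onI continuous_intros)
    have "(\<integral>\<^sup>+x. indicator A (x, y) \<partial>lborel) = (\<integral>\<^sup>+x. indicator A (x, y) \<partial>distr lborel borel ((+) (T y)))"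
      by (simp add: lborel_distr_plus)
    also have "\<dots> = (\<integral>\<^sup>+x. indicator A (T y + x, y) \<partial>lborel)"
      by (rule nn_integral_distr) (use m in auto)
    finally show "(\<integral>\<^sup>+x. indicator A (x + T y, y) \<partial>lborel) = (\<integral>\<^sup>+x. (indicator A (x, y) :: ennreal) \<partial>lborel)"
      by (simp add: add.commute)
  qed
  also have "\<dots> = (\<integral>\<^sup>+p. indicator A p \<partial>(lborel \<Otimes>\<^sub>M lborel))"
    using lborel_pair.nn_integral_snd[OF mA] by simp
  also have "\<dots> = emeasure lborel A"
    using A by (simp add: lborel_prod)
  finally show "emeasure (distr lborel borel ?s) A = emeasure lborel A" .
qed simp

lemma lborel_swap:
  "distr lborel borel (\<lambda>p. (snd p, fst p)) = (lborel :: ('a::euclidean_space \<times> 'b::euclidean_space) measure)"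
proof -
  have "distr (lborel \<Otimes>\<^sub>M lborel) (lborel \<Otimes>\<^sub>M lborel) (\<lambda>(x :: 'b, y :: 'a). (y, x)) = (lborel \<Otimes>\<^sub>M lborel :: ('a \<times> 'b) measure)"
    by (rule lborel_pair.distr_pair_swap[symmetric])
  moreover have "distr lborel borel (\<lambda>p. (snd p, fst p)) =
      distr (lborel \<Otimes>\<^sub>M lborel) (lborel \<Otimes>\<^sub>M lborel) (\<lambda>(x :: 'b, y :: 'a). (y, x))"
    by (rule distr_cong) (simp_all only: lborel_prod sets_lborel case_prod_unfold)
  ultimately show ?thesis by (simp add: lborel_prod)
qed

lemma distr_lborel_compose:
  fixes f g :: "'a::euclidean_space \<Rightarrow> 'a"
  assumes "distr lborel borel f = lborel" "distr lborel borel g = lborel"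
    and "f \<in> borel_measurable borel" "g \<in> borel_measurable borel"
  shows "distr lborel borel (\<lambda>p. g (f p)) = lborel"
proof -
  have "distr lborel borel (\<lambda>p. g (f p)) = distr (distr lborel borel f) borel g"
    using assms(3,4) by (subst distr_distr) (auto simp: o_def)
  then show ?thesis by (simp add: assms)
qed

section \<open>Coordinatewise rotations of phase space\<close>

definition phase_point :: "(real^'n::finite) \<times> (real^'n) \<Rightarrow> complex^'n" where
  "phase_point p = cplx_vec (fst p) (snd p)"

lemma phase_point_nth: "phase_point p $ j = Complex (fst p $ j) (snd p $ j)"
  by (simp add: phase_point_def cplx_vec_def)

lemma continuous_on_phase_point: "continuous_on A phase_point"
  unfolding phase_point_def cplx_vec_def Complex_eq by (intro continuous_intros)

definition rotation :: "('n::finite \<Rightarrow> complex) \<Rightarrow> (real^'n) \<times> (real^'n) \<Rightarrow> (real^'n) \<times> (real^'n)" where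
  "rotation c p = (\<chi> j. Re (c j) * fst p $ j - Im (c j) * snd p $ j, \<chi> j. Im (c j) * fst p $ j + Re (c j) * snd p $ j)"

lemma phase_point_rotation: "phase_point (rotation c p) = (\<chi> j. c j * phase_point p $ j)"
  by (simp add: vec_eq_iff phase_point_nth rotation_def complex_eq_iff algebra_simps)

lemma measurable_rotation: "rotation c \<in> borel_measurable borel"
  unfolding rotation_def[abs_def] by (intro borel_measurable_continuous_onI continuous_intros)

text \<open>A rotation by an angle different from \<open>\<pi>\<close> is a product of three shears, and shears preserve
  Lebesgue measure by Fubini and translation invariance.\<close>

lemma lborel_rotation_aux:
  assumes c: "\<And>j. cmod (c j) = 1" "\<And>j. Re (c j) \<noteq> -1"
  shows "distr lborel borel (rotation c) = lborel"
proof -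
  \<comment> \<open>Minus the tangent of half the angle, the slope of the two outer shears; the
    denominator is nonzero because the angle \<pi> is excluded.\<close>
  define a where "a j = - Im (c j) / (1 + Re (c j))" for j
  define s1 where "s1 p = (fst p + (\<chi> j. a j * snd p $ j), snd p)" for p :: "(real^'a) \<times> (real^'a)"
  \<comment> \<open>Conjugating with the swap lets the lemma on shears of the first component also
    provide the middle shear, which acts on the second.\<close>
  define sw where "sw p = (snd p, fst p)" for p :: "(real^'a) \<times> (real^'a)"
  define s2 where "s2 p = (fst p + (\<chi> j. Im (c j) * snd p $ j), snd p)" for p :: "(real^'a) \<times> (real^'a)"
  have m: "s1 \<in> borel_measurable borel" "s2 \<in> borel_measurable borel" "sw \<in> borel_measurable borel"
    unfolding s1_def s2_def sw_def by (intro borel_measurable_continuous_onI continuous_intros)+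
  have d1: "distr lborel borel s1 = lborel"
    unfolding s1_def by (rule lborel_shear_fst) (intro continuous_intros)
  have d2: "distr lborel borel s2 = lborel"
    unfolding s2_def by (rule lborel_shear_fst) (intro continuous_intros)
  have dsw: "distr lborel borel sw = lborel"
    unfolding sw_def by (rule lborel_swap)
  have "rotation c p = s1 (sw (s2 (sw (s1 p))))" for p
  proof -
    have a1: "1 + Im (c j) * a j = Re (c j)" and a2: "2 * a j + Im (c j) * a j * a j = - Im (c j)" for j
    proof -
      have n: "1 + Re (c j) \<noteq> 0" using c(2)[of j] by linarith
      have "(Re (c j))\<^sup>2 + (Im (c j))\<^sup>2 = 1"
        using c(1)[of j] by (simp add: cmod_def real_sqrt_eq_1_iff)
      then have sq: "Im (c j) * Im (c j) = (1 - Re (c j)) * (1 + Re (c j))"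
        by (simp add: power2_eq_square algebra_simps)
      have "Im (c j) * a j = - (Im (c j) * Im (c j)) / (1 + Re (c j))" by (simp add: a_def)
      also have "\<dots> = - (1 - Re (c j))" unfolding sq using n by simp
      finally show *: "1 + Im (c j) * a j = Re (c j)" by simp
      have "2 * a j + Im (c j) * a j * a j = a j * (1 + (1 + Im (c j) * a j))" by (simp add: algebra_simps)
      also have "\<dots> = - Im (c j)" unfolding * using n by (simp add: a_def)
      finally show "2 * a j + Im (c j) * a j * a j = - Im (c j)" .
    qed
    have "Re (c j) * x - Im (c j) * y = x + a j * y + a j * (y + Im (c j) * (x + a j * y))" for j x y
    proof -
      have "x + a j * y + a j * (y + Im (c j) * (x + a j * y)) = (1 + Im (c j) * a j) * x + (2 * a j + Im (c j) * a j * a j) * y"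
        by (simp add: algebra_simps)
      then show ?thesis by (simp add: a1 a2)
    qed
    moreover have "Im (c j) * x + Re (c j) * y = y + Im (c j) * (x + a j * y)" for j x y
    proof -
      have "y + Im (c j) * (x + a j * y) = Im (c j) * x + (1 + Im (c j) * a j) * y"
        by (simp add: algebra_simps)
      then show ?thesis by (simp add: a1)
    qed
    ultimately show ?thesis
      by (simp add: rotation_def s1_def s2_def sw_def vec_eq_iff)
  qed
  then have r: "rotation c = (\<lambda>p. s1 (sw (s2 (sw (s1 p)))))" ..
  have e1: "distr lborel borel (\<lambda>p. sw (s1 p)) = lborel" "(\<lambda>p. sw (s1 p)) \<in> borel_measurable borel"
    by (rule distr_lborel_compose[OF d1 dsw m(1,3)]) (rule measurable_compose[OF m(1,3)])
  have e2: "distr lborel borel (\<lambda>p. s2 (sw (s1 p))) = lborel" "(\<lambda>p. s2 (sw (s1 p))) \<in> borel_measurable borel"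
    by (rule distr_lborel_compose[OF e1(1) d2 e1(2) m(2)]) (rule measurable_compose[OF e1(2) m(2)])
  have e3: "distr lborel borel (\<lambda>p. sw (s2 (sw (s1 p)))) = lborel" "(\<lambda>p. sw (s2 (sw (s1 p)))) \<in> borel_measurable borel"
    by (rule distr_lborel_compose[OF e2(1) dsw e2(2) m(3)]) (rule measurable_compose[OF e2(2) m(3)])
  show ?thesis
    unfolding r by (rule distr_lborel_compose[OF e3(1) d1 e3(2) m(1)])
qed

text \<open>The excluded angle is avoided by rotating twice by half the angle: for the principal
  argument the half-angle has non-negative cosine.\<close>

lemma lborel_rotation: "distr lborel borel (rotation (\<lambda>j. cis (\<theta> j))) = lborel"
proof -
  define \<phi> where "\<phi> j = Arg (cis (\<theta> j)) / 2" for j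
  have \<phi>: "- pi / 2 < \<phi> j" "\<phi> j \<le> pi / 2" "cis (\<phi> j) * cis (\<phi> j) = cis (\<theta> j)" for j
    using Arg_bounded[of "cis (\<theta> j)"] cis_Arg[of "cis (\<theta> j)"]
    by (auto simp: \<phi>_def cis_mult sgn_if sgn_eq)
  have "cos (\<phi> j) \<ge> 0" for j
    using \<phi>(1,2)[of j] by (intro cos_ge_zero) auto
  then have d: "distr lborel borel (rotation (\<lambda>j. cis (\<phi> j))) = lborel"
    by (intro lborel_rotation_aux) (auto simp: neq_iff intro: order.strict_trans2[of "-1" 0])
  have "rotation (\<lambda>j. cis (\<theta> j)) p = rotation (\<lambda>j. cis (\<phi> j)) (rotation (\<lambda>j. cis (\<phi> j)) p)" for p
    unfolding \<phi>(3)[symmetric] rotation_def by (simp add: vec_eq_iff algebra_simps)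
  then have "rotation (\<lambda>j. cis (\<theta> j)) = (\<lambda>p. rotation (\<lambda>j. cis (\<phi> j)) (rotation (\<lambda>j. cis (\<phi> j)) p))" ..
  then show ?thesis
    using distr_lborel_compose[OF d d measurable_rotation measurable_rotation] by simp
qed

text \<open>A representative k of \<chi>: Borel, with sign, bound and support valid at every point,
  while radiality and the lower bound are kept almost everywhere. One outer radius T and one inner
  radius s replace the two vectors of radii.\<close>

locale radial_cutoff =
  fixes k :: "(real^'n::finite) \<times> (real^'n) \<Rightarrow> real" and C T s c :: real and chi\<^sub>0 :: "real^'n \<Rightarrow> real"
  assumes k_meas [measurable]: "k \<in> borel_measurable borel"
    and k_nonneg: "0 \<le> k p" and k_le: "k p \<le> C"
    and T_pos: "T > 0"
    and k_support: "k p \<noteq> 0 \<Longrightarrow> cmod (phase_point p $ j) \<le> T"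
    and k_radial: "AE p in lborel. k p = chi\<^sub>0 (\<chi> j. cmod (phase_point p $ j))"
    and s_pos: "s > 0" and c_pos: "c > 0"
    and k_lower: "AE p in lborel. (\<forall>j. cmod (phase_point p $ j) < s) \<longrightarrow> c \<le> k p"
begin

definition weight :: "(real^'n) \<times> (real^'n) \<Rightarrow> real" where
  "weight p = k p * exp (- ((norm (fst p))\<^sup>2 + (norm (snd p))\<^sup>2) / 4)"

definition weighted_lborel :: "((real^'n) \<times> (real^'n)) measure" where
  "weighted_lborel = density lborel (\<lambda>p. ennreal (weight p))"

text \<open>The measure \<mu> of the overview, transported from phase space to complex
  coordinates.\<close>

definition M :: "(complex^'n) measure" where
  "M = distr weighted_lborel borel phase_point"

lemma C_nonneg: "C \<ge> 0"
  using order_trans[OF k_nonneg k_le] .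

lemma measurable_weight [measurable]: "weight \<in> borel_measurable borel"
proof -
  have "(\<lambda>p::(real^'n) \<times> (real^'n). exp (- ((norm (fst p))\<^sup>2 + (norm (snd p))\<^sup>2) / 4)) \<in> borel_measurable borel"
    by (intro borel_measurable_continuous_onI continuous_intros) auto
  then show ?thesis unfolding weight_def[abs_def] by measurable
qed

lemma measurable_phase_point: "phase_point \<in> borel_measurable borel"
  by (intro borel_measurable_continuous_onI continuous_on_phase_point)

lemma measurable_phase_point_weighted: "phase_point \<in> measurable weighted_lborel borel"
  unfolding weighted_lborel_def using measurable_phase_point by simp

lemma weight_nonneg: "weight p \<ge> 0"
  by (simp add: weight_def k_nonneg)

lemma norm_phase: "(norm (fst p))\<^sup>2 + (norm (snd p))\<^sup>2 = (\<Sum>j\<in>UNIV. (cmod (phase_point p $ j))\<^sup>2)"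
  unfolding norm_vec_def L2_set_def
  by (simp add: sum_nonneg phase_point_nth cmod_power2 sum.distrib)

lemma support_ball:
  fixes p :: "(real^'n) \<times> (real^'n)"
  assumes "\<And>j. cmod (phase_point p $ j) \<le> T"
  shows "p \<in> cball 0 (2 * real CARD('n) * T)"
proof -
  have "norm (fst p) \<le> (\<Sum>j\<in>UNIV. \<bar>fst p $ j\<bar>)" "norm (snd p) \<le> (\<Sum>j\<in>UNIV. \<bar>snd p $ j\<bar>)"
    by (rule norm_le_l1_cart)+
  moreover have "\<bar>fst p $ j\<bar> \<le> T" "\<bar>snd p $ j\<bar> \<le> T" for j
    using assms[of j] abs_Re_le_cmod[of "phase_point p $ j"] abs_Im_le_cmod[of "phase_point p $ j"]
    by (auto simp: phase_point_nth)
  then have "(\<Sum>j\<in>UNIV. \<bar>fst p $ j\<bar>) \<le> real CARD('n) * T" "(\<Sum>j\<in>UNIV. \<bar>snd p $ j\<bar>) \<le> real CARD('n) * T"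
    using sum_bounded_above[of UNIV "\<lambda>j. \<bar>fst p $ j\<bar>" T] sum_bounded_above[of UNIV "\<lambda>j. \<bar>snd p $ j\<bar>" T] by auto
  moreover have "norm p \<le> norm (fst p) + norm (snd p)"
    using norm_Pair_le[of "fst p" "snd p"] by simp
  ultimately show ?thesis by (simp add: mem_cball_0)
qed

lemma k_zero_outside: "p \<notin> cball 0 (2 * real CARD('n) * T) \<Longrightarrow> k p = 0"
  using support_ball k_support by blast

lemma weight_le: "weight p \<le> C * indicator (cball 0 (2 * real CARD('n) * T)) p"
proof (cases "p \<in> cball 0 (2 * real CARD('n) * T)")
  case True
  have "weight p \<le> C * 1"
    unfolding weight_def using k_le C_nonneg by (intro mult_mono) auto
  then show ?thesis using True by simp
qed (simp add: weight_def k_zero_outside)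

lemma integrable_weight: "integrable lborel weight"
proof (rule Bochner_Integration.integrable_bound)
  show "integrable lborel (\<lambda>p::(real^'n) \<times> (real^'n). C * indicator (cball 0 (2 * real CARD('n) * T)) p)"
    by (intro integrable_mult_right integrable_real_indicator emeasure_lborel_cball_finite) auto
  show "AE p in lborel. norm (weight p) \<le> norm (C * indicator (cball 0 (2 * real CARD('n) * T)) p :: real)"
    using weight_le weight_nonneg by (auto intro!: AE_I2 order_trans[OF _ abs_ge_self])
qed measurable

text \<open>Rotations preserve \<open>lborel\<close>, so the radial identity holds at almost every
  rotated point as well. At p and at its rotation the moduli agree, and the Gaussian factor depends
  on the moduli alone.\<close>

lemma weight_rotation: "AE p in lborel. weight (rotation (\<lambda>j. cis (\<theta> j)) p) = weight p"
proof -
  have "AE p in distr lborel borel (rotation (\<lambda>j. cis (\<theta> j))). k p = chi\<^sub>0 (\<chi> j. cmod (phase_point p $ j))"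
    unfolding lborel_rotation by (rule k_radial)
  then have "AE p in lborel. k (rotation (\<lambda>j. cis (\<theta> j)) p) = chi\<^sub>0 (\<chi> j. cmod (phase_point (rotation (\<lambda>j. cis (\<theta> j)) p) $ j))"
    by (rule AE_distrD[rotated]) (simp add: measurable_rotation)
  then show ?thesis
    using k_radial
    by eventually_elim (simp add: weight_def norm_phase phase_point_rotation norm_mult)
qed

lemma distr_weighted_lborel_rotation: "distr weighted_lborel borel (rotation (\<lambda>j. cis (\<theta> j))) = weighted_lborel"
proof (rule measure_eqI)
  let ?r = "rotation (\<lambda>j. cis (\<theta> j)) :: (real^'n) \<times> (real^'n) \<Rightarrow> _"
  fix A assume "A \<in> sets (distr weighted_lborel borel ?r)"
  then have A [measurable]: "A \<in> sets borel" by simp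
  have [measurable]: "?r \<in> borel_measurable borel" by (rule measurable_rotation)
  have rA: "?r -` A \<in> sets borel"
    using measurable_sets[OF measurable_rotation A] by simp
  have "emeasure (distr weighted_lborel borel ?r) A = (\<integral>\<^sup>+p. ennreal (weight p) * indicator A (?r p) \<partial>lborel)"
    using rA by (subst emeasure_distr)
      (auto simp: weighted_lborel_def emeasure_density measurable_rotation indicator_def intro!: nn_integral_cong)
  also have "\<dots> = (\<integral>\<^sup>+p. ennreal (weight (?r p)) * indicator A (?r p) \<partial>lborel)"
    using weight_rotation[of \<theta>] by (intro nn_integral_cong_AE) (auto elim!: eventually_mono)
  also have "\<dots> = (\<integral>\<^sup>+p. ennreal (weight p) * indicator A p \<partial>distr lborel borel ?r)"
    by (subst nn_integral_distr) (auto simp: measurable_rotation)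
  also have "\<dots> = emeasure weighted_lborel A"
    unfolding lborel_rotation by (simp add: weighted_lborel_def emeasure_density)
  finally show "emeasure (distr weighted_lborel borel ?r) A = emeasure weighted_lborel A" .
qed (simp add: weighted_lborel_def)

sublocale toric_measure M T
proof (intro toric_measure.intro toric_measure_axioms.intro finite_measureI)
  show "emeasure M (space M) \<noteq> \<infinity>"
  proof -
    have "emeasure M (space M) = emeasure weighted_lborel (space weighted_lborel)"
      unfolding M_def by (subst emeasure_distr[OF measurable_phase_point_weighted]) auto
    also have "\<dots> = (\<integral>\<^sup>+p. ennreal (weight p) \<partial>lborel)"
      by (simp add: weighted_lborel_def emeasure_density)
    also have "\<dots> = ennreal (LINT p|lborel. weight p)"
      by (rule nn_integral_eq_integral[OF integrable_weight]) (simp add: weight_nonneg)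
    finally show ?thesis by simp
  qed
  show "sets M = sets borel" by (simp add: M_def)
  show "T > 0" by (rule T_pos)
  show "AE w in M. \<forall>j. cmod (w $ j) \<le> T"
  proof -
    have "closed {w :: complex^'n. \<forall>j. cmod (w $ j) \<le> T}"
      by (intro closed_Collect_all closed_Collect_le continuous_intros)
    then have S: "{w :: complex^'n \<in> space borel. \<forall>j. cmod (w $ j) \<le> T} \<in> sets borel" by (simp add: borel_closed)
    have "AE p in weighted_lborel. \<forall>j. cmod (phase_point p $ j) \<le> T"
    proof -
      have "cmod (phase_point p $ j) \<le> T" if "0 < ennreal (weight p)" for p j
        using that by (intro k_support) (auto simp: weight_def)
      then show ?thesis
        unfolding weighted_lborel_def by (subst AE_density) (auto intro!: AE_I2)
    qed
    then show ?thesis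
      unfolding M_def by (subst AE_distr_iff[OF measurable_phase_point_weighted S])
  qed
  show "distr M borel (\<lambda>w. \<chi> j. cis (\<theta> j) * w $ j) = M" for \<theta>
  proof -
    let ?R = "\<lambda>w :: complex^'n. \<chi> j. cis (\<theta> j) * w $ j"
    have R: "?R \<in> borel_measurable borel"
      by (intro borel_measurable_continuous_onI continuous_intros)
    have rD: "rotation (\<lambda>j. cis (\<theta> j)) \<in> measurable weighted_lborel borel"
      unfolding weighted_lborel_def using measurable_rotation by simp
    have "distr M borel ?R = distr weighted_lborel borel (?R \<circ> phase_point)"
      unfolding M_def by (rule distr_distr[OF R measurable_phase_point_weighted])
    also have "?R \<circ> phase_point = phase_point \<circ> rotation (\<lambda>j. cis (\<theta> j))"
      by (simp add: fun_eq_iff phase_point_rotation)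
    also have "distr weighted_lborel borel \<dots> = distr (distr weighted_lborel borel (rotation (\<lambda>j. cis (\<theta> j)))) borel phase_point"
      by (rule distr_distr[OF measurable_phase_point rD, symmetric])
    finally show ?thesis unfolding distr_weighted_lborel_rotation M_def .
  qed
qed

text \<open>Otherwise the set where all moduli lie strictly between s/2 and s would be null, since
  the weight is positive almost everywhere on it. But that set is open and nonempty.\<close>

lemma M_lower: "measure M {w. \<forall>j. s / 2 \<le> cmod (w $ j)} > 0"
proof (rule ccontr)
  let ?S = "{w :: complex^'n. \<forall>j. s / 2 \<le> cmod (w $ j)}"
  assume "\<not> measure M ?S > 0"
  then have 0: "measure M ?S = 0" using measure_nonneg[of M ?S] by linarith
  have "closed ?S" by (intro closed_Collect_all closed_Collect_le continuous_intros)
  then have S: "?S \<in> sets borel" by (rule borel_closed)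
  have "emeasure M ?S = 0" using 0 by (simp add: emeasure_eq_measure)
  then have "AE w in M. w \<notin> ?S"
    using S sets_M by (intro AE_not_in null_setsI) auto
  then have "AE p in weighted_lborel. phase_point p \<notin> ?S"
    unfolding M_def by (rule AE_distrD[OF measurable_phase_point_weighted])
  then have "AE p in lborel. 0 < ennreal (weight p) \<longrightarrow> phase_point p \<notin> ?S"
    unfolding weighted_lborel_def by (subst (asm) AE_density) auto
  with k_lower have ae: "AE p in (lborel :: ((real^'n) \<times> (real^'n)) measure). \<not> (\<forall>j. s / 2 < cmod (phase_point p $ j) \<and> cmod (phase_point p $ j) < s)"
  proof eventually_elim
    case (elim p)
    show ?case
    proof
      assume *: "\<forall>j. s / 2 < cmod (phase_point p $ j) \<and> cmod (phase_point p $ j) < s"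
      then have "k p \<ge> c" using elim by auto
      then have "weight p > 0" using c_pos by (simp add: weight_def)
      with elim * show False by (auto intro: less_imp_le)
    qed
  qed
  let ?U = "{p :: (real^'n) \<times> (real^'n). \<forall>j. s / 2 < cmod (phase_point p $ j) \<and> cmod (phase_point p $ j) < s}"
  have cont: "continuous_on UNIV (\<lambda>p :: (real^'n) \<times> (real^'n). cmod (phase_point p $ j))" for j
    by (intro continuous_intros continuous_on_compose2[OF continuous_on_phase_point[of UNIV]]) auto
  have "?U = (\<Inter>j. {p. s / 2 < cmod (phase_point p $ j) \<and> cmod (phase_point p $ j) < s})" by auto
  then have "open ?U"
    by (simp only:) (intro open_INT finite ballI open_Collect_conj open_Collect_less continuous_on_const cont)
  \<comment> \<open>A point whose moduli all equal 3s/4, midway between the two bounds.\<close>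
  moreover have "(\<chi> j. 3 * s / 4, 0) \<in> ?U"
    using s_pos by (auto simp: phase_point_nth cmod_def)
  moreover have "?U \<in> null_sets lborel"
  proof -
    have "?U \<in> sets lborel" using \<open>open ?U\<close> by simp
    then show ?thesis using ae by (subst AE_iff_null_sets) auto
  qed
  then have "negligible ?U" by (rule negligible_iff_null_sets[THEN iffD2, OF null_sets_completionI])
  ultimately show False using open_not_negligible by blast
qed

lemma integral_M:
  fixes f :: "complex^'n \<Rightarrow> complex"
  assumes "f \<in> borel_measurable borel"
  shows "(LINT w|M. f w) = (LINT p|lborel. f (phase_point p) * of_real (weight p))"
proof -
  have [measurable]: "(\<lambda>p. f (phase_point p)) \<in> borel_measurable borel"
    by (rule measurable_compose[OF measurable_phase_point assms])
  have "(LINT w|M. f w) = (LINT p|weighted_lborel. f (phase_point p))"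
    unfolding M_def by (rule integral_distr[OF measurable_phase_point_weighted assms])
  also have "\<dots> = (LINT p|lborel. weight p *\<^sub>R f (phase_point p))"
    unfolding weighted_lborel_def by (rule integral_density) (auto simp: weight_nonneg)
  finally show ?thesis by (simp add: scaleR_conv_of_real mult.commute)
qed

end

text \<open>A Borel representative is clipped to the interval from 0 to \<open>max C 0\<close> and
  cut off where some modulus exceeds T. By the conditions on \<chi> this changes it on a null set
  only.\<close>

lemma R_infty_obtain_cutoff:
  fixes chi :: "complex^'n::finite \<Rightarrow> real"
  assumes "chi \<in> R_infty"
  obtains k C T s c chi\<^sub>0 where "radial_cutoff k C T s c chi\<^sub>0" "AE p in lborel. chi (phase_point p) = k p"
    "(\<lambda>p. chi (phase_point p)) \<in> borel_measurable lebesgue"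
proof -
  have cv: "(\<lambda>(x, \<xi>). f (cplx_vec x \<xi>)) = (\<lambda>p. f (phase_point p))" for f :: "complex^'n \<Rightarrow> 'b"
    by (auto simp: phase_point_def)
  from assms obtain t1 t2 :: "real^'n" where t: "\<And>j. 0 < t1 $ j" "\<And>j. t1 $ j \<le> t2 $ j" and chi: "chi \<in> R_infty2 t1 t2"
    unfolding R_infty_def by auto
  from chi have meas: "(\<lambda>p. chi (phase_point p)) \<in> borel_measurable lebesgue"
    and bdd: "\<exists>C. AE p in lebesgue. \<bar>chi (phase_point p)\<bar> \<le> C"
    and nonneg: "AE p in lebesgue. 0 \<le> chi (phase_point p)"
    and supp: "ess_support (\<lambda>p. chi (phase_point p)) \<subseteq> {p. phase_point p \<in> closure (polydisc t2)}"
    and rad: "\<exists>chi\<^sub>0 :: real^'n \<Rightarrow> real. AE p in lebesgue. chi (phase_point p) = chi\<^sub>0 (\<chi> j. cmod (phase_point p $ j))"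
    and low: "\<exists>c>0. AE p in lebesgue. phase_point p \<in> polydisc t1 \<longrightarrow> c \<le> chi (phase_point p)"
    unfolding R_infty2_def L_infty_def cv by (auto simp: case_prod_unfold phase_point_def)
  obtain C where C: "AE p in lborel. \<bar>chi (phase_point p)\<bar> \<le> C" using bdd by (auto simp: AE_completion_iff)
  obtain chi\<^sub>0 :: "real^'n \<Rightarrow> real" where rad: "AE p in lborel. chi (phase_point p) = chi\<^sub>0 (\<chi> j. cmod (phase_point p $ j))"
    using rad by (auto simp: AE_completion_iff)
  obtain c where c: "c > 0" "AE p in lborel. phase_point p \<in> polydisc t1 \<longrightarrow> c \<le> chi (phase_point p)"
    using low by (auto simp: AE_completion_iff)
  obtain k' where k' [measurable]: "k' \<in> borel_measurable borel" and kk': "AE p in lborel. chi (phase_point p) = k' p"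
    using completion_ex_borel_measurable_real[OF meas] by auto
  \<comment> \<open>The largest outer and the smallest inner radius: enlarging the outer polydisc
    and shrinking the inner one preserves the conditions.\<close>
  define T where "T = Max (range (($) t2))"
  define s where "s = Min (range (($) t1))"
  have s: "s > 0" "\<And>j. s \<le> t1 $ j" using t by (auto simp: s_def)
  have T: "\<And>j. t2 $ j \<le> T" by (auto simp: T_def)
  have Tpos: "T > 0" using s(1) s(2) t(2) T by (meson less_le_trans)
  let ?in = "\<lambda>p. \<forall>j. cmod (phase_point p $ j) \<le> T"
  define k where "k p = (if ?in p then min (max C 0) (max 0 (k' p)) else 0)" for p :: "(real^'n) \<times> (real^'n)"
  have cls: "closed {p :: (real^'n) \<times> (real^'n). ?in p}"
    by (intro closed_Collect_all closed_Collect_le continuous_intros continuous_on_compose2[OF continuous_on_phase_point[of UNIV]]) auto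
  have zero: "AE p in lborel. \<not> ?in p \<longrightarrow> chi (phase_point p) = 0"
  proof -
    have ae: "AE p in lborel. p \<notin> ess_support (\<lambda>p. chi (phase_point p)) \<longrightarrow> chi (phase_point p) = 0"
      using AE_zero_outside_ess_support[of "\<lambda>p. chi (phase_point p)"] by (simp add: AE_completion_iff)
    have cl: "closure (polydisc t2) \<subseteq> {w. \<forall>j. cmod (w $ j) \<le> T}"
    proof (rule closure_minimal)
      show "polydisc t2 \<subseteq> {w. \<forall>j. cmod (w $ j) \<le> T}"
        using T by (auto simp: polydisc_def intro: less_imp_le less_le_trans)
      show "closed {w :: complex^'n. \<forall>j. cmod (w $ j) \<le> T}"
        by (intro closed_Collect_all closed_Collect_le continuous_intros)
    qed
    show ?thesis
      using ae
    proof eventually_elim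
      case (elim p)
      show ?case
      proof
        assume "\<not> ?in p"
        then have "phase_point p \<notin> closure (polydisc t2)" using cl by auto
        then show "chi (phase_point p) = 0" using elim supp by auto
      qed
    qed
  qed
  have eq: "AE p in lborel. chi (phase_point p) = k p"
    using kk' zero C nonneg[unfolded AE_completion_iff]
    by eventually_elim (auto simp: k_def)
  show thesis
  proof (rule that[OF _ eq meas])
    show "radial_cutoff k (max C 0) T s c chi\<^sub>0"
    proof
      have "{p :: (real^'n) \<times> (real^'n). ?in p} \<in> sets borel" using cls by (rule borel_closed)
      then have i: "(indicator {p. ?in p} :: (real^'n) \<times> (real^'n) \<Rightarrow> real) \<in> borel_measurable borel"
        by (rule borel_measurable_indicator)
      have m: "(\<lambda>p. min (max C 0) (max 0 (k' p))) \<in> borel_measurable borel" by measurable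
      have "k = (\<lambda>p. indicator {p. ?in p} p * min (max C 0) (max 0 (k' p)))"
        by (simp add: k_def fun_eq_iff)
      with borel_measurable_times[OF i m] show "k \<in> borel_measurable borel" by simp
      show "AE p in lborel. k p = chi\<^sub>0 (\<chi> j. cmod (phase_point p $ j))"
        using eq rad by eventually_elim simp
      show "AE p in lborel. (\<forall>j. cmod (phase_point p $ j) < s) \<longrightarrow> c \<le> k p"
        using eq c(2) by eventually_elim (use s(2) in \<open>auto simp: polydisc_def intro: less_le_trans\<close>)
    qed (use s c Tpos in \<open>auto simp: k_def split: if_splits\<close>)
  qed
qed

context radial_cutoff
begin

text \<open>The function F of condition (2) with the representative k in place of \<chi>.\<close>

definition phase_fun :: "(complex^'n \<Rightarrow> complex) \<Rightarrow> (real^'n) \<times> (real^'n) \<Rightarrow> complex" where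
  "phase_fun F\<^sub>0 p = F\<^sub>0 (conj_vec (phase_point p)) * exp (- \<i> * complex_of_real (fst p \<bullet> snd p)) * complex_of_real (k p)"

lemma phase_fun_bounded:
  assumes F: "F\<^sub>0 \<in> entire"
  shows "\<exists>B. bounded_compact_phase_function (phase_fun F\<^sub>0) B (2 * real CARD('n) * T)"
proof -
  obtain B where B: "B \<ge> 0" "\<And>z. (\<forall>j. cmod (z $ j) \<le> T) \<Longrightarrow> cmod (F\<^sub>0 z) \<le> B"
    using entire_bounded[OF F] by blast
  have "bounded_compact_phase_function (phase_fun F\<^sub>0) (B * C) (2 * real CARD('n) * T)"
  proof
    have "(\<lambda>p. F\<^sub>0 (conj_vec (phase_point p)) * exp (- \<i> * complex_of_real (fst p \<bullet> snd p))) \<in> borel_measurable borel"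
      by (intro borel_measurable_continuous_onI continuous_intros
          continuous_on_compose2[OF entire_continuous_on[OF F, of UNIV]]
          continuous_on_compose2[OF continuous_on_conj_vec[of UNIV]] continuous_on_phase_point) auto
    then show "phase_fun F\<^sub>0 \<in> borel_measurable borel"
      unfolding phase_fun_def[abs_def] by measurable
    show "cmod (phase_fun F\<^sub>0 p) \<le> B * C * indicator (cball 0 (2 * real CARD('n) * T)) p" for p
    proof (cases "k p = 0")
      case True
      then show ?thesis using B(1) C_nonneg by (simp add: phase_fun_def)
    next
      case False
      then have sup: "\<forall>j. cmod (phase_point p $ j) \<le> T" using k_support by blast
      then have "p \<in> cball 0 (2 * real CARD('n) * T)" by (intro support_ball) auto
      moreover have "cmod (F\<^sub>0 (conj_vec (phase_point p))) * \<bar>k p\<bar> \<le> B * C"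
        using sup k_nonneg[of p] k_le[of p] B by (intro mult_mono B(2)) (auto simp: conj_vec_def)
      ultimately show ?thesis by (simp add: phase_fun_def norm_mult)
    qed
  qed
  then show ?thesis by blast
qed

text \<open>Links the analysis on phase space to the moments of M: the phase of F and the two
  exponentials of \<open>hermite_coeff_synthesis\<close> recombine into \<open>twist\<close> and the
  Gaussian part of \<open>weight\<close>.\<close>

lemma hermite_coeff_phase_fun:
  assumes F: "F\<^sub>0 \<in> entire"
  shows "hermite_coeff (stft_adjoint gauss_window (phase_fun F\<^sub>0)) \<alpha> =
    of_real ((2 ^ mi_abs \<alpha> * mi_fact \<alpha>) powr (- 1 / 2)) * (LINT w|M. F\<^sub>0 (conj_vec w) * twist w * monomial \<alpha> w)"
proof -
  obtain B where "bounded_compact_phase_function (phase_fun F\<^sub>0) B (2 * real CARD('n) * T)"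
    using phase_fun_bounded[OF F] by blast
  then interpret P: bounded_compact_phase_function "phase_fun F\<^sub>0" B "2 * real CARD('n) * T" .
  have cont: "continuous_on UNIV (\<lambda>w. F\<^sub>0 (conj_vec w) * twist w * monomial \<alpha> w)"
    using continuous_on_scaled[OF F, of UNIV \<alpha> 1] by (simp add: scaled_1 cong: continuous_on_cong)
  have "phase_fun F\<^sub>0 p * of_real (exp (- (norm (fst p))\<^sup>2 / 2)) *
      exp (\<Sum>j\<in>UNIV. (phase_point p $ j)\<^sup>2 / 4) * (\<Prod>j\<in>UNIV. (phase_point p $ j) ^ \<alpha> j) =
    F\<^sub>0 (conj_vec (phase_point p)) * twist (phase_point p) * monomial \<alpha> (phase_point p) * of_real (weight p)" for p
  proof -
    have E: "exp (- \<i> * complex_of_real (fst p \<bullet> snd p)) * of_real (exp (- (norm (fst p))\<^sup>2 / 2)) *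
        exp (\<Sum>j\<in>UNIV. (phase_point p $ j)\<^sup>2 / 4) =
      twist (phase_point p) * of_real (exp (- ((norm (fst p))\<^sup>2 + (norm (snd p))\<^sup>2) / 4))"
    proof -
      have n: "(norm x)\<^sup>2 = (\<Sum>j\<in>UNIV. (x $ j)\<^sup>2)" for x :: "real^'n"
        unfolding norm_vec_def L2_set_def by (simp add: sum_nonneg)
      \<comment> \<open>Coordinatewise both sides equal -(x^2 + y^2)/4 - i x y/2.\<close>
      have "- \<i> * complex_of_real (fst p \<bullet> snd p) + of_real (- (norm (fst p))\<^sup>2 / 2) + (\<Sum>j\<in>UNIV. (phase_point p $ j)\<^sup>2 / 4) =
        ((1 / 8) * (\<Sum>j\<in>UNIV. (conj_vec (phase_point p) $ j)\<^sup>2) - (1 / 8) * (\<Sum>j\<in>UNIV. (phase_point p $ j)\<^sup>2)) +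
          of_real (- ((norm (fst p))\<^sup>2 + (norm (snd p))\<^sup>2) / 4)" (is "?l = ?r")
      proof -
        define x y where "x j = fst p $ j" and "y j = snd p $ j" for j
        have "?l = (\<Sum>j\<in>UNIV. - \<i> * of_real (x j * y j) - of_real ((x j)\<^sup>2 / 2) + (Complex (x j) (y j))\<^sup>2 / 4)"
          unfolding n by (simp add: x_def y_def inner_vec_def phase_point_nth sum.distrib sum_subtractf sum_distrib_left sum_divide_distrib sum_negf)
        also have "\<dots> = (\<Sum>j\<in>UNIV. (1 / 8) * (cnj (Complex (x j) (y j)))\<^sup>2 - (1 / 8) * (Complex (x j) (y j))\<^sup>2 - of_real (((x j)\<^sup>2 + (y j)\<^sup>2) / 4))"
          by (rule sum.cong) (auto simp: complex_eq_iff power2_eq_square field_simps)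
        also have "\<dots> = ?r"
        proof -
          have e1: "(\<Sum>j\<in>UNIV. ((x j)\<^sup>2 + (y j)\<^sup>2) / 4) = ((norm (fst p))\<^sup>2 + (norm (snd p))\<^sup>2) / 4"
            unfolding n by (simp add: x_def y_def sum.distrib flip: sum_divide_distrib)
          have e2: "(\<Sum>j\<in>UNIV. (1 / 8) * (cnj (Complex (x j) (y j)))\<^sup>2 - (1 / 8) * (Complex (x j) (y j))\<^sup>2 - of_real (((x j)\<^sup>2 + (y j)\<^sup>2) / 4)) =
              (1 / 8) * (\<Sum>j\<in>UNIV. (cnj (Complex (x j) (y j)))\<^sup>2) - (1 / 8) * (\<Sum>j\<in>UNIV. (Complex (x j) (y j))\<^sup>2)
              - of_real (\<Sum>j\<in>UNIV. ((x j)\<^sup>2 + (y j)\<^sup>2) / 4)"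
            by (simp only: sum_subtractf sum_distrib_left of_real_sum)
          show ?thesis
            unfolding e2 e1 by (simp add: x_def y_def conj_vec_def phase_point_nth add_divide_distrib diff_divide_distrib)
        qed
        finally show ?thesis .
      qed
      then show ?thesis
        unfolding twist_def exp_of_real[symmetric] exp_add[symmetric] by simp
    qed
    have "phase_fun F\<^sub>0 p * of_real (exp (- (norm (fst p))\<^sup>2 / 2)) *
        exp (\<Sum>j\<in>UNIV. (phase_point p $ j)\<^sup>2 / 4) * (\<Prod>j\<in>UNIV. (phase_point p $ j) ^ \<alpha> j) =
      F\<^sub>0 (conj_vec (phase_point p)) * complex_of_real (k p) * monomial \<alpha> (phase_point p) *
        (exp (- \<i> * complex_of_real (fst p \<bullet> snd p)) * of_real (exp (- (norm (fst p))\<^sup>2 / 2)) *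
        exp (\<Sum>j\<in>UNIV. (phase_point p $ j)\<^sup>2 / 4))"
      by (simp only: phase_fun_def monomial_def ac_simps)
    also have "\<dots> = F\<^sub>0 (conj_vec (phase_point p)) * twist (phase_point p) * monomial \<alpha> (phase_point p) * of_real (weight p)"
      unfolding E by (simp only: weight_def of_real_mult ac_simps)
    finally show ?thesis .
  qed
  then have "(LINT p|lborel. phase_fun F\<^sub>0 p * of_real (exp (- (norm (fst p))\<^sup>2 / 2)) *
      exp (\<Sum>j\<in>UNIV. (cplx_vec (fst p) (snd p) $ j)\<^sup>2 / 4) * (\<Prod>j\<in>UNIV. (cplx_vec (fst p) (snd p) $ j) ^ \<alpha> j)) =
      (LINT w|M. F\<^sub>0 (conj_vec w) * twist w * monomial \<alpha> w)"
    using integral_M[OF borel_measurable_continuous_onI[OF cont]] by (simp add: phase_point_def)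
  then show ?thesis
    using P.hermite_coeff_synthesis[of \<alpha>] by (simp add: P.synthesis_def[abs_def])
qed

end

section \<open>The theorem\<close>

lemma schwartz_measurable:
  assumes "\<psi> \<in> schwartz"
  shows "\<psi> \<in> borel_measurable borel"
proof -
  have "iter_partial [] \<psi> differentiable (at x)" for x
    using assms unfolding schwartz_def smooth_def by blast
  then have "continuous_on UNIV \<psi>"
    by (auto simp: iter_partial_def continuous_on_eq_continuous_at intro: differentiable_imp_continuous_within)
  then show ?thesis by (rule borel_measurable_continuous_onI)
qed

lemma integrable_L2_hermite:
  fixes f :: "real^'n::finite \<Rightarrow> complex"
  assumes [measurable]: "f \<in> borel_measurable borel" and f: "integrable lborel (\<lambda>x. (cmod (f x))\<^sup>2)"
  shows "integrable lborel (\<lambda>x. f x * of_real (hermite_fun \<alpha> x))"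
proof -
  have "integrable lborel (\<lambda>x. f x * complex_of_real (\<Prod>j\<in>UNIV. exp ((x $ j)\<^sup>2 / 2) * gauss_deriv (\<alpha> j) (x $ j)))"
  proof (rule integrable_L2_mult_prod[OF _ _ f])
    show "\<exists>C. \<forall>t. \<bar>exp (t\<^sup>2 / 2) * gauss_deriv (\<alpha> j) t\<bar> \<le> C * exp (- t\<^sup>2 / 4)" for j
      using exp_half_gauss_deriv_bound by blast
  qed measurable
  from integrable_mult_right[OF this, of "of_real (hermite_const \<alpha>)"] show ?thesis
    by (simp add: hermite_fun_eq mult.left_commute[of "f _"])
qed

text \<open>Reduces to Borel representatives, which have the same coefficients; their difference is
  in L^2 with all coefficients 0.\<close>

lemma hermite_complete:
  fixes f g :: "real^'n::finite \<Rightarrow> complex"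
  assumes "f \<in> L2" "g \<in> L2" and eq: "\<And>\<alpha>. hermite_coeff f \<alpha> = hermite_coeff g \<alpha>"
  shows "AE x in lborel. f x = g x"
proof -
  have version: "\<exists>f'. f' \<in> borel_measurable borel \<and> (AE x in lborel. f x = f' x) \<and> integrable lborel (\<lambda>x. (cmod (f' x))\<^sup>2) \<and>
     (\<forall>\<alpha>. hermite_coeff f \<alpha> = (LINT x|lborel. f' x * of_real (hermite_fun \<alpha> x)))" if f: "f \<in> L2" for f :: "real^'n \<Rightarrow> complex"
  proof -
    have fm: "f \<in> borel_measurable lebesgue" and fi: "integrable lebesgue (\<lambda>x. (cmod (f x))\<^sup>2)"
      using f by (auto simp: L2_def)
    obtain f' where f' [measurable]: "f' \<in> borel_measurable borel" and ae: "AE x in lborel. f x = f' x"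
      using borel_version[OF fm] .
    have "integrable lebesgue (\<lambda>x. (cmod (f' x))\<^sup>2)"
    proof (rule integrable_cong_AE_imp[OF fi])
      show "(\<lambda>x. (cmod (f' x))\<^sup>2) \<in> borel_measurable lebesgue"
        by (rule measurable_lebesgueI) measurable
      show "AE x in lebesgue. (cmod (f x))\<^sup>2 = (cmod (f' x))\<^sup>2"
        using AE_completion[OF ae] by eventually_elim simp
    qed
    then have "integrable lborel (\<lambda>x. (cmod (f' x))\<^sup>2)"
      by (subst (asm) integrable_completion) measurable
    moreover have "hermite_coeff f \<alpha> = (LINT x|lborel. f' x * of_real (hermite_fun \<alpha> x))" for \<alpha>
    proof -
      have h: "(\<lambda>x. complex_of_real (hermite_fun \<alpha> x)) \<in> borel_measurable lebesgue"
        by (rule measurable_lebesgueI) measurable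
      show ?thesis
        unfolding hermite_coeff_def L2_inner_def complex_cnj_complex_of_real
        by (rule integral_lebesgue_cong_AE_lborel)
           (use ae in \<open>auto intro!: borel_measurable_times fm h elim!: eventually_mono\<close>)
    qed
    ultimately show ?thesis using f' ae by blast
  qed
  obtain f' where f' [measurable]: "f' \<in> borel_measurable borel" "AE x in lborel. f x = f' x" "integrable lborel (\<lambda>x. (cmod (f' x))\<^sup>2)"
     "\<And>\<alpha>. hermite_coeff f \<alpha> = (LINT x|lborel. f' x * of_real (hermite_fun \<alpha> x))"
    using version[OF assms(1)] by blast
  obtain g' where g' [measurable]: "g' \<in> borel_measurable borel" "AE x in lborel. g x = g' x" "integrable lborel (\<lambda>x. (cmod (g' x))\<^sup>2)"
     "\<And>\<alpha>. hermite_coeff g \<alpha> = (LINT x|lborel. g' x * of_real (hermite_fun \<alpha> x))"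
    using version[OF assms(2)] by blast
  have "AE x in lborel. f' x - g' x = 0"
  proof (rule hermite_complete_borel)
    show "integrable lborel (\<lambda>x. (cmod (f' x - g' x))\<^sup>2)"
    proof (rule Bochner_Integration.integrable_bound)
      show "integrable lborel (\<lambda>x. 2 * (cmod (f' x))\<^sup>2 + 2 * (cmod (g' x))\<^sup>2)"
        using f'(3) g'(3) by simp
      show "AE x in lborel. norm ((cmod (f' x - g' x))\<^sup>2) \<le> norm (2 * (cmod (f' x))\<^sup>2 + 2 * (cmod (g' x))\<^sup>2)"
      proof (rule AE_I2)
        fix x
        have "(cmod (f' x - g' x))\<^sup>2 \<le> (cmod (f' x) + cmod (g' x))\<^sup>2"
          by (intro power_mono norm_triangle_ineq4) auto
        also have "\<dots> \<le> 2 * (cmod (f' x))\<^sup>2 + 2 * (cmod (g' x))\<^sup>2"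
          using sum_squares_bound[of "cmod (f' x)" "cmod (g' x)"] by (simp add: power2_sum)
        finally show "norm ((cmod (f' x - g' x))\<^sup>2) \<le> norm (2 * (cmod (f' x))\<^sup>2 + 2 * (cmod (g' x))\<^sup>2)" by simp
      qed
    qed measurable
    show "(LINT x|lborel. (f' x - g' x) * of_real (hermite_fun \<alpha> x)) = 0" for \<alpha>
      using integrable_L2_hermite[OF f'(1,3), of \<alpha>] integrable_L2_hermite[OF g'(1,3), of \<alpha>] eq[of \<alpha>]
      by (simp add: f'(4) g'(4) left_diff_distrib)
  qed measurable
  then show ?thesis
    using f'(2) g'(2) by eventually_elim simp
qed

lemma dist_eq_fun_cong_AE:
  fixes g h :: "real^'n::finite \<Rightarrow> complex"
  assumes "dist_eq_fun f g" "AE x in lborel. g x = h x" "g \<in> borel_measurable lebesgue" "h \<in> borel_measurable lebesgue"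
  shows "dist_eq_fun f h"
proof -
  have "(LINT x|lebesgue. g x * \<psi> x) = (LINT x|lebesgue. h x * \<psi> x)" if "\<psi> \<in> schwartz" for \<psi>
  proof (rule integral_cong_AE)
    have "\<psi> \<in> borel_measurable lebesgue" by (rule measurable_lebesgueI[OF schwartz_measurable[OF that]])
    then show "(\<lambda>x. g x * \<psi> x) \<in> borel_measurable lebesgue" "(\<lambda>x. h x * \<psi> x) \<in> borel_measurable lebesgue"
      using assms(3,4) by (auto intro: borel_measurable_times)
    show "AE x in lebesgue. g x * \<psi> x = h x * \<psi> x"
      using AE_completion[OF assms(2)] by eventually_elim simp
  qed
  with assms(1) show ?thesis by (simp add: dist_eq_fun_def)
qed

text \<open>At each x the integral sees F only modulo null sets, so the two transforms agree at
  every point.\<close>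

lemma stft_adjoint_cong_AE:
  fixes F F' :: "(real^'n::finite) \<times> (real^'n) \<Rightarrow> complex"
  assumes "AE p in lborel. F p = F' p" "F' \<in> borel_measurable borel" "F \<in> borel_measurable lebesgue"
  shows "stft_adjoint gauss_window F = stft_adjoint gauss_window F'"
proof
  fix x :: "real^'n"
  have g: "(\<lambda>p. gauss_window (x - fst p) * exp (\<i> * complex_of_real (x \<bullet> snd p))) \<in> borel_measurable lebesgue"
    unfolding gauss_window_def by (intro measurable_lebesgueI borel_measurable_continuous_onI continuous_intros) auto
  have "(LINT p|lebesgue. F p * (gauss_window (x - fst p) * exp (\<i> * complex_of_real (x \<bullet> snd p)))) =
    (LINT p|lebesgue. F' p * (gauss_window (x - fst p) * exp (\<i> * complex_of_real (x \<bullet> snd p))))"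
    by (rule integral_cong_AE)
       (use AE_completion[OF assms(1)] in \<open>auto intro!: borel_measurable_times g assms(3) measurable_lebesgueI[OF assms(2)] elim!: eventually_mono\<close>)
  then show "stft_adjoint gauss_window F x = stft_adjoint gauss_window F' x"
    by (simp add: stft_adjoint_def case_prod_unfold mult.assoc)
qed

lemma compact_ess_support:
  fixes F :: "'a::euclidean_space \<Rightarrow> 'b::zero"
  assumes "AE p in lebesgue. p \<notin> cball 0 r \<longrightarrow> F p = 0"
  shows "compact (ess_support F)"
proof -
  have "closed (ess_support F)"
    unfolding ess_support_def by (intro closed_Compl open_Union) auto
  moreover have "ess_support F \<subseteq> cball 0 r"
  proof (rule ccontr)
    assume "\<not> ess_support F \<subseteq> cball 0 r"
    then obtain x where x: "x \<in> ess_support F" "x \<in> - cball 0 r" by blast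
    have "open (- cball 0 r :: 'a set)" by (intro open_Compl closed_cball)
    moreover have "AE p in lebesgue. p \<in> - cball 0 r \<longrightarrow> F p = 0" using assms by simp
    ultimately show False using x unfolding ess_support_def by blast
  qed
  ultimately show ?thesis
    by (metis bounded_cball bounded_subset compact_eq_bounded_closed)
qed

lemma mi_power_ge:
  assumes "\<And>j. c \<le> r $ j" "c \<ge> 0"
  shows "c ^ mi_abs \<alpha> \<le> mi_power r \<alpha>"
  unfolding mi_power_def power_mi_abs using assms by (intro prod_mono conjI power_mono) auto

lemma rapidly_decreasing_imp_H0_flat1:
  fixes g :: "real^'n::finite \<Rightarrow> complex"
  assumes "g \<in> L2" "rapidly_decreasing b"
    and hc: "\<And>\<alpha>. hermite_coeff g \<alpha> = of_real ((2 ^ mi_abs \<alpha> * mi_fact \<alpha>) powr (- 1 / 2)) * b \<alpha>"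
  shows "g \<in> H0_flat1"
proof -
  have "\<exists>C>0. \<forall>\<alpha>. cmod (hermite_coeff g \<alpha>) \<le> C * (mi_power r \<alpha> * mi_fact \<alpha> powr (- 1 / 2))"
    if r: "\<forall>j. 0 < r $ j" for r
  proof -
    \<comment> \<open>The smallest coordinate of r turns the single-radius decay of b into the bound
      with the monomial in r; the factor 2^(-|\<alpha>|/2) is at most 1 and is dropped.\<close>
    define c where "c = Min (range (($) r))"
    have c: "c > 0" "\<And>j. c \<le> r $ j" using r by (auto simp: c_def)
    obtain C where C: "C \<ge> 0" "\<And>\<alpha>. cmod (b \<alpha>) \<le> C * c ^ mi_abs \<alpha>"
      using assms(2) c(1) unfolding rapidly_decreasing_def by blast
    \<comment> \<open>The constant C may be 0, whereas \<open>H0_flat1\<close> asks for a positive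
      one, hence C + 1.\<close>
    have "cmod (hermite_coeff g \<alpha>) \<le> (C + 1) * (mi_power r \<alpha> * mi_fact \<alpha> powr (- 1 / 2))" for \<alpha>
    proof -
      have "(2 ^ mi_abs \<alpha> * mi_fact \<alpha>) powr (- 1 / 2) \<le> mi_fact \<alpha> powr (- 1 / 2)"
        using mi_fact_pos[of \<alpha>] by (intro powr_mono2') auto
      moreover have "cmod (b \<alpha>) \<le> (C + 1) * mi_power r \<alpha>"
        using C mi_power_ge[of c r \<alpha>] c by (intro order_trans[OF C(2)] mult_mono) auto
      ultimately have "(2 ^ mi_abs \<alpha> * mi_fact \<alpha>) powr (- 1 / 2) * cmod (b \<alpha>) \<le> mi_fact \<alpha> powr (- 1 / 2) * ((C + 1) * mi_power r \<alpha>)"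
        by (intro mult_mono) auto
      then show ?thesis by (simp add: hc norm_mult ac_simps)
    qed
    then show ?thesis using C(1) by (intro exI[of _ "C + 1"]) auto
  qed
  then show ?thesis using assms(1) by (simp add: H0_flat1_def)
qed

lemma H0_flat1_imp_rapidly_decreasing:
  fixes g :: "real^'n::finite \<Rightarrow> complex"
  assumes "g \<in> H0_flat1"
  shows "rapidly_decreasing (\<lambda>\<alpha>. of_real ((2 ^ mi_abs \<alpha> * mi_fact \<alpha>) powr (1 / 2)) * hermite_coeff g \<alpha>)"
  unfolding rapidly_decreasing_def
proof (intro allI impI)
  fix r :: real assume r: "r > 0"
  \<comment> \<open>Half the radius pays for the factor 2^(|\<alpha>|/2), bounded here by
    2^|\<alpha>|.\<close>
  define v where "v = (\<chi> j::'n. r / 2)"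
  have "\<forall>j. 0 < v $ j" using r by (simp add: v_def)
  then obtain C where C: "C > 0" "\<And>\<alpha>. cmod (hermite_coeff g \<alpha>) \<le> C * (mi_power v \<alpha> * mi_fact \<alpha> powr (- 1 / 2))"
    using assms unfolding H0_flat1_def by blast
  have "cmod (of_real ((2 ^ mi_abs \<alpha> * mi_fact \<alpha>) powr (1 / 2)) * hermite_coeff g \<alpha>) \<le> C * r ^ mi_abs \<alpha>" for \<alpha>
  proof -
    have f: "mi_fact \<alpha> powr (1 / 2) * mi_fact \<alpha> powr (- 1 / 2) = 1"
      using mi_fact_pos[of \<alpha>] by (simp flip: powr_add)
    have two: "(2 ^ mi_abs \<alpha>) powr (1 / 2) \<le> (2 :: real) ^ mi_abs \<alpha>"
      using powr_mono[of "1 / 2" 1 "(2 :: real) ^ mi_abs \<alpha>"] by simp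
    have v: "mi_power v \<alpha> = (r / 2) ^ mi_abs \<alpha>" by (simp add: mi_power_def v_def power_mi_abs)
    have "(2 ^ mi_abs \<alpha> * mi_fact \<alpha>) powr (1 / 2) = (2 ^ mi_abs \<alpha>) powr (1 / 2) * mi_fact \<alpha> powr (1 / 2)"
      using mi_fact_pos[of \<alpha>] by (simp add: powr_mult)
    then have "cmod (of_real ((2 ^ mi_abs \<alpha> * mi_fact \<alpha>) powr (1 / 2)) * hermite_coeff g \<alpha>) =
        (2 ^ mi_abs \<alpha>) powr (1 / 2) * mi_fact \<alpha> powr (1 / 2) * cmod (hermite_coeff g \<alpha>)"
      by (simp add: norm_mult)
    also have "\<dots> \<le> 2 ^ mi_abs \<alpha> * mi_fact \<alpha> powr (1 / 2) * (C * ((r / 2) ^ mi_abs \<alpha> * mi_fact \<alpha> powr (- 1 / 2)))"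
      using C(2)[of \<alpha>] two unfolding v by (intro mult_mono) auto
    also have "\<dots> = C * (2 * (r / 2)) ^ mi_abs \<alpha> * (mi_fact \<alpha> powr (1 / 2) * mi_fact \<alpha> powr (- 1 / 2))"
      by (simp only: power_mult_distrib ac_simps)
    finally show ?thesis unfolding f by simp
  qed
  then show "\<exists>C\<ge>0. \<forall>\<alpha>. cmod (of_real ((2 ^ mi_abs \<alpha> * mi_fact \<alpha>) powr (1 / 2)) * hermite_coeff g \<alpha>) \<le> C * r ^ mi_abs \<alpha>"
    using C(1) by (intro exI[of _ C]) auto
qed

lemma conj_vec_phase_point: "conj_vec (phase_point p) = cplx_vec (fst p) (- snd p)"
  by (simp add: vec_eq_iff conj_vec_def phase_point_nth cplx_vec_def complex_eq_iff)

theorem proposition4p4: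
  fixes chi :: "complex^'n::finite \<Rightarrow> real"
    and f :: "(real^'n \<Rightarrow> complex) \<Rightarrow> complex"
  assumes "chi \<in> R_infty"
    and "tempered_distribution f"
  shows "(\<exists>g \<in> H0_flat1. dist_eq_fun f g) \<longleftrightarrow>
    (\<exists>F \<in> L_infty. compact (ess_support F) \<and>
       dist_eq_fun f (stft_adjoint gauss_window F) \<and>
       (\<exists>F\<^sub>0 \<in> entire. AE (x, \<xi>) in lebesgue.
          F (x, \<xi>) = F\<^sub>0 (cplx_vec x (- \<xi>)) * exp (- \<i> * complex_of_real (x \<bullet> \<xi>))
            * complex_of_real (chi (cplx_vec x \<xi>))))"
    (is "?H \<longleftrightarrow> ?F")
proof -
  obtain k C T s c chi\<^sub>0 where "radial_cutoff k C T s c chi\<^sub>0" and chik: "AE p in lborel. chi (phase_point p) = k p"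
    and chim: "(\<lambda>p. chi (phase_point p)) \<in> borel_measurable lebesgue"
    using R_infty_obtain_cutoff[OF assms(1)] .
  then interpret radial_cutoff k C T s c chi\<^sub>0 by simp
  \<comment> \<open>The right-hand side of condition (2) taken literally with \<chi>. It agrees
    almost everywhere with \<open>phase_fun\<close>, for which the estimates are available.\<close>
  define lit where "lit F\<^sub>0 p = F\<^sub>0 (cplx_vec (fst p) (- snd p)) * exp (- \<i> * complex_of_real (fst p \<bullet> snd p))
      * complex_of_real (chi (cplx_vec (fst p) (snd p)))" for F\<^sub>0 and p :: "(real^'n) \<times> (real^'n)"
  have lit: "AE p in lborel. lit F\<^sub>0 p = phase_fun F\<^sub>0 p" for F\<^sub>0
    using chik by eventually_elim (simp add: lit_def phase_fun_def conj_vec_phase_point flip: phase_point_def)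
  have S_L2: "stft_adjoint gauss_window (phase_fun F\<^sub>0) \<in> L2"
    and pm: "phase_fun F\<^sub>0 \<in> borel_measurable borel"
    and pb: "\<exists>B. \<forall>p. cmod (phase_fun F\<^sub>0 p) \<le> B * indicator (cball 0 (2 * real CARD('n) * T)) p"
    if F: "F\<^sub>0 \<in> entire" for F\<^sub>0
  proof -
    obtain B where "bounded_compact_phase_function (phase_fun F\<^sub>0) B (2 * real CARD('n) * T)"
      using phase_fun_bounded[OF F] by blast
    then interpret P: bounded_compact_phase_function "phase_fun F\<^sub>0" B "2 * real CARD('n) * T" .
    show "stft_adjoint gauss_window (phase_fun F\<^sub>0) \<in> L2"
      using P.synthesis_in_L2 by (simp add: P.synthesis_def[abs_def])
    show "phase_fun F\<^sub>0 \<in> borel_measurable borel" by (rule P.meas)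
    show "\<exists>B. \<forall>p. cmod (phase_fun F\<^sub>0 p) \<le> B * indicator (cball 0 (2 * real CARD('n) * T)) p"
      using P.bound by blast
  qed
  show ?thesis
  proof
    assume ?F
    then obtain F F\<^sub>0 where F: "F \<in> L_infty" "dist_eq_fun f (stft_adjoint gauss_window F)" "F\<^sub>0 \<in> entire"
      and ae: "AE (x, \<xi>) in lebesgue.
          F (x, \<xi>) = F\<^sub>0 (cplx_vec x (- \<xi>)) * exp (- \<i> * complex_of_real (x \<bullet> \<xi>))
            * complex_of_real (chi (cplx_vec x \<xi>))" by blast
    from ae have "AE p in lborel. F p = lit F\<^sub>0 p"
      by (simp add: AE_completion_iff lit_def case_prod_unfold)
    then have "AE p in lborel. F p = phase_fun F\<^sub>0 p"
      using lit[of F\<^sub>0] by eventually_elim simp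
    moreover have "F \<in> borel_measurable lebesgue" using F(1) by (simp add: L_infty_def)
    ultimately have "stft_adjoint gauss_window F = stft_adjoint gauss_window (phase_fun F\<^sub>0)"
      by (intro stft_adjoint_cong_AE pm F(3))
    moreover have "stft_adjoint gauss_window (phase_fun F\<^sub>0) \<in> H0_flat1"
      by (rule rapidly_decreasing_imp_H0_flat1[OF S_L2[OF F(3)] moments_rapidly_decreasing[OF F(3)]])
         (rule hermite_coeff_phase_fun[OF F(3)])
    ultimately show ?H using F(2) by auto
  next
    assume ?H
    then obtain g where g: "g \<in> H0_flat1" "dist_eq_fun f g" by blast
    then have gL: "g \<in> L2" by (simp add: H0_flat1_def)
    \<comment> \<open>The moments are prescribed as the rescaled Hermite coefficients of g, so the
      synthesised function and g have equal coefficients and coincide almost everywhere.\<close>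
    obtain F\<^sub>0 where F\<^sub>0: "F\<^sub>0 \<in> entire" and mom: "\<And>\<alpha>. (LINT w|M. F\<^sub>0 (conj_vec w) * twist w * monomial \<alpha> w) =
        of_real ((2 ^ mi_abs \<alpha> * mi_fact \<alpha>) powr (1 / 2)) * hermite_coeff g \<alpha>"
      using exists_entire_with_moments[OF _ M_lower H0_flat1_imp_rapidly_decreasing[OF g(1)]] s_pos by auto
    let ?S = "stft_adjoint gauss_window (phase_fun F\<^sub>0)"
    have "hermite_coeff g \<alpha> = hermite_coeff ?S \<alpha>" for \<alpha>
    proof -
      have "(2 ^ mi_abs \<alpha> * mi_fact \<alpha>) powr (- 1 / 2) * (2 ^ mi_abs \<alpha> * mi_fact \<alpha>) powr (1 / 2) = 1"
        using mi_fact_pos[of \<alpha>] by (simp flip: powr_add)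
      then show ?thesis
        unfolding hermite_coeff_phase_fun[OF F\<^sub>0] mom mult.assoc[symmetric] of_real_mult[symmetric] by simp
    qed
    then have "AE x in lborel. g x = ?S x"
      by (rule hermite_complete[OF gL S_L2[OF F\<^sub>0]])
    then have distS: "dist_eq_fun f ?S"
      using gL S_L2[OF F\<^sub>0] by (intro dist_eq_fun_cong_AE[OF g(2)]) (auto simp: L2_def)
    \<comment> \<open>With \<open>lit\<close> as witness the required form holds identically;
      boundedness, compact support and the transform are inherited from
      \<open>phase_fun\<close>.\<close>
    let ?G = "lit F\<^sub>0"
    have Gm: "?G \<in> borel_measurable lebesgue"
    proof -
      have "(\<lambda>p. F\<^sub>0 (conj_vec (phase_point p)) * exp (- \<i> * complex_of_real (fst p \<bullet> snd p))) \<in> borel_measurable lebesgue"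
        by (intro measurable_lebesgueI borel_measurable_continuous_onI continuous_intros
          continuous_on_compose2[OF entire_continuous_on[OF F\<^sub>0, of UNIV]]
          continuous_on_compose2[OF continuous_on_conj_vec[of UNIV]] continuous_on_phase_point) auto
      moreover have "(\<lambda>p. complex_of_real (chi (phase_point p))) \<in> borel_measurable lebesgue"
        using chim by measurable
      ultimately show ?thesis
        unfolding lit_def[abs_def] conj_vec_phase_point[symmetric] phase_point_def[symmetric] by (rule borel_measurable_times)
    qed
    obtain B where B: "\<And>p. cmod (phase_fun F\<^sub>0 p) \<le> B * indicator (cball 0 (2 * real CARD('n) * T)) p"
      using pb[OF F\<^sub>0] by blast
    have "AE p in lebesgue. cmod (?G p) \<le> \<bar>B\<bar>"
      using AE_completion[OF lit[of F\<^sub>0]]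
    proof eventually_elim
      case (elim p)
      have "cmod (?G p) \<le> B * indicator (cball 0 (2 * real CARD('n) * T)) p" unfolding elim by (rule B)
      also have "\<dots> \<le> \<bar>B\<bar>" by (auto simp: indicator_def)
      finally show ?case .
    qed
    then have "?G \<in> L_infty" using Gm by (auto simp: L_infty_def)
    moreover have "compact (ess_support ?G)"
    proof (rule compact_ess_support)
      show "AE p in lebesgue. p \<notin> cball 0 (2 * real CARD('n) * T) \<longrightarrow> ?G p = 0"
        using AE_completion[OF lit[of F\<^sub>0]]
      proof eventually_elim
        case (elim p)
        then show ?case using B[of p] by (auto simp: indicator_def)
      qed
    qed
    moreover have "stft_adjoint gauss_window ?G = ?S"
      by (rule stft_adjoint_cong_AE[OF lit pm[OF F\<^sub>0] Gm])
    moreover have "AE (x, \<xi>) in lebesgue.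
          ?G (x, \<xi>) = F\<^sub>0 (cplx_vec x (- \<xi>)) * exp (- \<i> * complex_of_real (x \<bullet> \<xi>))
            * complex_of_real (chi (cplx_vec x \<xi>))"
      by (simp add: lit_def case_prod_unfold)
    ultimately show ?F using distS F\<^sub>0 by (intro bexI[of _ ?G]) auto
  qed
qed

end
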